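(* Let $M$ and $N$ be infinite metric spaces such that at least one of the following conditions holds: (1) at least one of the spaces $M$ and $N$ is not separable, or (2) $M$ is countable, or (3) $M$ is scattered, or (4) $M$ is not $\sigma$-compact, or (5) $\mathcal{F}(N)$ has the Schur property, or (6) $\mathcal{F}(N)$ isomorphically embeds into some separable space $L_1(\Omega,\Sigma,\mu)$. Then the spaces $C_p(M)$ and $\mathcal{F}(N)_w$ are not homeomorphic.
   Context: All vector spaces are real. $C_p(M)$ is the set of all continuous real-valued functions on $M$ endowed with the topology of pointwise convergence (inherited from $\mathbb{R}^M$). For a metric space $(N,\rho)$ with a distinguished base point $e$, $\mathrm{Lip}_0(N)$ is the Banach space of all Lipschitz functions $f\colon N\to\mathbb{R}$ with $f(e)=0$, with norm $\|f\|=\mathrm{Lip}(f)=\sup_{x\neq y}|f(x)-f(y)|/\rho(x,y)$. The Lipschitz-free space $\mathcal{F}(N)$ is the norm closure in the dual $\mathrm{Lip}_0(N)^*$ of the linear span of the evaluation functionals $\delta_x\colon f\mapsto f(x)$, $x\in N$. For a Banach space $E$, $E_w$ denotes $E$ endowed with its weak topology. A Banach space has the Schur property if every weakly convergent sequence in it is norm convergent. A topological space is scattered if each of its non-empty subspaces has an isolated point. *)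

theory Defs
  imports "HOL-Analysis.Analysis"
begin

section \<open>Function spaces with the pointwise topology\<close>

definition C_p :: "('a::topological_space \<Rightarrow> real) topology"
  where "C_p = subtopology (product_topology (\<lambda>_. euclideanreal) UNIV) {f. continuous_on UNIV f}"

section \<open>The space of Lipschitz functions vanishing at the base point\<close>

text \<open>The base point is a parameter of the type class, on which no axiom is imposed.
  A statement about all types of this class is thus a statement about all metric spaces and
  all choices of the base point.\<close>

class pointed_metric_space = metric_space +
  fixes base_point :: 'a

typedef (overloaded) 'a lip0 =
  "{f :: 'a::pointed_metric_space \<Rightarrow> real. (\<exists>L. L-lipschitz_on UNIV f) \<and> f base_point = 0}"
  morphisms apply_lip0 Abs_lip0
proof
  show "(\<lambda>_. 0) \<in> {f :: 'a \<Rightarrow> real. (\<exists>L. L-lipschitz_on UNIV f) \<and> f base_point = 0}"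
    by (auto intro!: exI[of _ 0] lipschitz_onI)
qed

setup_lifting type_definition_lip0

lemma apply_lip0_lipschitz: "\<exists>L. L-lipschitz_on UNIV (apply_lip0 f)"
  using apply_lip0[of f] by auto

lemma apply_lip0_base_point [simp]: "apply_lip0 f base_point = 0"
  using apply_lip0[of f] by auto

instantiation lip0 :: (pointed_metric_space) real_vector
begin

lift_definition zero_lip0 :: "'a lip0" is "\<lambda>_. 0"
  by (auto intro!: exI[of _ 0] lipschitz_onI)

lift_definition plus_lip0 :: "'a lip0 \<Rightarrow> 'a lip0 \<Rightarrow> 'a lip0" is "\<lambda>f g x. f x + g x"
  by (auto intro: lipschitz_on_add)

lift_definition uminus_lip0 :: "'a lip0 \<Rightarrow> 'a lip0" is "\<lambda>f x. - f x"
  by auto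

lift_definition minus_lip0 :: "'a lip0 \<Rightarrow> 'a lip0 \<Rightarrow> 'a lip0" is "\<lambda>f g x. f x - g x"
  by (auto intro: lipschitz_on_diff)

lift_definition scaleR_lip0 :: "real \<Rightarrow> 'a lip0 \<Rightarrow> 'a lip0" is "\<lambda>c f x. c *\<^sub>R f x"
  by (auto dest: lipschitz_on_cmult_real)

instance
  by standard (transfer, auto simp: fun_eq_iff algebra_simps)+

end

text \<open>As \<^term>\<open>x / 0 = 0\<close>, the diagonal pairs contribute \<^term>\<open>0\<close> to the supremum below: it is the
  supremum over \<^term>\<open>x \<noteq> y\<close>, with the correct value \<^term>\<open>0\<close> on a one-point space.\<close>

instantiation lip0 :: (pointed_metric_space) real_normed_vector
begin

definition norm_lip0 :: "'a lip0 \<Rightarrow> real"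
  where "norm_lip0 f = (SUP (x, y). \<bar>apply_lip0 f x - apply_lip0 f y\<bar> / dist x y)"

definition sgn_lip0 :: "'a lip0 \<Rightarrow> 'a lip0"
  where "sgn_lip0 f = f /\<^sub>R norm f"

definition dist_lip0 :: "'a lip0 \<Rightarrow> 'a lip0 \<Rightarrow> real"
  where "dist_lip0 f g = norm (f - g)"

definition uniformity_lip0 :: "('a lip0 \<times> 'a lip0) filter"
  where "uniformity_lip0 = (INF e\<in>{0 <..}. principal {(x, y). dist x y < e})"

definition open_lip0 :: "'a lip0 set \<Rightarrow> bool"
  where "open_lip0 S = (\<forall>x\<in>S. \<forall>\<^sub>F (x', y) in uniformity. x' = x \<longrightarrow> y \<in> S)"

lemma lip0_bdd_above:
  fixes f :: "'a lip0"
  shows "bdd_above (range (\<lambda>(x, y). \<bar>apply_lip0 f x - apply_lip0 f y\<bar> / dist x y))"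
proof -
  obtain L where L: "L-lipschitz_on UNIV (apply_lip0 f)"
    using apply_lip0_lipschitz by blast
  have "\<bar>apply_lip0 f x - apply_lip0 f y\<bar> / dist x y \<le> L" for x y
    using lipschitz_onD[OF L, of x y] lipschitz_on_nonneg[OF L]
    by (cases "x = y") (auto simp: dist_real_def divide_le_eq)
  then show ?thesis
    by (intro bdd_aboveI[of _ L]) auto
qed

lemma lip0_bound:
  fixes f :: "'a lip0"
  shows "\<bar>apply_lip0 f x - apply_lip0 f y\<bar> \<le> norm f * dist x y"
proof (cases "x = y")
  case False
  have "\<bar>apply_lip0 f x - apply_lip0 f y\<bar> / dist x y \<le> norm f"
    unfolding norm_lip0_def using cSUP_upper[OF UNIV_I lip0_bdd_above, of f "(x, y)"] by simp
  with False show ?thesis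
    by (simp add: divide_le_eq)
qed simp

lemma lip0_norm_leI:
  fixes f :: "'a lip0"
  assumes "\<And>x y. \<bar>apply_lip0 f x - apply_lip0 f y\<bar> \<le> K * dist x y" "0 \<le> K"
  shows "norm f \<le> K"
  unfolding norm_lip0_def
proof (rule cSUP_least)
  show "(case p of (x, y) \<Rightarrow> \<bar>apply_lip0 f x - apply_lip0 f y\<bar> / dist x y) \<le> K" for p
    using assms by (cases p, cases "fst p = snd p") (auto simp: divide_le_eq)
qed simp

lemma lip0_norm_nonneg: "0 \<le> norm (f :: 'a lip0)"
  unfolding norm_lip0_def
  using cSUP_upper[OF UNIV_I lip0_bdd_above, of f "(base_point, base_point)"] by simp

instance
proof
  fix f g :: "'a lip0" and c :: real
  show "norm f = 0 \<longleftrightarrow> f = 0"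
  proof
    assume "norm f = 0"
    then have "apply_lip0 f x = 0" for x
      using lip0_bound[of f x base_point] by simp
    then show "f = 0"
      by transfer auto
  next
    assume "f = 0"
    then have "norm f \<le> 0"
      by (intro lip0_norm_leI) (simp_all add: zero_lip0.rep_eq)
    then show "norm f = 0"
      using lip0_norm_nonneg[of f] by simp
  qed
  show "norm (f + g) \<le> norm f + norm g"
  proof (rule lip0_norm_leI)
    fix x y
    show "\<bar>apply_lip0 (f + g) x - apply_lip0 (f + g) y\<bar> \<le> (norm f + norm g) * dist x y"
      using lip0_bound[of f x y] lip0_bound[of g x y]
      by (simp add: plus_lip0.rep_eq algebra_simps)
  qed (simp add: lip0_norm_nonneg)
  have le: "norm (a *\<^sub>R h) \<le> \<bar>a\<bar> * norm h" for a and h :: "'a lip0"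
  proof (rule lip0_norm_leI)
    fix x y
    show "\<bar>apply_lip0 (a *\<^sub>R h) x - apply_lip0 (a *\<^sub>R h) y\<bar> \<le> \<bar>a\<bar> * norm h * dist x y"
      using mult_left_mono[OF lip0_bound[of h x y] abs_ge_zero[of a]]
      by (simp add: scaleR_lip0.rep_eq abs_mult[symmetric] right_diff_distrib mult.assoc)
  qed (simp add: lip0_norm_nonneg)
  show "norm (c *\<^sub>R f) = \<bar>c\<bar> * norm f"
  proof (cases "c = 0")
    case True
    then show ?thesis
      using le[of c f] lip0_norm_nonneg[of "c *\<^sub>R f"] by simp
  next
    case False
    then have "\<bar>c\<bar> * norm f \<le> norm (c *\<^sub>R f)"
      using le[of "inverse c" "c *\<^sub>R f"] by (simp add: field_simps)
    with le[of c f] show ?thesis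
      by simp
  qed
qed (rule sgn_lip0_def dist_lip0_def uniformity_lip0_def open_lip0_def)+

end

section \<open>The Lipschitz-free space\<close>

text \<open>The dual of \<^typ>\<open>'a lip0\<close> is the normed space of bounded linear functions \<^typ>\<open>'a lip0 \<Rightarrow>\<^sub>L real\<close>.\<close>

lift_definition lip0_eval :: "'a::pointed_metric_space \<Rightarrow> 'a lip0 \<Rightarrow>\<^sub>L real"
  is "\<lambda>x f. apply_lip0 f x"
proof (rule bounded_linear_intro)
  show "norm (apply_lip0 f x) \<le> norm f * dist x base_point" for x :: 'a and f
    using lip0_bound[of f x base_point] by simp
qed (simp_all add: plus_lip0.rep_eq scaleR_lip0.rep_eq)

typedef (overloaded) 'a lipschitz_free =
  "closure (span (range lip0_eval)) :: ('a::pointed_metric_space lip0 \<Rightarrow>\<^sub>L real) set"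
  morphisms functional_of_free Abs_lipschitz_free
proof
  show "0 \<in> closure (span (range lip0_eval) :: ('a lip0 \<Rightarrow>\<^sub>L real) set)"
    using closure_subset span_zero by blast
qed

setup_lifting type_definition_lipschitz_free

lemma subspace_closure_span:
  fixes S :: "'a::real_normed_vector set"
  shows "subspace (closure (span S))"
proof (rule subspaceI)
  show "0 \<in> closure (span S)"
    using closure_subset span_zero by blast
next
  fix x y assume "x \<in> closure (span S)" "y \<in> closure (span S)"
  then obtain u v where "\<forall>n. u n \<in> span S" "u \<longlonglongrightarrow> x" "\<forall>n. v n \<in> span S" "v \<longlonglongrightarrow> y"
    unfolding closure_sequential by blast
  then show "x + y \<in> closure (span S)"
    unfolding closure_sequential
    by (intro exI[of _ "\<lambda>n. u n + v n"]) (auto intro: span_add tendsto_add)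
next
  fix c x assume "x \<in> closure (span S)"
  then obtain u where "\<forall>n. u n \<in> span S" "u \<longlonglongrightarrow> x"
    unfolding closure_sequential by blast
  then show "c *\<^sub>R x \<in> closure (span S)"
    unfolding closure_sequential
    by (intro exI[of _ "\<lambda>n. c *\<^sub>R u n"]) (auto intro: span_scale tendsto_scaleR)
qed

lemmas subspace_lipschitz_free = subspace_closure_span[of "range lip0_eval"]

instantiation lipschitz_free :: (pointed_metric_space) real_vector
begin

lift_definition zero_lipschitz_free :: "'a lipschitz_free" is 0
  by (rule subspace_0[OF subspace_lipschitz_free])

lift_definition plus_lipschitz_free ::
    "'a lipschitz_free \<Rightarrow> 'a lipschitz_free \<Rightarrow> 'a lipschitz_free" is "(+)"
  by (rule subspace_add[OF subspace_lipschitz_free])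

lift_definition uminus_lipschitz_free :: "'a lipschitz_free \<Rightarrow> 'a lipschitz_free" is uminus
  by (rule subspace_neg[OF subspace_lipschitz_free])

lift_definition minus_lipschitz_free ::
    "'a lipschitz_free \<Rightarrow> 'a lipschitz_free \<Rightarrow> 'a lipschitz_free" is "(-)"
  by (rule subspace_diff[OF subspace_lipschitz_free])

lift_definition scaleR_lipschitz_free ::
    "real \<Rightarrow> 'a lipschitz_free \<Rightarrow> 'a lipschitz_free" is "(*\<^sub>R)"
  by (rule subspace_scale[OF subspace_lipschitz_free])

instance
  by standard (transfer, simp add: algebra_simps)+

end

instantiation lipschitz_free :: (pointed_metric_space) real_normed_vector
begin

lift_definition norm_lipschitz_free :: "'a lipschitz_free \<Rightarrow> real" is norm .

definition sgn_lipschitz_free :: "'a lipschitz_free \<Rightarrow> 'a lipschitz_free"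
  where "sgn_lipschitz_free m = m /\<^sub>R norm m"

definition dist_lipschitz_free :: "'a lipschitz_free \<Rightarrow> 'a lipschitz_free \<Rightarrow> real"
  where "dist_lipschitz_free m m' = norm (m - m')"

definition uniformity_lipschitz_free :: "('a lipschitz_free \<times> 'a lipschitz_free) filter"
  where "uniformity_lipschitz_free = (INF e\<in>{0 <..}. principal {(x, y). dist x y < e})"

definition open_lipschitz_free :: "'a lipschitz_free set \<Rightarrow> bool"
  where "open_lipschitz_free S = (\<forall>x\<in>S. \<forall>\<^sub>F (x', y) in uniformity. x' = x \<longrightarrow> y \<in> S)"

instance
proof
  fix m m' :: "'a lipschitz_free" and a :: real
  show "norm m = 0 \<longleftrightarrow> m = 0" by transfer simp
  show "norm (m + m') \<le> norm m + norm m'" by transfer (rule norm_triangle_ineq)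
  show "norm (a *\<^sub>R m) = \<bar>a\<bar> * norm m" by transfer simp
qed (rule sgn_lipschitz_free_def dist_lipschitz_free_def uniformity_lipschitz_free_def
    open_lipschitz_free_def)+

end

section \<open>Weak topology, Schur property, embeddings into \<open>L\<^sub>1\<close>\<close>

definition weak_topology :: "'a::real_normed_vector topology"
  where "weak_topology =
    topology_generated_by {\<phi> -` U | (\<phi> :: 'a \<Rightarrow> real) U. bounded_linear \<phi> \<and> open U}"

definition schur_property :: "'a::real_normed_vector itself \<Rightarrow> bool"
  where "schur_property _ \<longleftrightarrow>
    (\<forall>(X :: nat \<Rightarrow> 'a) l. limitin weak_topology X l sequentially \<longrightarrow> X \<longlonglongrightarrow> l)"

text \<open>\<open>L\<^sub>1(\<Omega>, \<Sigma>, \<mu>)\<close> is handled through representatives: its elements are the real-valued integrable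
  functions on \<^term>\<open>M\<close>, regarded modulo equality almost everywhere.\<close>

definition separable_L1 :: "'w measure \<Rightarrow> bool"
  where "separable_L1 M \<longleftrightarrow>
    (\<exists>D :: ('w \<Rightarrow> real) set. countable D \<and> (\<forall>g\<in>D. integrable M g) \<and>
      (\<forall>f :: 'w \<Rightarrow> real. integrable M f \<longrightarrow>
        (\<forall>e>0. \<exists>g\<in>D. (\<integral>w. \<bar>f w - g w\<bar> \<partial>M) < e)))"

text \<open>\<^term>\<open>T\<close> chooses a representative of the image of every vector, so it has to be linear
  only almost everywhere; the norm bounds make it an isomorphism onto its image.\<close>

definition embeds_into_L1 :: "'a::real_normed_vector itself \<Rightarrow> 'w measure \<Rightarrow> bool"
  where "embeds_into_L1 _ M \<longleftrightarrow>
    (\<exists>T :: 'a \<Rightarrow> 'w \<Rightarrow> real.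
      (\<forall>x. integrable M (T x)) \<and>
      (\<forall>x y. AE w in M. T (x + y) w = T x w + T y w) \<and>
      (\<forall>c x. AE w in M. T (c *\<^sub>R x) w = c * T x w) \<and>
      (\<exists>c>0. \<exists>C. \<forall>x. c * norm x \<le> (\<integral>w. \<bar>T x w\<bar> \<partial>M) \<and> (\<integral>w. \<bar>T x w\<bar> \<partial>M) \<le> C * norm x))"

section \<open>Topological conditions\<close>

definition sigma_compact_space :: "'a topology \<Rightarrow> bool"
  where "sigma_compact_space X \<longleftrightarrow>
    (\<exists>\<K>. countable \<K> \<and> (\<forall>K\<in>\<K>. compactin X K) \<and> \<Union>\<K> = topspace X)"

definition scattered :: "'a::topological_space set \<Rightarrow> bool"
  where "scattered X \<longleftrightarrow> (\<forall>S\<subseteq>X. S \<noteq> {} \<longrightarrow> (\<exists>x. x isolated_in S))"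

end

theory Submission
  imports Defs
begin

text \<open>Suppose that \<open>h\<close> is a homeomorphism of \<open>C\<^sub>p(M)\<close> onto \<open>E\<close> with its weak topology, where \<open>E\<close> is the
Lipschitz-free space over \<open>N\<close>, with inverse \<open>T\<close>. Nothing is known about \<open>h\<close> beyond continuity, so every
argument transports a purely topological property, and each of the six conditions is refuted by one of
the following facts.

\<^bold>\<open>Separability.\<close> The weak topology of a normed space has countable tightness: a point in the closure of
a set lies in the closure of a countable subset (\<open>weak_topology_countably_tight\<close>, from the compactness
of the dual ball). If \<open>M\<close> is not separable, then for some \<open>\<epsilon>\<close> no countable set meets every \<open>\<epsilon>\<close>-ball, and
the constant \<open>1\<close> lies in the closure of the functions supported in finitely many \<open>\<epsilon>\<close>-balls, but in the
closure of no countable set of them. So \<open>M\<close> is separable. Then \<open>C\<^sub>p(M)\<close> is separable, hence \<open>E\<close> is weakly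
separable, and so is \<open>N\<close>, because the distance function of a closed set acts on \<open>E\<close> as a functional.

\<^bold>\<open>Countable or scattered \<open>M\<close>.\<close> If \<open>M\<close> is countable, points of \<open>C\<^sub>p(M)\<close> have countable neighbourhood bases.
In the weak topology of an infinite-dimensional space this would produce non-zero vectors \<open>y\<^sub>n\<close> such
that every functional vanishes on almost all of them, against Baire's theorem in the dual. A separable
scattered metric space is countable.

\<^bold>\<open>Sigma-compactness of \<open>M\<close>.\<close> By separability, \<open>E\<close> is Polish in its norm, and \<open>T\<close> maps it onto the continuous functions on \<open>M\<close>, with
continuous evaluations. This suffices (\<open>sigma_compact_of_polish_parametrization\<close>, a variant of a theorem of
Christensen and Calbrix). Embed \<open>M\<close> into a compact metric space \<open>K\<close>. A compact \<open>L \<subseteq> K - M\<close> gives the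
function \<open>1 / dist(\<cdot>, L)\<close> on \<open>M\<close>; running through finer and finer covers of \<open>E\<close> by balls, one obtains a tree
of relatively open subsets of \<open>K - M\<close> along whose branches no sequence converges to a point of \<open>M\<close>,
since the corresponding vectors of \<open>E\<close> would have a convergent subsequence whose functions blow up at
that point. This exhibits \<open>K - M\<close> as a \<open>G\<^sub>\<delta>\<close>.

\<^bold>\<open>The Schur property and subspaces of \<open>L\<^sub>1\<close>.\<close> In both cases there are sets \<open>A j n\<close>, increasing in \<open>n\<close>, such
that for every \<open>j\<close> each weakly convergent sequence lies in some \<open>A j n\<close>, while each sequence that lies
in some \<open>A j (n j)\<close> for every \<open>j\<close> has a weak cluster point. No such family exists if \<open>M\<close> has a
non-isolated point (\<open>not_strongly_dominated\<close>): sums of disjoint bumps near that point are chosen one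
after the other so that all of them stay in one set \<open>A j (n j)\<close> for each \<open>j\<close>, whereas they converge
pointwise to a discontinuous function. For a Schur space, \<open>A j n\<close> is the union of the balls of radius
\<open>1/(j+1)\<close> around the first \<open>n + 1\<close> terms of a dense sequence. For a subspace of \<open>L\<^sub>1\<close> it consists of the \<open>f\<close> with
\<open>\<integral> max 0 (\<bar>f\<bar> - n g) \<le> 1/(j+1)\<close> for a fixed weight \<open>g\<close>. Weakly convergent sequences are equi-integrable by
a gliding hump, and equi-integrable sequences have weak cluster points by minimising a strictly convex
integral over convex hulls.\<close>

section \<open>Neighbourhoods and limits in the two topologies\<close>

lemma topspace_weak_topology [simp]: "topspace (weak_topology :: 'a::real_normed_vector topology) = UNIV"
proof -
  have "bounded_linear (\<lambda>_::'a. 0::real)" by simp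
  then have "(UNIV :: 'a set) \<in> {\<phi> -` U | (\<phi> :: 'a \<Rightarrow> real) U. bounded_linear \<phi> \<and> open U}"
    by (intro CollectI exI[of _ "\<lambda>_. 0"] exI[of _ UNIV]) auto
  then show ?thesis
    by (auto simp: weak_topology_def topology_generated_by_topspace)
qed

lemma openin_weak_vimage:
  fixes \<phi> :: "'a::real_normed_vector \<Rightarrow> real"
  shows "bounded_linear \<phi> \<Longrightarrow> open U \<Longrightarrow> openin weak_topology (\<phi> -` U)"
  unfolding weak_topology_def by (rule topology_generated_by_Basis, intro CollectI exI conjI) (rule refl, assumption+)

definition weak_nbhd :: "('a::real_normed_vector \<Rightarrow> real) set \<Rightarrow> real \<Rightarrow> 'a \<Rightarrow> 'a set"
  where "weak_nbhd \<Psi> \<epsilon> x = {y. \<forall>\<psi>\<in>\<Psi>. \<bar>\<psi> y - \<psi> x\<bar> < \<epsilon>}"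

lemma weak_nbhd_antimono: "\<Psi>' \<subseteq> \<Psi> \<Longrightarrow> \<epsilon> \<le> \<epsilon>' \<Longrightarrow> weak_nbhd \<Psi> \<epsilon> x \<subseteq> weak_nbhd \<Psi>' \<epsilon>' x"
  by (force simp: weak_nbhd_def)

lemma in_weak_nbhd_self: "\<epsilon> > 0 \<Longrightarrow> x \<in> weak_nbhd \<Psi> \<epsilon> x"
  by (simp add: weak_nbhd_def)

lemma openin_weak_nbhd:
  assumes "finite \<Psi>" "\<forall>\<psi>\<in>\<Psi>. bounded_linear \<psi>"
  shows "openin weak_topology (weak_nbhd \<Psi> \<epsilon> x)"
  using assms
proof (induction \<Psi>)
  case empty
  then show ?case using openin_topspace[of "weak_topology :: 'a topology"] by (simp add: weak_nbhd_def)
next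
  case (insert \<psi> \<Psi>)
  have "weak_nbhd (insert \<psi> \<Psi>) \<epsilon> x = \<psi> -` ball (\<psi> x) \<epsilon> \<inter> weak_nbhd \<Psi> \<epsilon> x"
    by (auto simp: weak_nbhd_def dist_real_def abs_minus_commute)
  then show ?case
    using insert by (auto intro!: openin_Int openin_weak_vimage)
qed

text \<open>The generating sets are preimages under single functionals; finite intersections of them are handled by
the minimum of the radii.\<close>

lemma weak_topology_nhd:
  assumes "openin weak_topology U" "x \<in> U"
  obtains \<Psi> \<epsilon> where "finite \<Psi>" "\<forall>\<psi>\<in>\<Psi>. bounded_linear \<psi>" "\<epsilon> > 0" "weak_nbhd \<Psi> \<epsilon> x \<subseteq> U"
proof -
  define N where "N x U \<longleftrightarrow> (\<exists>\<Psi> \<epsilon>. finite \<Psi> \<and> (\<forall>\<psi>\<in>\<Psi>. bounded_linear \<psi>) \<and> \<epsilon> > 0 \<and> weak_nbhd \<Psi> \<epsilon> x \<subseteq> U)"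
    for x :: 'a and U
  have N_mono: "N x V" if "N x U" "U \<subseteq> V" for x U V
    using that unfolding N_def by (meson order_trans)
  have N_Int: "N x (A \<inter> B)" if N: "N x A" "N x B" for x A B
  proof -
    obtain \<Psi> \<epsilon> \<Psi>' \<epsilon>' where 1: "finite \<Psi>" "\<forall>\<psi>\<in>\<Psi>. bounded_linear \<psi>" "\<epsilon> > 0" "weak_nbhd \<Psi> \<epsilon> x \<subseteq> A"
      and 2: "finite \<Psi>'" "\<forall>\<psi>\<in>\<Psi>'. bounded_linear \<psi>" "\<epsilon>' > 0" "weak_nbhd \<Psi>' \<epsilon>' x \<subseteq> B"
      using N unfolding N_def by blast
    have "weak_nbhd (\<Psi> \<union> \<Psi>') (min \<epsilon> \<epsilon>') x \<subseteq> A \<inter> B"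
      using weak_nbhd_antimono[of \<Psi> "\<Psi> \<union> \<Psi>'" "min \<epsilon> \<epsilon>'" \<epsilon> x]
        weak_nbhd_antimono[of \<Psi>' "\<Psi> \<union> \<Psi>'" "min \<epsilon> \<epsilon>'" \<epsilon>' x] 1(4) 2(4) by auto
    then show ?thesis
      unfolding N_def using 1 2 by (intro exI[of _ "\<Psi> \<union> \<Psi>'"] exI[of _ "min \<epsilon> \<epsilon>'"]) auto
  qed
  have "generate_topology_on {\<phi> -` U | (\<phi> :: 'a \<Rightarrow> real) U. bounded_linear \<phi> \<and> open U} U"
    using assms(1) unfolding weak_topology_def by (rule openin_topology_generated_by)
  then have "\<forall>x\<in>U. N x U"
  proof induction
    case (UN K)
    then show ?case by (meson N_mono Sup_upper UnionE)
  next
    case (Basis s)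
    then show ?case
    proof (elim CollectE exE conjE)
      fix \<phi> :: "'a \<Rightarrow> real" and V assume s: "s = \<phi> -` V" "bounded_linear \<phi>" "open V"
      show "\<forall>x\<in>s. N x s"
      proof
        fix x assume "x \<in> s"
        with s obtain e where e: "e > 0" "ball (\<phi> x) e \<subseteq> V"
          by (metis open_contains_ball vimageE)
        have "weak_nbhd {\<phi>} e x \<subseteq> s"
        proof
          fix y assume "y \<in> weak_nbhd {\<phi>} e x"
          then have "\<phi> y \<in> ball (\<phi> x) e"
            by (simp add: weak_nbhd_def dist_real_def abs_minus_commute)
          then show "y \<in> s" using e(2) s(1) by blast
        qed
        then show "N x s"
          unfolding N_def using s(2) e(1) by (intro exI[of _ "{\<phi>}"] exI[of _ e]) simp
      qed
    qed
  next
    case (Int A B)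
    then show ?case by (meson IntD1 IntD2 N_Int)
  qed simp
  then have "N x U" using assms(2) by blast
  then show ?thesis unfolding N_def by (elim exE conjE) (rule that)
qed

lemma limitin_weak_iff:
  fixes X :: "'k \<Rightarrow> 'a::real_normed_vector"
  shows "limitin weak_topology X l F \<longleftrightarrow> (\<forall>\<psi>. bounded_linear \<psi> \<longrightarrow> ((\<lambda>k. \<psi> (X k)) \<longlongrightarrow> (\<psi> l :: real)) F)"
proof
  assume L: "limitin weak_topology X l F"
  show "\<forall>\<psi>. bounded_linear \<psi> \<longrightarrow> ((\<lambda>k. \<psi> (X k)) \<longlongrightarrow> (\<psi> l :: real)) F"
  proof (intro allI impI, rule topological_tendstoI)
    fix \<psi> :: "'a \<Rightarrow> real" and S assume "bounded_linear \<psi>" "open S" "\<psi> l \<in> S"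
    then have "\<forall>\<^sub>F k in F. X k \<in> \<psi> -` S"
      by (intro limitinD[OF L] openin_weak_vimage vimageI2)
    then show "\<forall>\<^sub>F k in F. \<psi> (X k) \<in> S"
      by (simp add: vimage_def)
  qed
next
  assume L: "\<forall>\<psi>. bounded_linear \<psi> \<longrightarrow> ((\<lambda>k. \<psi> (X k)) \<longlongrightarrow> (\<psi> l :: real)) F"
  show "limitin weak_topology X l F"
    unfolding limitin_def
  proof (intro conjI allI impI)
    fix U assume "openin weak_topology U \<and> l \<in> U"
    then obtain \<Psi> \<epsilon> where \<Psi>: "finite \<Psi>" "\<forall>\<psi>\<in>\<Psi>. bounded_linear \<psi>" "\<epsilon> > 0" "weak_nbhd \<Psi> \<epsilon> l \<subseteq> U"
      by (elim conjE) (rule weak_topology_nhd)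
    have "\<forall>\<^sub>F k in F. \<forall>\<psi>\<in>\<Psi>. \<bar>\<psi> (X k) - \<psi> l\<bar> < \<epsilon>"
      using \<Psi>(1-3) L by (intro eventually_ball_finite) (auto simp: tendsto_iff dist_real_def)
    then have "\<forall>\<^sub>F k in F. X k \<in> weak_nbhd \<Psi> \<epsilon> l"
      unfolding weak_nbhd_def mem_Collect_eq .
    then show "\<forall>\<^sub>F k in F. X k \<in> U"
      by (rule eventually_mono) (rule subsetD[OF \<Psi>(4)])
  qed simp
qed

lemma openin_weak_imp_open:
  assumes "openin weak_topology U"
  shows "open U"
proof (subst open_subopen, intro ballI)
  fix x assume "x \<in> U"
  with assms obtain \<Psi> \<epsilon> where \<Psi>: "finite \<Psi>" "\<forall>\<psi>\<in>\<Psi>. bounded_linear \<psi>" "\<epsilon> > 0" "weak_nbhd \<Psi> \<epsilon> x \<subseteq> U"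
    by (rule weak_topology_nhd)
  have "open (\<Inter>\<psi>\<in>\<Psi>. \<psi> -` ball (\<psi> x) \<epsilon>)"
    using \<Psi>(1-3) by (intro open_INT ballI continuous_open_vimage linear_continuous_at) auto
  moreover have "x \<in> (\<Inter>\<psi>\<in>\<Psi>. \<psi> -` ball (\<psi> x) \<epsilon>)" using \<Psi>(3) by auto
  moreover have "(\<Inter>\<psi>\<in>\<Psi>. \<psi> -` ball (\<psi> x) \<epsilon>) \<subseteq> weak_nbhd \<Psi> \<epsilon> x"
    by (auto simp: weak_nbhd_def dist_real_def abs_minus_commute)
  ultimately show "\<exists>V. open V \<and> x \<in> V \<and> V \<subseteq> U"
    using \<Psi>(4) by blast
qed

lemma topspace_C_p [simp]: "topspace C_p = {f. continuous_on UNIV f}"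
  by (simp add: C_p_def)

lemma continuous_map_C_p_eval: "continuous_map C_p euclideanreal (\<lambda>f. f x)"
  unfolding C_p_def
  by (intro continuous_map_from_subtopology continuous_map_product_projection) simp

definition C_p_nbhd :: "'a::topological_space set \<Rightarrow> real \<Rightarrow> ('a \<Rightarrow> real) \<Rightarrow> ('a \<Rightarrow> real) set"
  where "C_p_nbhd F \<epsilon> f = {g. continuous_on UNIV g \<and> (\<forall>x\<in>F. \<bar>g x - f x\<bar> < \<epsilon>)}"

lemma openin_C_p_nbhd:
  assumes "finite F"
  shows "openin C_p (C_p_nbhd F \<epsilon> f)"
proof -
  have "openin C_p {g \<in> topspace C_p. g x \<in> ball (f x) \<epsilon>}" for x
    by (rule openin_continuous_map_preimage[OF continuous_map_C_p_eval]) auto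
  then have "openin C_p ((\<Inter>x\<in>F. {g \<in> topspace C_p. g x \<in> ball (f x) \<epsilon>}) \<inter> topspace C_p)"
    by (intro openin_INT assms)
  moreover have "(\<Inter>x\<in>F. {g \<in> topspace C_p. g x \<in> ball (f x) \<epsilon>}) \<inter> topspace C_p = C_p_nbhd F \<epsilon> f"
    by (auto simp: dist_real_def abs_minus_commute C_p_nbhd_def)
  ultimately show ?thesis by simp
qed

lemma C_p_nhd:
  assumes "openin C_p U" "f \<in> U"
  obtains F \<epsilon> where "finite F" "\<epsilon> > 0" "C_p_nbhd F \<epsilon> f \<subseteq> U"
proof -
  obtain W where W: "openin (product_topology (\<lambda>_. euclideanreal) UNIV) W"
    "U = W \<inter> {f. continuous_on UNIV f}"
    using assms(1) by (auto simp: C_p_def openin_subtopology)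
  then have "f \<in> W" using assms(2) by simp
  then have "\<exists>V. finite {i \<in> UNIV. V i \<noteq> topspace euclideanreal} \<and> (\<forall>i\<in>UNIV. openin euclideanreal (V i)) \<and>
      f \<in> Pi\<^sub>E UNIV V \<and> Pi\<^sub>E UNIV V \<subseteq> W"
    using W(1) unfolding openin_product_topology_alt by (rule bspec[rotated])
  then obtain V where "finite {i \<in> UNIV. V i \<noteq> topspace euclideanreal}"
      "\<forall>i\<in>UNIV. openin euclideanreal (V i)" and V': "f \<in> Pi\<^sub>E UNIV V" "Pi\<^sub>E UNIV V \<subseteq> W"
    by (elim exE conjE)
  then have V: "finite {i. V i \<noteq> UNIV}" "\<forall>i. open (V i)" by simp_all
  have "\<exists>\<delta>. \<delta> > 0 \<and> ball (f i) \<delta> \<subseteq> V i" for i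
  proof -
    have "f i \<in> V i" using V'(1) by (simp add: PiE_iff)
    moreover have "open (V i)" using V(2) by simp
    ultimately show ?thesis by (meson openE)
  qed
  then have "\<exists>\<delta>. \<forall>i. \<delta> i > 0 \<and> ball (f i) (\<delta> i) \<subseteq> V i" by (rule choice[OF allI])
  then obtain \<delta> where \<delta>: "\<forall>i. \<delta> i > 0 \<and> ball (f i) (\<delta> i) \<subseteq> V i" by (elim exE)
  define F where "F = {i. V i \<noteq> UNIV}"
  have "finite F" using V(1) by (simp add: F_def)
  define \<epsilon> where "\<epsilon> = Min (insert 1 (\<delta> ` F))"
  have \<epsilon>: "\<epsilon> > 0" "\<And>i. i \<in> F \<Longrightarrow> \<epsilon> \<le> \<delta> i"
    using \<open>finite F\<close> \<delta> by (simp_all add: \<epsilon>_def)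
  have "C_p_nbhd F \<epsilon> f \<subseteq> U"
  proof
    fix g assume g: "g \<in> C_p_nbhd F \<epsilon> f"
    have "g i \<in> V i" for i
    proof (cases "i \<in> F")
      case True
      then have "g i \<in> ball (f i) (\<delta> i)"
        using g \<epsilon>(2)[OF True] by (force simp: dist_real_def abs_minus_commute C_p_nbhd_def)
      then show ?thesis using \<delta> by blast
    qed (simp add: F_def)
    then show "g \<in> U" using W(2) V'(2) g by (auto simp: PiE_UNIV_domain C_p_nbhd_def)
  qed
  with \<open>finite F\<close> show ?thesis using \<epsilon>(1) by (intro that)
qed

lemma limitin_C_p_iff:
  assumes "\<And>k. continuous_on UNIV (X k)" "continuous_on UNIV f"
  shows "limitin C_p X f F \<longleftrightarrow> (\<forall>x. ((\<lambda>k. X k x) \<longlongrightarrow> f x) F)"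
  unfolding C_p_def limitin_subtopology limitin_componentwise using assms by auto

lemma in_C_p_closure_of:
  fixes f :: "'a::topological_space \<Rightarrow> real"
  shows "f \<in> C_p closure_of A \<longleftrightarrow> continuous_on UNIV f \<and>
    (\<forall>F \<epsilon>. finite F \<longrightarrow> \<epsilon> > 0 \<longrightarrow> A \<inter> C_p_nbhd F \<epsilon> f \<noteq> {})"
  (is "?L \<longleftrightarrow> ?R")
proof
  assume L: ?L
  show ?R
  proof (intro conjI allI impI)
    show "continuous_on UNIV f" using L by (auto simp: in_closure_of)
    fix F :: "'a set" and \<epsilon> :: real assume *: "finite F" "\<epsilon> > 0"
    have "f \<in> C_p_nbhd F \<epsilon> f"
      using L * by (auto simp: in_closure_of C_p_nbhd_def)
    then show "A \<inter> C_p_nbhd F \<epsilon> f \<noteq> {}"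
      using L openin_C_p_nbhd[OF *(1), of \<epsilon> f] unfolding in_closure_of by blast
  qed
next
  assume R: ?R
  show ?L
    unfolding in_closure_of
  proof (intro conjI allI impI)
    show "f \<in> topspace C_p" using R by simp
    fix U assume "f \<in> U \<and> openin C_p U"
    then obtain F \<epsilon> where "finite F" "\<epsilon> > 0" "C_p_nbhd F \<epsilon> f \<subseteq> U" by (elim conjE) (rule C_p_nhd)
    then show "\<exists>y. y \<in> A \<and> y \<in> U" using R by blast
  qed
qed

text \<open>The standing situation of the proof by contradiction, for an arbitrary normed space in place of the
Lipschitz-free space.\<close>

locale C_p_weak_homeomorphism =
  fixes h :: "('m::metric_space \<Rightarrow> real) \<Rightarrow> 'e::real_normed_vector" and T :: "'e \<Rightarrow> 'm \<Rightarrow> real"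
  assumes homeo: "homeomorphic_maps C_p weak_topology h T"
begin

lemma T_cont: "continuous_on UNIV (T e)"
  using homeo by (auto simp: homeomorphic_maps_def continuous_map_def)

lemma h_T [simp]: "h (T e) = e"
  using homeo by (auto simp: homeomorphic_maps_def)

lemma T_h: "continuous_on UNIV f \<Longrightarrow> T (h f) = f"
  using homeo by (auto simp: homeomorphic_maps_def)

lemma continuous_map_h: "continuous_map C_p weak_topology h"
  and continuous_map_T: "continuous_map weak_topology C_p T"
  using homeo by (auto simp: homeomorphic_maps_def)

lemma weak_T_eval: "continuous_map weak_topology euclideanreal (\<lambda>e. T e x)"
  using continuous_map_compose[OF continuous_map_T continuous_map_C_p_eval[of x]]
  by (simp add: o_def)

lemma continuous_T_eval: "continuous_on UNIV (\<lambda>e. T e x)"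
proof -
  have "open ((\<lambda>e. T e x) -` U)" if "open U" for U
    using openin_continuous_map_preimage[OF weak_T_eval[of x], of U] that
    by (auto intro!: openin_weak_imp_open simp: vimage_def)
  then show ?thesis by (simp add: continuous_on_open_vimage)
qed

text \<open>Pointwise convergence in \<open>C\<^sub>p(M)\<close> is the source of all weakly convergent sequences that are used below.\<close>

lemma limitin_weak_h:
  fixes F :: "'k filter"
  assumes "\<And>k. continuous_on UNIV (X k)" "continuous_on UNIV f" "\<And>x. ((\<lambda>k. X k x) \<longlongrightarrow> f x) F"
  shows "limitin weak_topology (\<lambda>k. h (X k)) (h f) F"
  using continuous_map_limit[OF continuous_map_h, of X f F] limitin_C_p_iff[of X f F, OF assms(1,2)] assms(3)
  by (simp add: o_def)

lemma closure_of_h: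
  "A \<subseteq> {f. continuous_on UNIV f} \<Longrightarrow> weak_topology closure_of (h ` A) = h ` (C_p closure_of A)"
  using homeomorphic_map_closure_of[of C_p weak_topology h A] homeomorphic_maps_imp_map[OF homeo]
  by simp

end

section \<open>Separability\<close>

lemma compact_PiE_UNIV:
  fixes K :: "'i \<Rightarrow> 'a::topological_space set"
  assumes "\<And>i. compact (K i)"
  shows "compact (Pi\<^sub>E UNIV K)"
proof -
  have "compactin (product_topology (\<lambda>_. euclidean) UNIV) (Pi\<^sub>E UNIV K)"
    unfolding compactin_PiE using assms by simp
  then show ?thesis
    by (simp add: euclidean_product_topology)
qed

text \<open>Alaoglu's theorem: the dual unit ball is a closed subset of a product of intervals.\<close>

lemma compact_dual_unit_ball:
  "compact {\<psi> :: 'a::real_normed_vector \<Rightarrow> real. linear \<psi> \<and> (\<forall>a. \<bar>\<psi> a\<bar> \<le> norm a)}" (is "compact ?B")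
proof -
  have ev: "continuous_on UNIV (\<lambda>\<psi> :: 'a \<Rightarrow> real. \<psi> a)" for a
    by (rule continuous_on_product_coordinates)
  have "?B = {\<psi>. \<forall>a b. \<psi> (a + b) = \<psi> a + \<psi> b} \<inter> {\<psi>. \<forall>c a. \<psi> (c *\<^sub>R a) = c * \<psi> a} \<inter>
      Pi\<^sub>E UNIV (\<lambda>a. {- norm a..norm a})"
    by (auto simp: linear_iff PiE_iff abs_le_iff minus_le_iff)
  moreover have "closed {\<psi> :: 'a \<Rightarrow> real. \<forall>a b. \<psi> (a + b) = \<psi> a + \<psi> b}"
    by (intro closed_Collect_all closed_Collect_eq continuous_intros ev)
  moreover have "closed {\<psi> :: 'a \<Rightarrow> real. \<forall>c a. \<psi> (c *\<^sub>R a) = c * \<psi> a}"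
    by (intro closed_Collect_all closed_Collect_eq continuous_intros ev)
  ultimately show ?thesis
    by (simp only:) (intro closed_Int_compact closed_Int compact_PiE_UNIV compact_Icc)
qed

text \<open>Kaplansky's theorem. Every point of the compact space of sequences in the dual unit ball is, through its
first \<open>n\<close> terms, a weak neighbourhood of \<open>x\<close>, and so is met by some \<open>a \<in> A\<close>. The sequences served by \<open>a\<close>
form an open set, so finitely many \<open>a\<close> suffice for each \<open>n\<close>.\<close>

lemma weak_topology_countably_tight:
  fixes A :: "'a::real_normed_vector set"
  assumes x: "x \<in> weak_topology closure_of A"
  obtains C where "C \<subseteq> A" "countable C" "x \<in> weak_topology closure_of C"
proof -
  define B where "B = {\<psi> :: 'a \<Rightarrow> real. linear \<psi> \<and> (\<forall>a. \<bar>\<psi> a\<bar> \<le> norm a)}"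
  define D where "D = Pi\<^sub>E UNIV (\<lambda>_::nat. B)"
  define W where "W n a = {u :: nat \<Rightarrow> 'a \<Rightarrow> real. \<forall>i\<in>{..<n}. \<bar>u i a - u i x\<bar> < 1 / real (Suc n)}"
    for n a
  have bl: "bounded_linear \<psi>" if "\<psi> \<in> B" for \<psi>
    using that by (intro bounded_linear_intro[where K = 1]) (auto simp: B_def linear_iff)
  have "compact D"
    unfolding D_def B_def by (intro compact_PiE_UNIV compact_dual_unit_ball)
  have ev: "continuous_on UNIV (\<lambda>u :: nat \<Rightarrow> 'a \<Rightarrow> real. u i a)" for i a
    by (rule continuous_on_compose2[OF continuous_on_product_coordinates[of a] continuous_on_product_coordinates[of i]]) simp
  have "open (W n a)" for n a
  proof -
    have "W n a = (\<Inter>i\<in>{..<n}. {u. \<bar>u i a - u i x\<bar> < 1 / real (Suc n)})" by (auto simp: W_def)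
    also have "open \<dots>" by (intro open_INT ballI open_Collect_less continuous_intros ev) simp
    finally show ?thesis .
  qed
  have "\<exists>C. C \<subseteq> A \<and> finite C \<and> D \<subseteq> (\<Union>a\<in>C. W n a)" for n
  proof -
    have "D \<subseteq> (\<Union>a\<in>A. W n a)"
    proof
      fix u assume u: "u \<in> D"
      have "openin weak_topology (weak_nbhd (u ` {..<n}) (1 / real (Suc n)) x)"
        using u by (intro openin_weak_nbhd) (auto simp: D_def intro!: bl)
      moreover have "x \<in> weak_nbhd (u ` {..<n}) (1 / real (Suc n)) x"
        by (intro in_weak_nbhd_self) simp
      ultimately obtain a where a: "a \<in> A" "a \<in> weak_nbhd (u ` {..<n}) (1 / real (Suc n)) x"
        using x unfolding in_closure_of by metis
      then have "u \<in> W n a" by (simp add: W_def weak_nbhd_def)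
      with a(1) show "u \<in> (\<Union>a\<in>A. W n a)" by blast
    qed
    from compactE_image[OF \<open>compact D\<close> _ this] \<open>\<And>n a. open (W n a)\<close>
    show ?thesis by metis
  qed
  then obtain C where C: "\<And>n. C n \<subseteq> A" "\<And>n. finite (C n)" "\<And>n. D \<subseteq> (\<Union>a\<in>C n. W n a)" by metis
  show thesis
  proof
    show "(\<Union>n. C n) \<subseteq> A" using C(1) by blast
    show "countable (\<Union>n. C n)" using C(2) by (simp add: countable_finite)
    show "x \<in> weak_topology closure_of (\<Union>n. C n)"
      unfolding in_closure_of
    proof (intro conjI allI impI)
      fix U assume "x \<in> U \<and> openin weak_topology U"
      then obtain \<Psi> \<epsilon> where \<Psi>: "finite \<Psi>" "\<forall>\<psi>\<in>\<Psi>. bounded_linear \<psi>" "\<epsilon> > 0" "weak_nbhd \<Psi> \<epsilon> x \<subseteq> U"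
        by (elim conjE) (rule weak_topology_nhd)
      have "\<exists>K. K > 0 \<and> (\<forall>\<psi>\<in>\<Psi>. \<forall>a. \<bar>\<psi> a\<bar> \<le> K * norm a)"
        using \<Psi>(1,2)
      proof (induction \<Psi>)
        case empty
        show ?case by (intro exI[of _ 1]) simp
      next
        case (insert \<psi> \<Psi>)
        then obtain K where K: "K > 0" "\<forall>\<psi>\<in>\<Psi>. \<forall>a. \<bar>\<psi> a\<bar> \<le> K * norm a" by auto
        obtain K' where K': "K' > 0" "\<And>a. norm (\<psi> a) \<le> norm a * K'"
          using bounded_linear.pos_bounded insert.prems by blast
        show ?case
        proof (intro exI[of _ "K + K'"] conjI ballI allI)
          show "0 < K + K'" using K K' by simp
          fix \<theta> a assume "\<theta> \<in> insert \<psi> \<Psi>"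
          then have "\<bar>\<theta> a\<bar> \<le> K * norm a \<or> \<bar>\<theta> a\<bar> \<le> K' * norm a"
            using K K' by (auto simp: mult.commute)
          moreover have "0 \<le> K * norm a" "0 \<le> K' * norm a" using K K' by auto
          ultimately show "\<bar>\<theta> a\<bar> \<le> (K + K') * norm a" unfolding distrib_right by linarith
        qed
      qed
      then obtain K where K: "K > 0" "\<forall>\<psi>\<in>\<Psi>. \<forall>a. \<bar>\<psi> a\<bar> \<le> K * norm a" by blast
      obtain g where g: "bij_betw g {..<card \<Psi>} \<Psi>"
        using ex_bij_betw_nat_finite[OF \<Psi>(1)] by (auto simp: atLeast0LessThan)
      define u where "u i = (if i < card \<Psi> then (\<lambda>a. g i a / K) else (\<lambda>_. 0))" for i
      have "u i \<in> B" for i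
      proof (cases "i < card \<Psi>")
        case True
        then have gi: "g i \<in> \<Psi>" using g by (auto simp: bij_betw_def)
        then interpret gi: bounded_linear "g i" using \<Psi>(2) by simp
        have "linear (\<lambda>a. g i a / K)"
          by (simp add: linear_iff gi.add gi.scaleR add_divide_distrib)
        moreover have "\<bar>g i a / K\<bar> \<le> norm a" for a
          using K gi by (simp add: pos_divide_le_eq mult.commute)
        ultimately show ?thesis
          using True by (simp add: u_def B_def)
      qed (simp add: u_def B_def linear_iff)
      then have "u \<in> D" by (simp add: D_def PiE_iff)
      obtain n where n: "K / \<epsilon> < real n" "card \<Psi> \<le> n"
        using reals_Archimedean2[of "max (K / \<epsilon>) (card \<Psi>)"] by auto
      from \<open>u \<in> D\<close> C(3)[of n] obtain a where a: "a \<in> C n" "u \<in> W n a" by blast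
      have "a \<in> weak_nbhd \<Psi> \<epsilon> x"
        unfolding weak_nbhd_def
      proof (intro CollectI ballI)
        fix \<psi> assume "\<psi> \<in> \<Psi>"
        then obtain i where i: "i < card \<Psi>" "\<psi> = g i" using g by (auto simp: bij_betw_def)
        have "\<bar>u i a - u i x\<bar> < 1 / real (Suc n)" using a(2) i(1) n(2) by (simp add: W_def)
        moreover have "\<bar>u i a - u i x\<bar> = \<bar>\<psi> a - \<psi> x\<bar> / K"
          using i K(1) by (simp add: u_def diff_divide_distrib[symmetric])
        ultimately have "\<bar>\<psi> a - \<psi> x\<bar> < 1 / real (Suc n) * K"
          using K(1) by (simp only: pos_divide_less_eq)
        also have "\<dots> < \<epsilon>"
        proof -
          have "K < real n * \<epsilon>" using n(1) \<Psi>(3) by (simp only: pos_divide_less_eq)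
          also have "\<dots> \<le> real (Suc n) * \<epsilon>" using \<Psi>(3) by simp
          finally show ?thesis by (simp add: pos_divide_less_eq mult.commute)
        qed
        finally show "\<bar>\<psi> a - \<psi> x\<bar> < \<epsilon>" .
      qed
      then have "a \<in> U" by (rule subsetD[OF \<Psi>(4)])
      moreover have "a \<in> (\<Union>n. C n)" using a(1) by blast
      ultimately show "\<exists>y. y \<in> (\<Union>n. C n) \<and> y \<in> U" by (intro exI[of _ a] conjI)
    qed simp
  qed
qed

text \<open>If no countable set is \<open>\<epsilon>\<close>-dense, then countably many functions, each supported near a finite set, all vanish
at some point far from these finite sets. So they cannot approximate \<open>1\<close> there, although all functions
of this kind together approximate \<open>1\<close> on every finite set.\<close>

lemma (in C_p_weak_homeomorphism) separable_domain:
  obtains S :: "'m set" where "countable S" "closure S = UNIV"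
proof -
  have "\<exists>S. countable S \<and> (\<forall>x::'m. \<exists>s\<in>S. dist x s < \<epsilon>)" if "\<epsilon> > 0" for \<epsilon>
  proof (rule ccontr)
    assume no: "\<nexists>S. countable S \<and> (\<forall>x::'m. \<exists>s\<in>S. dist x s < \<epsilon>)"
    define A where "A = {f :: 'm \<Rightarrow> real. continuous_on UNIV f \<and>
      (\<exists>F. finite F \<and> (\<forall>x. f x \<noteq> 0 \<longrightarrow> (\<exists>p\<in>F. dist x p < \<epsilon>)))}"
    have "(\<lambda>_. 1) \<in> C_p closure_of A"
      unfolding in_C_p_closure_of
    proof (intro conjI allI impI)
      fix F :: "'m set" and \<eta> :: real assume F: "finite F" "\<eta> > 0"
      define g where "g x = (if F = {} then 0 else max 0 (1 - infdist x F / \<epsilon>))" for x :: 'm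
      have "continuous_on UNIV g"
        unfolding g_def using \<open>\<epsilon> > 0\<close> by (cases "F = {}") (auto intro!: continuous_intros)
      moreover have "\<exists>p\<in>F. dist x p < \<epsilon>" if "g x \<noteq> 0" for x
      proof -
        have "F \<noteq> {}" "infdist x F < \<epsilon>"
          using that \<open>\<epsilon> > 0\<close> by (auto simp: g_def max_def field_simps split: if_splits)
        then have "\<not> (\<forall>p\<in>F. \<epsilon> \<le> dist x p)"
          using cINF_greatest[of F \<epsilon> "dist x"] by (auto simp: infdist_notempty not_less[symmetric])
        then show ?thesis by (simp add: not_le)
      qed
      ultimately have "g \<in> A" using F(1) unfolding A_def by blast
      moreover have "g \<in> C_p_nbhd F \<eta> (\<lambda>_. 1)"
        using F \<open>continuous_on UNIV g\<close> \<open>\<epsilon> > 0\<close> by (auto simp: C_p_nbhd_def g_def)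
      ultimately show "A \<inter> C_p_nbhd F \<eta> (\<lambda>_. 1) \<noteq> {}" by blast
    qed simp
    then have "h (\<lambda>_. 1) \<in> weak_topology closure_of (h ` A)"
      by (subst closure_of_h) (auto simp: A_def)
    then obtain C where C: "C \<subseteq> h ` A" "countable C" "h (\<lambda>_. 1) \<in> weak_topology closure_of C"
      by (rule weak_topology_countably_tight)
    define C' where "C' = T ` C"
    have "T c \<in> A" "h (T c) = c" if "c \<in> C" for c
    proof -
      obtain f where "f \<in> A" "c = h f" using \<open>c \<in> C\<close> C(1) by auto
      then show "T c \<in> A" using T_h[of f] by (simp add: A_def)
    qed simp
    then have C': "C' \<subseteq> A" "countable C'" "C = h ` C'"
      using C(2) by (auto simp: C'_def image_image)
    then have cont: "C' \<subseteq> {f. continuous_on UNIV f}" by (auto simp: A_def)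
    have "(\<lambda>_. 1) \<in> C_p closure_of C'"
    proof -
      have "h (\<lambda>_. 1) \<in> h ` (C_p closure_of C')"
        using C(3) closure_of_h[OF cont] C'(3) by simp
      then obtain f where f: "f \<in> C_p closure_of C'" "h (\<lambda>_. 1) = h f" by blast
      then have "continuous_on UNIV f" by (simp add: in_C_p_closure_of)
      then have "f = (\<lambda>_. 1)" using f(2) T_h by (metis continuous_on_const)
      then show ?thesis using f(1) by simp
    qed
    have "\<forall>f\<in>C'. \<exists>F. finite F \<and> (\<forall>x. f x \<noteq> 0 \<longrightarrow> (\<exists>p\<in>F. dist x p < \<epsilon>))"
      using C'(1) by (auto simp: A_def)
    then obtain F where F: "\<And>f. f \<in> C' \<Longrightarrow> finite (F f)"
      "\<And>f x. f \<in> C' \<Longrightarrow> f x \<noteq> 0 \<Longrightarrow> \<exists>p\<in>F f. dist x p < \<epsilon>" by metis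
    have "countable (\<Union>f\<in>C'. F f)" using C'(2) F(1) by (simp add: countable_finite)
    with no have "\<not> (\<forall>x. \<exists>s\<in>(\<Union>f\<in>C'. F f). dist x s < \<epsilon>)" by metis
    then obtain x where x: "\<And>s. s \<in> (\<Union>f\<in>C'. F f) \<Longrightarrow> \<not> dist x s < \<epsilon>" by auto
    have fx: "f x = 0" if "f \<in> C'" for f 
      by (rule ccontr) (use F(2)[OF that, of x] x that in auto)
    have "C' \<inter> C_p_nbhd {x} (1/2) (\<lambda>_. 1) = {}" by (auto simp: C_p_nbhd_def dest!: fx)
    moreover have "C' \<inter> C_p_nbhd {x} (1/2) (\<lambda>_. 1) \<noteq> {}"
      using \<open>(\<lambda>_. 1) \<in> C_p closure_of C'\<close> unfolding in_C_p_closure_of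
      by (metis finite.emptyI finite_insert half_gt_zero zero_less_one)
    ultimately show False by contradiction
  qed
  then have "\<exists>S. \<forall>n::nat. countable (S n) \<and> (\<forall>x::'m. \<exists>s\<in>S n. dist x s < 1 / real (Suc n))"
    by (intro choice allI) simp
  then obtain S where S: "\<And>n::nat. countable (S n)" "\<And>n (x::'m). \<exists>s\<in>S n. dist x s < 1 / real (Suc n)"
    by blast
  show thesis
  proof
    show "countable (\<Union>n. S n)" using S(1) by simp
    show "closure (\<Union>n. S n) = UNIV"
    proof (intro set_eqI iffI UNIV_I)
      fix x :: 'm
      show "x \<in> closure (\<Union>n. S n)"
        unfolding closure_approachable
      proof (intro allI impI)
        fix e :: real assume "e > 0"
        then obtain n where "inverse (real (Suc n)) < e" using reals_Archimedean by blast
        moreover obtain s where "s \<in> S n" "dist x s < 1 / real (Suc n)" using S(2) by blast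
        ultimately have "s \<in> (\<Union>n. S n)" "dist s x < e"
          by (blast, simp add: dist_commute inverse_eq_divide)
        then show "\<exists>y\<in>(\<Union>n. S n). dist y x < e" by (rule rev_bexI)
      qed
    qed
  qed
qed

text \<open>The pointwise topology has a countable network. Its members are given by finite lists of conditions ``on
the ball of radius \<open>1/(k+1)\<close> about \<open>s\<close>, the values differ from \<open>q\<close> by less than \<open>1/(m+1)\<close>'', with \<open>s\<close> in a
countable dense set and \<open>q\<close> rational. One function from each non-empty member gives a dense set.\<close>

lemma C_p_separable:
  assumes "countable (S :: 'm::metric_space set)" "closure S = UNIV"
  obtains Q where "countable Q" "Q \<subseteq> {f :: 'm \<Rightarrow> real. continuous_on UNIV f}"
    "C_p closure_of Q = {f. continuous_on UNIV f}"
proof -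
  define N :: "('m \<times> nat \<times> nat \<times> rat) list \<Rightarrow> ('m \<Rightarrow> real) set" where
    "N l = {f. continuous_on UNIV f \<and> (\<forall>(s, k, m, q)\<in>set l. \<forall>x\<in>ball s (1 / real (Suc k)).
      \<bar>f x - of_rat q\<bar> < 1 / real (Suc m))}" for l
  define I where "I = lists (S \<times> (UNIV :: (nat \<times> nat \<times> rat) set))"
  define Q where "Q = (\<lambda>l. SOME f. f \<in> N l) ` {l\<in>I. N l \<noteq> {}}"
  have some: "(SOME f. f \<in> N l) \<in> N l" if "N l \<noteq> {}" for l
    using that by (simp add: some_in_eq)
  show thesis
  proof
    have "countable I" unfolding I_def using assms(1) by (intro countable_lists countable_SIGMA) auto
    then show "countable Q" unfolding Q_def by (intro countable_image) (rule countable_subset[of _ I], auto)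
    show Qc: "Q \<subseteq> {f. continuous_on UNIV f}" using some by (auto simp: Q_def N_def)
    show "C_p closure_of Q = {f. continuous_on UNIV f}"
    proof (intro set_eqI iffI)
      fix f :: "'m \<Rightarrow> real" assume "f \<in> {f. continuous_on UNIV f}"
      then have f: "continuous_on UNIV f" by simp
      show "f \<in> C_p closure_of Q"
        unfolding in_C_p_closure_of
      proof (intro conjI allI impI f)
        fix F :: "'m set" and \<epsilon> :: real assume F: "finite F" "\<epsilon> > 0"
        obtain m where m: "2 / \<epsilon> < real m" using reals_Archimedean2 by blast
        have m': "2 / real (Suc m) < \<epsilon>" using m F(2) by (simp add: field_simps)
        have "\<exists>s k q. s \<in> S \<and> x \<in> ball s (1 / real (Suc k)) \<and>
            (\<forall>y\<in>ball s (1 / real (Suc k)). \<bar>f y - of_rat q\<bar> < 1 / real (Suc m))" for x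
        proof -
          define \<delta> where "\<delta> = 1 / (3 * real (Suc m))"
          have \<delta>: "\<delta> > 0" "3 * \<delta> = 1 / real (Suc m)" by (simp_all add: \<delta>_def del: of_nat_Suc)
          then have "f x - \<delta> < f x + \<delta>" by simp
          then obtain q where q: "f x - \<delta> < of_rat q" "of_rat q < f x + \<delta>"
            using of_rat_dense by blast
          obtain d where d: "d > 0" "\<And>y. dist y x < d \<Longrightarrow> dist (f y) (f x) < \<delta>"
            using f \<delta>(1) unfolding continuous_on_iff by (metis UNIV_I)
          obtain k where k: "inverse (real (Suc k)) < d / 2" using reals_Archimedean[of "d/2"] d(1) by auto
          have "x \<in> closure S" using assms(2) by simp
          then obtain s where s: "s \<in> S" "dist s x < 1 / real (Suc k)"
            unfolding closure_approachable by (metis of_nat_0_less_iff zero_less_Suc zero_less_divide_1_iff)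
          have "\<bar>f y - of_rat q\<bar> < 1 / real (Suc m)" if "y \<in> ball s (1 / real (Suc k))" for y
          proof -
            have "dist y x < d"
              using that s(2) k dist_triangle[of y x s] by (simp add: dist_commute inverse_eq_divide)
            from d(2)[OF this] have "\<bar>f y - f x\<bar> < \<delta>" by (simp add: dist_real_def)
            then show ?thesis using q \<delta> by linarith
          qed
          then show ?thesis using s by (intro exI[of _ s] exI[of _ k] exI[of _ q]) auto
        qed
        then obtain s k q where skq: "\<And>x. s x \<in> S" "\<And>x. x \<in> ball (s x) (1 / real (Suc (k x)))"
            "\<And>x y. y \<in> ball (s x) (1 / real (Suc (k x))) \<Longrightarrow> \<bar>f y - of_rat (q x)\<bar> < 1 / real (Suc m)"
          by metis
        obtain xs where xs: "set xs = F" using finite_list[OF F(1)] by blast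
        define l where "l = map (\<lambda>x. (s x, k x, m, q x)) xs"
        have "l \<in> I" using skq(1) by (auto simp: I_def l_def in_lists_conv_set)
        have "f \<in> N l" using f skq(3) by (auto simp: N_def l_def)
        then have ne: "N l \<noteq> {}" by blast
        define g where "g = (SOME f. f \<in> N l)"
        have g: "g \<in> N l" unfolding g_def by (rule some[OF ne])
        have "g \<in> Q" unfolding Q_def g_def using \<open>l \<in> I\<close> ne by blast
        moreover have "g \<in> C_p_nbhd F \<epsilon> f"
          unfolding C_p_nbhd_def
        proof (intro CollectI conjI ballI)
          show "continuous_on UNIV g" using g by (simp add: N_def)
          fix x assume "x \<in> F"
          then have "(s x, k x, m, q x) \<in> set l" using xs by (simp add: l_def)
          then have "\<bar>g x - of_rat (q x)\<bar> < 1 / real (Suc m)"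
            using g skq(2)[of x] unfolding N_def by fast
          moreover have "\<bar>f x - of_rat (q x)\<bar> < 1 / real (Suc m)" by (rule skq(3)[OF skq(2)])
          ultimately show "\<bar>g x - f x\<bar> < \<epsilon>" using m' by linarith
        qed
        ultimately show "Q \<inter> C_p_nbhd F \<epsilon> f \<noteq> {}" by blast
      qed
    qed (simp add: in_C_p_closure_of)
  qed
qed

lemma (in C_p_weak_homeomorphism) weakly_separable_codomain:
  obtains Q where "countable Q" "weak_topology closure_of Q = (UNIV :: 'e set)"
proof -
  obtain S :: "'m set" where "countable S" "closure S = UNIV" by (rule separable_domain)
  then obtain Q where Q: "countable Q" "Q \<subseteq> {f :: 'm \<Rightarrow> real. continuous_on UNIV f}"
    "C_p closure_of Q = {f. continuous_on UNIV f}" by (rule C_p_separable)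
  show thesis
  proof
    show "countable (h ` Q)" using Q(1) by simp
    have "UNIV = h ` {f. continuous_on UNIV f}"
      using T_cont h_T by (metis UNIV_eq_I imageI mem_Collect_eq)
    then show "weak_topology closure_of (h ` Q) = UNIV"
      using closure_of_h[OF Q(2)] Q(3) by simp
  qed
qed

text \<open>The Cantor--Bendixson argument: the set of points without a countable neighbourhood has no isolated point.\<close>

lemma separable_scattered_imp_countable:
  fixes S :: "'m::metric_space set"
  assumes S: "countable S" "closure S = UNIV" and sc: "scattered (UNIV :: 'm set)"
  shows "countable (UNIV :: 'm set)"
proof (rule ccontr)
  assume unc: "uncountable (UNIV :: 'm set)"
  define \<B> where "\<B> = {ball s (1 / real (Suc k)) | s k. s \<in> S \<and> countable (ball s (1 / real (Suc k)))}"
  have "\<B> \<subseteq> (\<lambda>(s, k). ball s (1 / real (Suc k))) ` (S \<times> UNIV)" by (auto simp: \<B>_def)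
  moreover have "countable (S \<times> (UNIV :: nat set))" using S(1) by simp
  ultimately have "countable \<B>" by (meson countable_image countable_subset)
  moreover have "countable B" if "B \<in> \<B>" for B using that by (auto simp: \<B>_def)
  ultimately have "countable (\<Union>B\<in>\<B>. B)" by (rule countable_UN)
  then have cU: "countable (\<Union>\<B>)" by simp
  have *: "x \<in> \<Union>\<B>" if V: "open V" "x \<in> V" "countable V" for x V
  proof -
    obtain e where e: "e > 0" "ball x e \<subseteq> V" by (rule openE[OF V(1,2)])
    obtain k where k: "inverse (real (Suc k)) < e / 2" using reals_Archimedean[of "e/2"] e(1) by auto
    have "x \<in> closure S" using S(2) by simp
    then obtain s where s: "s \<in> S" "dist s x < 1 / real (Suc k)"
      unfolding closure_approachable by (metis of_nat_0_less_iff zero_less_Suc zero_less_divide_1_iff)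
    have "ball s (1 / real (Suc k)) \<subseteq> ball x e"
    proof
      fix y assume "y \<in> ball s (1 / real (Suc k))"
      then show "y \<in> ball x e"
        using s(2) k dist_triangle[of x y s] by (simp add: dist_commute inverse_eq_divide)
    qed
    then have "countable (ball s (1 / real (Suc k)))"
      using e(2) V(3) by (meson countable_subset order_trans)
    then have "ball s (1 / real (Suc k)) \<in> \<B>" using s(1) by (auto simp: \<B>_def)
    moreover have "x \<in> ball s (1 / real (Suc k))" using s(2) by simp
    ultimately show ?thesis by blast
  qed
  have "- \<Union>\<B> \<noteq> {}" using unc cU by (metis Compl_empty_eq double_complement)
  then have "\<exists>x. x isolated_in (- \<Union>\<B>)" using sc by (simp add: scattered_def)
  then obtain x where x: "x isolated_in (- \<Union>\<B>)" ..
  then obtain V where V: "open V" "V \<inter> (- \<Union>\<B>) = {x}" and "x \<notin> \<Union>\<B>"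
    by (auto simp: isolated_in_def)
  have "V \<subseteq> insert x (\<Union>\<B>)" using V(2) by blast
  then have "countable V" using cU by (meson countable_insert countable_subset)
  then show False using *[OF V(1)] V(2) \<open>x \<notin> \<Union>\<B>\<close> by blast
qed

section \<open>The Lipschitz-free space\<close>

text \<open>The canonical embedding of the metric space. Together with \<open>pairing\<close> below, it lets the duality with Lipschitz
functions be used on the abstract type.\<close>

definition dirac :: "'n::pointed_metric_space \<Rightarrow> 'n lipschitz_free"
  where "dirac x = Abs_lipschitz_free (lip0_eval x)"

definition pairing :: "'n::pointed_metric_space lip0 \<Rightarrow> 'n lipschitz_free \<Rightarrow> real"
  where "pairing f m = blinfun_apply (functional_of_free m) f"

lemma functional_of_dirac: "functional_of_free (dirac x) = lip0_eval x"
proof -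
  have "lip0_eval x \<in> closure (span (range lip0_eval))"
    by (rule subsetD[OF closure_subset span_base[OF rangeI]])
  then show ?thesis unfolding dirac_def by (rule Abs_lipschitz_free_inverse)
qed

lemma pairing_dirac [simp]: "pairing f (dirac x) = apply_lip0 f x"
  by (simp add: pairing_def functional_of_dirac lip0_eval.rep_eq)

lemma bounded_linear_pairing: "bounded_linear (pairing f)"
proof (rule bounded_linear_intro)
  show "norm (pairing f m) \<le> norm m * norm f" for m
    unfolding pairing_def norm_lipschitz_free.rep_eq by (rule norm_blinfun)
qed (simp_all add: pairing_def plus_lipschitz_free.rep_eq scaleR_lipschitz_free.rep_eq blinfun.bilinear_simps)

lemma pairing_separates:
  assumes "\<And>f. pairing f m = 0"
  shows "m = 0"
proof -
  have "functional_of_free m = 0"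
    by (rule blinfun_eqI) (use assms in \<open>simp add: pairing_def\<close>)
  then show ?thesis
    by (simp add: functional_of_free_inject[symmetric] zero_lipschitz_free.rep_eq)
qed

lemma dist_functional_of_free: "dist (functional_of_free m) (functional_of_free m') = dist m m'"
  by (simp add: dist_norm dist_lipschitz_free_def norm_lipschitz_free.rep_eq minus_lipschitz_free.rep_eq)

lemma complete_lipschitz_free: "complete (UNIV :: 'n::pointed_metric_space lipschitz_free set)"
proof (rule completeI)
  fix X :: "nat \<Rightarrow> 'n lipschitz_free" assume "Cauchy X"
  then have "Cauchy (\<lambda>k. functional_of_free (X k))"
    by (simp add: Cauchy_def dist_functional_of_free)
  then obtain L where L: "(\<lambda>k. functional_of_free (X k)) \<longlonglongrightarrow> L"
    using Cauchy_convergent convergent_def by blast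
  have "L \<in> closure (span (range lip0_eval))"
    by (rule closed_sequentially[OF closed_closure _ L]) (rule functional_of_free)
  then have "functional_of_free (Abs_lipschitz_free L) = L" by (rule Abs_lipschitz_free_inverse)
  with L have "X \<longlonglongrightarrow> Abs_lipschitz_free L"
    by (simp add: tendsto_iff dist_functional_of_free[symmetric])
  then show "\<exists>l\<in>UNIV. X \<longlonglongrightarrow> l" by blast
qed

lemma dist_dirac_le: "dist (dirac x) (dirac y) \<le> dist x y"
proof -
  have "norm (lip0_eval x - lip0_eval y) \<le> dist x y"
  proof (rule norm_blinfun_bound)
    fix f
    show "norm (blinfun_apply (lip0_eval x - lip0_eval y) f) \<le> dist x y * norm f"
      using lip0_bound[of f x y] by (simp add: blinfun.bilinear_simps lip0_eval.rep_eq mult.commute)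
  qed simp
  then show ?thesis
    by (simp add: dist_functional_of_free[symmetric] functional_of_dirac dist_norm)
qed

lemma functional_of_free_span: "span (range lip0_eval) \<subseteq> functional_of_free ` span (range dirac)"
proof -
  have lin: "linear (functional_of_free :: 'a lipschitz_free \<Rightarrow> _)"
    by (simp add: linear_iff plus_lipschitz_free.rep_eq scaleR_lipschitz_free.rep_eq)
  have "range lip0_eval = functional_of_free ` (range dirac :: 'a lipschitz_free set)"
    by (auto simp: functional_of_dirac image_image)
  then show ?thesis
    by (simp add: linear_span_image[OF lin])
qed

lemma closure_span_dirac: "closure (span (range dirac)) = (UNIV :: 'n::pointed_metric_space lipschitz_free set)"
proof (intro set_eqI iffI UNIV_I)
  fix m :: "'n lipschitz_free"
  show "m \<in> closure (span (range dirac))"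
    unfolding closure_approachable
  proof (intro allI impI)
    fix e :: real assume "e > 0"
    then obtain y where y: "y \<in> span (range lip0_eval)" "dist y (functional_of_free m) < e"
      using functional_of_free[of m] unfolding closure_approachable by blast
    then obtain m' where "m' \<in> span (range dirac)" "y = functional_of_free m'"
      using functional_of_free_span by blast
    with y(2) show "\<exists>y\<in>span (range dirac). dist y m < e"
      by (auto simp: dist_functional_of_free)
  qed
qed

lemma apply_Abs_lip0_infdist:
  assumes "base_point \<in> S"
  shows "apply_lip0 (Abs_lip0 (\<lambda>x. infdist x S)) x = infdist x S"
proof -
  have "1-lipschitz_on UNIV (\<lambda>x. infdist x S)"
    by (rule lipschitz_onI) (auto simp: dist_real_def infdist_triangle_abs)
  then show ?thesis
    using assms by (subst Abs_lip0_inverse) auto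
qed

text \<open>Distance functions replace the Hahn--Banach theorem here: the distance to \<open>S\<close> annihilates everything
that is supported in \<open>S\<close>, and no Dirac functional at a point outside the closure of \<open>S\<close>.\<close>

lemma pairing_infdist_eq_0:
  assumes "base_point \<in> S" "m \<in> closure (span (dirac ` S))"
  shows "pairing (Abs_lip0 (\<lambda>x. infdist x S)) m = 0"
proof -
  define f where "f = Abs_lip0 (\<lambda>x. infdist x S)"
  interpret bounded_linear "pairing f" by (rule bounded_linear_pairing)
  have "pairing f y = 0" if "y \<in> dirac ` S" for y
    using that assms(1) by (auto simp: f_def apply_Abs_lip0_infdist)
  then have "span (dirac ` S) \<subseteq> {m. pairing f m = 0}"
    by (intro span_minimal) (auto simp: subspace_def zero add scaleR)
  moreover have "closed {m. pairing f m = 0}"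
    by (intro closed_Collect_eq continuous_intros linear_continuous_on bounded_linear_axioms)
  ultimately have "closure (span (dirac ` S)) \<subseteq> {m. pairing f m = 0}"
    by (rule closure_minimal)
  with assms(2) show ?thesis unfolding f_def by blast
qed

lemma finite_support_of_span:
  assumes "m \<in> span (g ` A)"
  obtains F where "finite F" "F \<subseteq> A" "m \<in> span (g ` F)"
proof -
  from assms obtain t r where t: "finite t" "t \<subseteq> g ` A" "m = (\<Sum>a\<in>t. r a *\<^sub>R a)"
    unfolding span_explicit by blast
  then obtain F where F: "F \<subseteq> A" "finite F" "t = g ` F" by (meson finite_subset_image)
  have "m \<in> span t" unfolding t(3) by (intro span_sum span_scale span_base)
  with F that show thesis by blast
qed

lemma independent_dirac: "independent (dirac ` (- {base_point :: 'n::pointed_metric_space}))"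
  unfolding dependent_def
proof
  assume "\<exists>a\<in>dirac ` (- {base_point :: 'n}). a \<in> span (dirac ` (- {base_point}) - {a})"
  then obtain x :: 'n where x: "x \<noteq> base_point" "dirac x \<in> span (dirac ` (- {base_point}) - {dirac x})" by auto
  have "dirac ` (- {base_point}) - {dirac x} \<subseteq> dirac ` (- {x})" by blast
  with x(2) have "dirac x \<in> span (dirac ` (- {x}))" by (meson span_mono subsetD)
  then obtain F where F: "finite F" "F \<subseteq> - {x}" "dirac x \<in> span (dirac ` F)" by (rule finite_support_of_span)
  define S where "S = insert base_point F"
  have "dirac x \<in> closure (span (dirac ` S))"
    using F(3) closure_subset span_mono[of "dirac ` F" "dirac ` S"] by (auto simp: S_def)
  then have "infdist x S = 0"
    using pairing_infdist_eq_0[of S "dirac x"] by (simp add: S_def apply_Abs_lip0_infdist)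
  moreover have "closed S" "x \<notin> S" "S \<noteq> {}"
    using F x(1) by (auto simp: S_def finite_imp_closed)
  ultimately show False using infdist_pos_not_in_closed[of S x] by simp
qed

lemma inj_dirac: "inj (dirac :: 'n::pointed_metric_space \<Rightarrow> _)"
proof (rule injI, rule ccontr)
  fix x y :: 'n assume xy: "dirac x = dirac y" "x \<noteq> y"
  have *: False if "dirac a = dirac b" "a \<noteq> b" "a \<noteq> base_point" for a b :: 'n
  proof -
    define g where "g = Abs_lip0 (\<lambda>z. infdist z {base_point, b})"
    have g: "apply_lip0 g z = infdist z {base_point, b}" for z
      by (simp add: g_def apply_Abs_lip0_infdist)
    have "apply_lip0 g a = apply_lip0 g b"
      using that(1) by (metis pairing_dirac)
    then have "infdist a {base_point, b} = 0" by (simp add: g)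
    then show False
      using infdist_pos_not_in_closed[of "{base_point, b}" a] that by (simp add: finite_imp_closed)
  qed
  show False
    using *[of x y] *[of y x] xy by metis
qed

lemma infinite_independent_dirac:
  assumes "infinite (UNIV :: 'n::pointed_metric_space set)"
  shows "infinite (dirac ` (- {base_point :: 'n}))"
  using assms inj_dirac by (subst finite_image_iff) (auto intro: inj_on_subset simp: Compl_eq_Diff_UNIV)

lemma countable_dense_rational_span:
  fixes D :: "'a::real_normed_vector set"
  assumes "countable D"
  obtains Q where "countable Q" "closure (span D) \<subseteq> closure Q"
proof -
  define q where "q l = (\<Sum>(r, d)\<leftarrow>l. of_rat r *\<^sub>R d)" for l :: "(rat \<times> 'a) list"
  define Q where "Q = q ` lists (UNIV \<times> D)"
  have "countable (lists ((UNIV :: rat set) \<times> D))"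
    using assms by (intro countable_lists countable_SIGMA) auto
  then have "countable Q" unfolding Q_def by simp
  have Q_add: "x + y \<in> Q" if xy: "x \<in> Q" "y \<in> Q" for x y
  proof -
    obtain l l' where "x = q l" "y = q l'" "l \<in> lists (UNIV \<times> D)" "l' \<in> lists (UNIV \<times> D)"
      using xy unfolding Q_def by blast
    then have "x + y = q (l @ l')" "l @ l' \<in> lists (UNIV \<times> D)" by (auto simp: q_def)
    then show ?thesis unfolding Q_def by blast
  qed
  have Q_scale: "of_rat r *\<^sub>R x \<in> Q" if x: "x \<in> Q" for r x
  proof -
    obtain l where l: "x = q l" "l \<in> lists (UNIV \<times> D)" using x unfolding Q_def by blast
    have "of_rat r *\<^sub>R q l = q (map (\<lambda>(s, d). (r * s, d)) l)"
      unfolding q_def by (induction l) (auto simp: scaleR_add_right of_rat_mult)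
    moreover have "map (\<lambda>(s, d). (r * s, d)) l \<in> lists (UNIV \<times> D)"
      using l(2) by (auto simp: in_lists_conv_set)
    ultimately show ?thesis unfolding Q_def l(1) by blast
  qed
  have "subspace (closure Q)"
  proof (rule subspaceI)
    have "q [] \<in> Q" unfolding Q_def by simp
    then show "0 \<in> closure Q" using closure_subset by (auto simp: q_def)
  next
    fix x y assume "x \<in> closure Q" "y \<in> closure Q"
    then obtain u v where "\<forall>n. u n \<in> Q" "u \<longlonglongrightarrow> x" "\<forall>n. v n \<in> Q" "v \<longlonglongrightarrow> y"
      unfolding closure_sequential by blast
    then show "x + y \<in> closure Q"
      unfolding closure_sequential
      by (intro exI[of _ "\<lambda>n. u n + v n"]) (auto intro: Q_add tendsto_add)
  next
    fix c x assume "x \<in> closure Q"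
    then obtain u where u: "\<forall>n. u n \<in> Q" "u \<longlonglongrightarrow> x" unfolding closure_sequential by blast
    have "\<exists>r. \<bar>real_of_rat r - c\<bar> < 1 / real (Suc n)" for n
    proof -
      have "c < c + 1 / real (Suc n)" by simp
      then obtain r where "c < of_rat r" "of_rat r < c + 1 / real (Suc n)" using of_rat_dense by blast
      then show ?thesis by (intro exI[of _ r]) simp
    qed
    then obtain r where r: "\<And>n. \<bar>real_of_rat (r n) - c\<bar> < 1 / real (Suc n)" by metis
    have "(\<lambda>n. real_of_rat (r n)) \<longlonglongrightarrow> c"
    proof (rule LIM_zero_cancel, rule Lim_null_comparison)
      show "\<forall>\<^sub>F n in sequentially. norm (real_of_rat (r n) - c) \<le> inverse (real (Suc n))"
        using r by (intro always_eventually allI) (simp add: inverse_eq_divide less_imp_le)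
    qed (rule LIMSEQ_inverse_real_of_nat)
    then have "(\<lambda>n. of_rat (r n) *\<^sub>R u n) \<longlonglongrightarrow> c *\<^sub>R x" using u(2) by (rule tendsto_scaleR)
    then show "c *\<^sub>R x \<in> closure Q"
      unfolding closure_sequential using u(1) Q_scale by (intro exI[of _ "\<lambda>n. of_rat (r n) *\<^sub>R u n"]) auto
  qed
  moreover have "D \<subseteq> closure Q"
  proof
    fix d assume "d \<in> D"
    then have "[(1, d)] \<in> lists (UNIV \<times> D)" "q [(1, d)] = d" by (auto simp: q_def)
    then have "d \<in> Q" unfolding Q_def by (metis imageI)
    then show "d \<in> closure Q" using closure_subset by blast
  qed
  ultimately have "span D \<subseteq> closure Q" by (intro span_minimal)
  then have "closure (span D) \<subseteq> closure Q" by (rule closure_minimal) simp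
  with \<open>countable Q\<close> that show thesis by blast
qed

lemma lipschitz_free_separable:
  fixes S :: "'n::pointed_metric_space set"
  assumes S: "countable S" "closure S = UNIV"
  obtains Q :: "'n lipschitz_free set" where "countable Q" "closure Q = UNIV"
proof -
  have "countable (dirac ` S)" using S(1) by simp
  then obtain Q where Q: "countable Q" "closure (span (dirac ` S)) \<subseteq> closure Q"
    by (rule countable_dense_rational_span)
  have "range dirac \<subseteq> closure (span (dirac ` S))"
  proof safe
    fix x :: 'n
    have "x \<in> closure S" using S(2) by simp
    show "dirac x \<in> closure (span (dirac ` S))"
      unfolding closure_approachable
    proof (intro allI impI)
      fix e :: real assume "e > 0"
      with \<open>x \<in> closure S\<close> obtain s where s: "s \<in> S" "dist s x < e" by (auto simp: closure_approachable)
      then have "dist (dirac s) (dirac x) < e" using dist_dirac_le[of s x] by linarith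
      moreover have "dirac s \<in> span (dirac ` S)" using s(1) by (intro span_base imageI)
      ultimately show "\<exists>y\<in>span (dirac ` S). dist y (dirac x) < e" by (rule rev_bexI[rotated])
    qed
  qed
  then have "span (range dirac) \<subseteq> closure (span (dirac ` S))"
    by (intro span_minimal subspace_closure_span)
  then have "closure (span (range dirac)) \<subseteq> closure (span (dirac ` S))" by (rule closure_minimal) simp
  then have "closure Q = UNIV" using Q(2) closure_span_dirac by auto
  with Q(1) that show thesis by blast
qed

lemma weak_closure_of_imp_zero:
  fixes \<psi> :: "'a::real_normed_vector \<Rightarrow> real"
  assumes "bounded_linear \<psi>" "x \<in> weak_topology closure_of Q" "\<And>q. q \<in> Q \<Longrightarrow> \<psi> q = 0"
  shows "\<psi> x = 0"
proof (rule ccontr)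
  assume "\<psi> x \<noteq> 0"
  have "openin weak_topology (\<psi> -` (- {0}))"
    using assms(1) by (rule openin_weak_vimage) (simp add: open_Compl)
  moreover have "x \<in> \<psi> -` (- {0})" using \<open>\<psi> x \<noteq> 0\<close> by simp
  ultimately obtain q where "q \<in> Q" "q \<in> \<psi> -` (- {0})"
    using assms(2) unfolding in_closure_of by metis
  with assms(3) show False by simp
qed

text \<open>Every vector is a norm limit of finitely supported ones, so a countable set of vectors is supported in a
countable set \<open>S\<close> of points. The distance to \<open>S\<close> annihilates these vectors, hence everything by weak density.\<close>

lemma weakly_separable_lipschitz_free:
  fixes Q :: "'n::pointed_metric_space lipschitz_free set"
  assumes Q: "countable Q" "weak_topology closure_of Q = UNIV"
  obtains S :: "'n set" where "countable S" "closure S = UNIV"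
proof -
  have "\<exists>S. countable S \<and> m \<in> closure (span (dirac ` S))" for m :: "'n lipschitz_free"
  proof -
    have "m \<in> closure (span (range dirac))" by (simp add: closure_span_dirac)
    then obtain u where u: "\<forall>k. u k \<in> span (range dirac)" "u \<longlonglongrightarrow> m"
      unfolding closure_sequential by blast
    have "\<exists>F. finite F \<and> u k \<in> span (dirac ` F)" for k
      using u(1) finite_support_of_span[of "u k" dirac UNIV] by metis
    then obtain F where F: "\<And>k. finite (F k)" "\<And>k. u k \<in> span (dirac ` F k)" by metis
    have "u k \<in> span (dirac ` (\<Union>k. F k))" for k
      by (rule subsetD[OF span_mono F(2)]) blast
    then have "m \<in> closure (span (dirac ` (\<Union>k. F k)))"
      unfolding closure_sequential using u(2) by blast
    moreover have "countable (\<Union>k. F k)" using F(1) by (simp add: countable_finite)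
    ultimately show ?thesis by blast
  qed
  then obtain S0 :: "'n lipschitz_free \<Rightarrow> 'n set"
    where S0: "\<And>m. countable (S0 m)" "\<And>m. m \<in> closure (span (dirac ` S0 m))" by metis
  define S where "S = insert base_point (\<Union>m\<in>Q. S0 m)"
  define f where "f = Abs_lip0 (\<lambda>x. infdist x S)"
  have "countable S" using Q(1) S0(1) by (simp add: S_def)
  have vanish: "pairing f q = 0" if "q \<in> Q" for q
    unfolding f_def
  proof (rule pairing_infdist_eq_0)
    have "dirac ` S0 q \<subseteq> dirac ` S" using that by (auto simp: S_def)
    then show "q \<in> closure (span (dirac ` S))"
      using S0(2)[of q] by (meson closure_mono span_mono subsetD)
  qed (simp add: S_def)
  have "infdist x S = 0" for x
  proof -
    have "pairing f (dirac x) = 0"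
      by (rule weak_closure_of_imp_zero[OF bounded_linear_pairing _ vanish]) (use Q(2) in simp_all)
    then show ?thesis by (simp add: f_def apply_Abs_lip0_infdist S_def)
  qed
  then have "closure S = UNIV"
    using in_closure_iff_infdist_zero[of S] by (auto simp: S_def)
  with \<open>countable S\<close> that show thesis by blast
qed

section \<open>Countable domains\<close>

text \<open>Otherwise \<open>x \<mapsto> \<Sum>\<psi>\<in>\<Psi>. \<psi> x *\<^sub>R b \<psi>\<close>, with linearly independent vectors \<open>b \<psi>\<close>, would map the
infinite-dimensional space injectively into a finite-dimensional subspace.\<close>

lemma infinite_dimensional_common_kernel:
  fixes B :: "'a::real_normed_vector set"
  assumes B: "infinite B" "independent B" and "finite \<Psi>" and lin: "\<forall>\<psi>\<in>\<Psi>. linear (\<psi> :: 'a \<Rightarrow> real)"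
  obtains x where "x \<noteq> 0" "\<forall>\<psi>\<in>\<Psi>. \<psi> x = 0"
proof (rule ccontr)
  assume no: "\<not> thesis"
  obtain C where C: "finite C" "card C = card \<Psi>" "C \<subseteq> B"
    using infinite_arbitrarily_large[OF B(1)] by metis
  obtain b where b: "bij_betw b \<Psi> C"
    using finite_same_card_bij[OF \<open>finite \<Psi>\<close> C(1)] C(2) by auto
  then have inj: "inj_on b \<Psi>" and img: "b ` \<Psi> = C" by (auto simp: bij_betw_def)
  define S where "S x = (\<Sum>\<psi>\<in>\<Psi>. \<psi> x *\<^sub>R b \<psi>)" for x
  have lS: "linear S"
  proof (rule linearI)
    show "S (x + y) = S x + S y" for x y
      unfolding S_def sum.distrib[symmetric] using lin
      by (intro sum.cong) (simp_all add: linear_add scaleR_add_left)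
    show "S (c *\<^sub>R x) = c *\<^sub>R S x" for c x
      unfolding S_def scaleR_sum_right using lin
      by (intro sum.cong) (simp_all add: linear_scale)
  qed
  have "x = 0" if "S x = 0" for x
  proof (rule ccontr)
    assume "x \<noteq> 0"
    have "(\<Sum>c\<in>C. (inv_into \<Psi> b c x) *\<^sub>R c) = S x"
      unfolding S_def img[symmetric] using inj by (subst sum.reindex) (auto intro!: sum.cong)
    then have *: "inv_into \<Psi> b c x = 0" if "c \<in> C" for c
      using independentD[OF B(2) C(1,3), of "\<lambda>c. inv_into \<Psi> b c x"] \<open>S x = 0\<close> that by simp
    have "\<psi> x = 0" if "\<psi> \<in> \<Psi>" for \<psi>
      using *[of "b \<psi>"] img inj that by auto
    with no that \<open>x \<noteq> 0\<close> \<open>\<not> thesis\<close> show False using \<open>\<And>x. x \<noteq> 0 \<Longrightarrow> \<forall>\<psi>\<in>\<Psi>. \<psi> x = 0 \<Longrightarrow> thesis\<close> by blast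
  qed
  then have "inj S" using linear_injective_0[OF lS] by blast
  then have "independent (S ` B)"
    by (intro linear_independent_injective_image lS B(2)) (auto intro: inj_on_subset)
  moreover have "S ` B \<subseteq> span C"
    unfolding S_def img[symmetric] by (intro image_subsetI span_sum span_scale span_base imageI)
  ultimately have "finite (S ` B)" using independent_span_bound[OF C(1)] by blast
  then show False using B(1) \<open>inj S\<close> by (metis finite_imageD inj_on_subset subset_UNIV)
qed

text \<open>The functionals vanishing on \<open>y k\<close> for all \<open>k \<ge> n\<close> form closed subspaces that cover the dual as \<open>n\<close> varies. By
Baire's theorem one of them has an interior point, so it is the whole dual.\<close>

lemma eventually_annihilated_imp_zero:
  fixes y :: "nat \<Rightarrow> 'a::real_normed_vector"
  assumes ev: "\<And>\<psi> :: 'a \<Rightarrow> real. bounded_linear \<psi> \<Longrightarrow> \<exists>n. \<forall>k\<ge>n. \<psi> (y k) = 0"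
  obtains n where "\<forall>\<psi> :: 'a \<Rightarrow> real. bounded_linear \<psi> \<longrightarrow> \<psi> (y n) = 0"
proof -
  define G where "G n = {\<psi> :: 'a \<Rightarrow>\<^sub>L real. \<forall>k\<ge>n. blinfun_apply \<psi> (y k) = 0}" for n
  have cl: "closed (G n)" for n
    unfolding G_def by (intro closed_Collect_all closed_Collect_imp closed_Collect_eq open_Collect_const continuous_intros)
  have un: "\<Union>(range G) = UNIV"
    using ev[OF blinfun.bounded_linear_right] by (auto simp: G_def)
  have "\<exists>n. interior (G n) \<noteq> {}"
  proof (rule ccontr)
    assume "\<nexists>n. interior (G n) \<noteq> {}"
    then have int: "\<And>n. interior (G n) = {}" by simp
    have "Met_TC.mtopology interior_of \<Union>(range G) = {}"
    proof (rule Met_TC.metric_Baire_category_alt)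
      show "Met_TC.mcomplete TYPE('a \<Rightarrow>\<^sub>L real)" by (simp add: complete_UNIV)
      show "closedin Met_TC.mtopology T \<and> Met_TC.mtopology interior_of T = {}" if "T \<in> range G" for T
        using that cl int by auto
    qed simp
    then show False unfolding un by simp
  qed
  then obtain n \<psi>0 where "\<psi>0 \<in> interior (G n)" by blast
  then obtain e where e: "e > 0" "ball \<psi>0 e \<subseteq> G n" using mem_interior by blast
  have "\<psi> (y n) = 0" if \<psi>: "bounded_linear \<psi>" for \<psi> :: "'a \<Rightarrow> real"
  proof -
    define \<theta> where "\<theta> = Blinfun \<psi>"
    define c where "c = e / (2 * (norm \<theta> + 1))"
    have "norm \<theta> + 1 > 0" by (smt (verit) norm_ge_zero)
    then have c: "c > 0" "c * norm \<theta> < e"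
      using e(1) by (auto simp: c_def field_simps) (smt (verit) mult_nonneg_nonneg norm_ge_zero)
    have "\<psi>0 + c *\<^sub>R \<theta> \<in> ball \<psi>0 e" using c by (simp add: dist_norm)
    then have "blinfun_apply (\<psi>0 + c *\<^sub>R \<theta>) (y n) = 0" using e(2) by (auto simp: G_def)
    moreover have "\<psi>0 \<in> G n" by (rule subsetD[OF e(2)]) (use e(1) in simp)
    then have "blinfun_apply \<psi>0 (y n) = 0" by (simp add: G_def)
    ultimately show ?thesis
      using c(1) \<psi> by (simp add: blinfun.bilinear_simps \<theta>_def bounded_linear_Blinfun_apply)
  qed
  with that show thesis by blast
qed

text \<open>For countable \<open>M\<close>, let \<open>U n\<close> be a countable neighbourhood base at \<open>T 0\<close>. The weak neighbourhood of \<open>0\<close> given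
by \<open>h ` U n\<close> contains a line spanned by a vector \<open>y n\<close>. A functional that is bounded on \<open>h ` U n\<close> is bounded
on this line, so it vanishes at \<open>y n\<close>, and every functional is bounded on almost all these sets.\<close>

lemma (in C_p_weak_homeomorphism) uncountable_domain:
  fixes B :: "'e set"
  assumes B: "infinite B" "independent B"
    and sep: "\<And>y. (\<And>\<psi> :: 'e \<Rightarrow> real. bounded_linear \<psi> \<Longrightarrow> \<psi> y = 0) \<Longrightarrow> y = (0 :: 'e)"
  shows "uncountable (UNIV :: 'm set)"
proof
  assume "countable (UNIV :: 'm set)"
  define F where "F n = from_nat_into (UNIV :: 'm set) ` {..n}" for n
  define U where "U n = C_p_nbhd (F n) (1 / real (Suc n)) (T 0)" for n
  have F: "finite (F n)" for n by (simp add: F_def)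
  have F_ev: "\<exists>n. F' \<subseteq> F n" if "finite F'" for F' :: "'m set"
  proof -
    define N where "N = Max (insert 0 (to_nat_on (UNIV :: 'm set) ` F'))"
    have "x \<in> F N" if "x \<in> F'" for x
    proof -
      have "to_nat_on (UNIV :: 'm set) x \<le> N" unfolding N_def using that \<open>finite F'\<close> by simp
      moreover have "from_nat_into UNIV (to_nat_on (UNIV :: 'm set) x) = x"
        using \<open>countable (UNIV :: 'm set)\<close> by simp
      ultimately show ?thesis unfolding F_def by (metis atMost_iff imageI)
    qed
    then show ?thesis by blast
  qed
  have F_mono: "F n \<subseteq> F m" if "n \<le> m" for n m using that by (auto simp: F_def)
  have U_mono: "U m \<subseteq> U n" if "n \<le> m" for n m
  proof -
    have "1 / real (Suc m) \<le> 1 / real (Suc n)" using that by (simp add: frac_le)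
    then show ?thesis using F_mono[OF that] unfolding U_def C_p_nbhd_def by fastforce
  qed
  have "\<exists>\<Psi> \<epsilon>. finite \<Psi> \<and> (\<forall>\<psi>\<in>\<Psi>. bounded_linear \<psi>) \<and> \<epsilon> > 0 \<and> weak_nbhd \<Psi> \<epsilon> 0 \<subseteq> h ` U n" for n
  proof -
    \<comment> \<open>The weak neighbourhood of \<open>0\<close> found here contains the common kernel of its functionals.\<close>
    have "openin weak_topology (h ` U n)"
      using homeomorphic_imp_open_map[OF homeomorphic_maps_imp_map[OF homeo]] openin_C_p_nbhd[OF F]
      unfolding open_map_def U_def by blast
    moreover have "T 0 \<in> U n" by (simp add: U_def C_p_nbhd_def T_cont)
    then have "0 \<in> h ` U n" using h_T by (metis imageI)
    ultimately obtain \<Psi> \<epsilon> where "finite \<Psi>" "\<forall>\<psi>\<in>\<Psi>. bounded_linear \<psi>" "\<epsilon> > 0" "weak_nbhd \<Psi> \<epsilon> 0 \<subseteq> h ` U n"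
      by (rule weak_topology_nhd)
    then show ?thesis by (intro exI conjI)
  qed
  then obtain \<Psi> \<epsilon> where \<Psi>: "\<And>n. finite (\<Psi> n)" "\<And>n. \<forall>\<psi>\<in>\<Psi> n. bounded_linear \<psi>" "\<And>n. \<epsilon> n > 0"
      "\<And>n. weak_nbhd (\<Psi> n) (\<epsilon> n) 0 \<subseteq> h ` U n"
    by metis
  have "\<exists>x. x \<noteq> 0 \<and> (\<forall>\<psi>\<in>\<Psi> n. \<psi> x = 0)" for n
  proof -
    have "\<forall>\<psi>\<in>\<Psi> n. linear \<psi>" using \<Psi>(2) bounded_linear.linear by blast
    with B \<Psi>(1)[of n] show ?thesis by (rule infinite_dimensional_common_kernel) blast
  qed
  then obtain y where y: "\<And>n. y n \<noteq> 0" "\<And>n. \<forall>\<psi>\<in>\<Psi> n. \<psi> (y n) = 0" by metis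
  have "\<exists>n. \<forall>k\<ge>n. \<psi> (y k) = 0" if \<psi>: "bounded_linear \<psi>" for \<psi> :: "'e \<Rightarrow> real"
  proof -
    interpret \<psi>: bounded_linear \<psi> by (rule \<psi>)
    have "openin C_p {f \<in> topspace C_p. h f \<in> weak_nbhd {\<psi>} 1 0}"
      by (rule openin_continuous_map_preimage[OF continuous_map_h openin_weak_nbhd]) (use \<psi> in auto)
    moreover have "T 0 \<in> {f \<in> topspace C_p. h f \<in> weak_nbhd {\<psi>} 1 0}"
      by (simp add: T_cont weak_nbhd_def)
    ultimately obtain F' \<delta> where F': "finite F'" "\<delta> > 0"
      "C_p_nbhd F' \<delta> (T 0) \<subseteq> {f \<in> topspace C_p. h f \<in> weak_nbhd {\<psi>} 1 0}" by (rule C_p_nhd)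
    obtain n1 where n1: "F' \<subseteq> F n1" using F_ev[OF F'(1)] by blast
    obtain n2 where n2: "inverse (real (Suc n2)) < \<delta>" using reals_Archimedean[OF F'(2)] by blast
    define n where "n = max n1 n2"
    have "1 / real (Suc n) \<le> 1 / real (Suc n2)" by (simp add: n_def frac_le)
    then have "1 / real (Suc n) < \<delta>" using n2 by (simp add: inverse_eq_divide)
    then have Un: "U n \<subseteq> C_p_nbhd F' \<delta> (T 0)"
      using n1 F_mono[of n1 n] unfolding U_def C_p_nbhd_def n_def by fastforce
    have "\<psi> (y k) = 0" if "k \<ge> n" for k
    proof (rule ccontr)
      assume ne: "\<psi> (y k) \<noteq> 0"
      \<comment> \<open>On this multiple of \<open>y k\<close> the functional \<open>\<psi>\<close> has the value \<open>1\<close>.\<close>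
      define z where "z = (1 / \<psi> (y k)) *\<^sub>R y k"
      have "z \<in> weak_nbhd (\<Psi> k) (\<epsilon> k) 0"
        unfolding weak_nbhd_def
      proof (intro CollectI ballI)
        fix \<theta> assume \<theta>: "\<theta> \<in> \<Psi> k"
        then interpret \<theta>: bounded_linear \<theta> using \<Psi>(2) by blast
        have "\<theta> (y k) = 0" using y(2) \<theta> by blast
        then show "\<bar>\<theta> z - \<theta> 0\<bar> < \<epsilon> k" using \<Psi>(3)[of k] by (simp add: z_def \<theta>.scaleR \<theta>.zero)
      qed
      then have "z \<in> h ` U k" using \<Psi>(4) by blast
      then obtain f where "f \<in> U k" "z = h f" by blast
      then have "z \<in> weak_nbhd {\<psi>} 1 0" using U_mono[OF that] Un F'(3) by blast
      then show False using ne by (simp add: weak_nbhd_def z_def \<psi>.scaleR \<psi>.zero)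
    qed
    then show ?thesis by blast
  qed
  then obtain n where "\<forall>\<psi> :: 'e \<Rightarrow> real. bounded_linear \<psi> \<longrightarrow> \<psi> (y n) = 0"
    by (rule eventually_annihilated_imp_zero)
  then have "y n = 0" by (intro sep) blast
  with y(1) show False by blast
qed

section \<open>Sigma-compactness\<close>

lemma dense_sequence:
  fixes S :: "'a::metric_space set"
  assumes "countable S" "closure S = UNIV"
  obtains s :: "nat \<Rightarrow> 'a" where "\<forall>x. \<forall>\<epsilon>>0. \<exists>i. dist (s i) x < \<epsilon>"
proof
  have "S \<noteq> {}" using assms(2) by auto
  then have range: "range (from_nat_into S) = S" using assms(1) by (simp add: range_from_nat_into)
  show "\<forall>x. \<forall>\<epsilon>>0. \<exists>i. dist (from_nat_into S i) x < \<epsilon>"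
  proof (intro allI impI)
    fix x and \<epsilon> :: real assume "\<epsilon> > 0"
    moreover have "x \<in> closure (range (from_nat_into S))" using assms(2) range by simp
    ultimately show "\<exists>i. dist (from_nat_into S i) x < \<epsilon>" by (auto simp: closure_approachable)
  qed
qed

text \<open>Such a sequence has a totally bounded range.\<close>

lemma convergent_subsequence_of_finite_covers:
  fixes d e :: "nat \<Rightarrow> 'e::metric_space"
  assumes compl: "complete (UNIV :: 'e set)"
    and cov: "\<And>j. \<exists>n. \<forall>k>j. e k \<in> (\<Union>i\<le>n. cball (d i) (1 / real (Suc j)))"
  obtains l r where "strict_mono (r :: nat \<Rightarrow> nat)" "(\<lambda>k. e (r k)) \<longlonglongrightarrow> l"
proof -
  have "compact (closure (range e))"
    unfolding compact_eq_totally_bounded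
  proof (intro conjI allI impI)
    show "complete (closure (range e))"
      using compl by (rule complete_closed_subset[rotated 2]) auto
    fix \<epsilon> :: real assume "\<epsilon> > 0"
    then obtain j where j: "inverse (real (Suc j)) < \<epsilon>" using reals_Archimedean by blast
    define \<rho> where "\<rho> = 1 / real (Suc j)"
    have \<rho>: "\<rho> < \<epsilon>" "\<rho> > 0" using j by (simp_all add: \<rho>_def inverse_eq_divide)
    obtain n where n: "\<forall>k>j. e k \<in> (\<Union>i\<le>n. cball (d i) \<rho>)" using cov unfolding \<rho>_def by blast
    define F where "F = d ` {..n} \<union> e ` {..j}"
    have "range e \<subseteq> (\<Union>x\<in>F. cball x \<rho>)"
    proof safe
      fix k
      show "e k \<in> (\<Union>x\<in>F. cball x \<rho>)"
      proof (cases "k > j")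
        case True
        then obtain i where "i \<le> n" "e k \<in> cball (d i) \<rho>" using n by blast
        then show ?thesis unfolding F_def by blast
      next
        case False
        then have "e k \<in> F" "e k \<in> cball (e k) \<rho>" using \<rho>(2) by (auto simp: F_def)
        then show ?thesis by blast
      qed
    qed
    moreover have "closed (\<Union>x\<in>F. cball x \<rho>)" by (intro closed_UN) (auto simp: F_def)
    ultimately have "closure (range e) \<subseteq> (\<Union>x\<in>F. cball x \<rho>)" by (rule closure_minimal)
    also have "\<dots> \<subseteq> (\<Union>x\<in>F. ball x \<epsilon>)"
      using \<rho>(1) by (intro UN_mono) auto
    finally show "\<exists>F. finite F \<and> closure (range e) \<subseteq> (\<Union>x\<in>F. ball x \<epsilon>)"
      by (intro exI[of _ F] conjI) (simp add: F_def)
  qed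
  then have "seq_compact (closure (range e))" by (simp add: compact_eq_seq_compact_metric)
  moreover have "\<forall>k. e k \<in> closure (range e)" by (meson closure_subset rangeI subsetD)
  ultimately obtain l r where "strict_mono r" "(e \<circ> r) \<longlonglongrightarrow> l" unfolding seq_compact_def by metis
  then show thesis using that[of r l] by (simp add: o_def)
qed

lemma open_imp_countable_Union_closed:
  fixes U :: "'a::metric_space set"
  assumes "open U"
  obtains C :: "nat \<Rightarrow> 'a set" where "\<And>k. closed (C k)" "U = (\<Union>k. C k)"
proof
  define C where "C k = {x. \<forall>y. y \<notin> U \<longrightarrow> 1 / real (Suc k) \<le> dist x y}" for k
  show "closed (C k)" for k
    unfolding C_def by (intro closed_Collect_all closed_Collect_imp open_Collect_const closed_Collect_le continuous_intros)
  show "U = (\<Union>k. C k)"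
  proof (intro set_eqI iffI)
    fix x assume "x \<in> U"
    with assms obtain e where e: "e > 0" "ball x e \<subseteq> U" by (meson openE)
    obtain k where k: "inverse (real (Suc k)) < e" using reals_Archimedean[OF e(1)] by blast
    have "x \<in> C k"
      unfolding C_def
    proof (intro CollectI allI impI)
      fix y assume "y \<notin> U"
      then have "y \<notin> ball x e" using e(2) by blast
      then show "1 / real (Suc k) \<le> dist x y" using k by (simp add: inverse_eq_divide)
    qed
    then show "x \<in> (\<Union>k. C k)" by blast
  next
    fix x assume "x \<in> (\<Union>k. C k)"
    then obtain k where "x \<in> C k" by blast
    show "x \<in> U"
    proof (rule ccontr)
      assume "x \<notin> U"
      then have "1 / real (Suc k) \<le> dist x x" using \<open>x \<in> C k\<close> unfolding C_def by blast
      then show False by simp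
    qed
  qed
qed

text \<open>The truncated distances to a dense sequence embed the space homeomorphically into the Hilbert cube. The
last conclusion records that compact subsets of the image come from compact sets.\<close>

lemma separable_metric_compactification:
  fixes S :: "'m::metric_space set"
  assumes S: "countable S" "closure S = UNIV"
  obtains \<iota> :: "'m \<Rightarrow> nat \<Rightarrow> real" and K where "compact K" "range \<iota> \<subseteq> K" "continuous_on UNIV \<iota>"
    "\<forall>H. compact H \<longrightarrow> H \<subseteq> range \<iota> \<longrightarrow> compact (\<iota> -` H)"
proof -
  obtain s :: "nat \<Rightarrow> 'm" where s: "\<forall>x. \<forall>\<epsilon>>0. \<exists>i. dist (s i) x < \<epsilon>" by (rule dense_sequence[OF S])
  define \<iota> where "\<iota> x i = min 1 (dist x (s i))" for x :: 'm and i
  define K where "K = Pi\<^sub>E (UNIV :: nat set) (\<lambda>_. {0..1::real})"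
  have "compactin (product_topology (\<lambda>_. euclideanreal) (UNIV :: nat set)) K"
    unfolding K_def compactin_PiE by simp
  then have "compact K" by (simp add: euclidean_product_topology)
  moreover have "range \<iota> \<subseteq> K" by (auto simp: K_def \<iota>_def)
  moreover have "continuous_on UNIV \<iota>"
    unfolding \<iota>_def by (intro continuous_on_coordinatewise_then_product continuous_intros)
  moreover have "compact (\<iota> -` H)" if H: "compact H" "H \<subseteq> range \<iota>" for H
    unfolding compact_eq_seq_compact_metric seq_compact_def
  proof (intro allI impI)
    fix x :: "nat \<Rightarrow> 'm" assume "\<forall>k. x k \<in> \<iota> -` H"
    then have "\<forall>k. \<iota> (x k) \<in> H" by simp
    moreover have "seq_compact H" using H(1) by (simp add: compact_eq_seq_compact_metric)
    ultimately obtain l r where l: "l \<in> H" "strict_mono r" "((\<lambda>k. \<iota> (x k)) \<circ> r) \<longlonglongrightarrow> l"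
      unfolding seq_compact_def by meson
    obtain z where z: "l = \<iota> z" using l(1) H(2) by blast
    have lim: "(\<lambda>k. \<iota> (x (r k)) i) \<longlonglongrightarrow> \<iota> z i" for i
    proof -
      have "isCont (\<lambda>f :: nat \<Rightarrow> real. f i) l"
        by (rule continuous_on_interior[OF continuous_on_product_coordinates]) simp
      then have "(\<lambda>k. ((\<lambda>k. \<iota> (x k)) \<circ> r) k i) \<longlonglongrightarrow> l i" using l(3) by (rule isCont_tendsto_compose)
      then show ?thesis by (simp add: z)
    qed
    have "(\<lambda>k. x (r k)) \<longlonglongrightarrow> z"
      unfolding tendsto_iff
    proof (intro allI impI)
      fix e :: real assume "e > 0"
      define \<delta> where "\<delta> = min (e / 2) (1 / 2)"
      have \<delta>: "\<delta> > 0" "\<delta> \<le> e / 2" "\<delta> < 1" using \<open>e > 0\<close> by (auto simp: \<delta>_def)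
      obtain i where i: "dist (s i) z < \<delta>" using s \<delta>(1) by blast
      then have "\<iota> z i < \<delta>" using \<delta>(3) by (simp add: \<iota>_def dist_commute)
      with lim[of i] have "\<forall>\<^sub>F k in sequentially. \<iota> (x (r k)) i < \<delta>" by (rule order_tendstoD(2))
      then show "\<forall>\<^sub>F k in sequentially. dist (x (r k)) z < e"
      proof (rule eventually_mono)
        fix k assume "\<iota> (x (r k)) i < \<delta>"
        then have "dist (x (r k)) (s i) < \<delta>" using \<delta>(3) by (simp add: \<iota>_def min_def split: if_splits)
        then show "dist (x (r k)) z < e" using i \<delta>(2) dist_triangle[of "x (r k)" z "s i"] by linarith
      qed
    qed
    then show "\<exists>l\<in>\<iota> -` H. \<exists>r. strict_mono r \<and> (x \<circ> r) \<longlonglongrightarrow> l"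
      using l(1,2) z by (intro bexI[of _ z] exI[of _ r]) (simp_all add: o_def)
  qed
  ultimately show thesis using that by blast
qed

text \<open>Compact sets that shrink to a point can be merged into one compact set. This is how countably many
counterexamples are combined below.\<close>

lemma compact_insert_Union_shrinking:
  fixes y :: "'a::metric_space" and c :: "nat \<Rightarrow> real"
  assumes L: "\<And>j. compact (L j)" "\<And>j. L j \<subseteq> cball y (c j)" and c: "c \<longlonglongrightarrow> 0"
  shows "compact (insert y (\<Union>j. L j))"
proof (rule compactI)
  fix \<C> assume \<C>: "\<forall>B\<in>\<C>. open B" "insert y (\<Union>j. L j) \<subseteq> \<Union>\<C>"
  then obtain B where B: "B \<in> \<C>" "y \<in> B" by blast
  with \<C>(1) obtain e where e: "e > 0" "ball y e \<subseteq> B" by (meson openE)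
  have "\<forall>\<^sub>F j in sequentially. c j < e" using c e(1) by (rule order_tendstoD(2))
  then obtain N where N: "\<And>j. j \<ge> N \<Longrightarrow> c j < e" by (auto simp: eventually_sequentially)
  have "compact (\<Union>j<N. L j)" using L(1) by (intro compact_UN) auto
  moreover have "(\<Union>j<N. L j) \<subseteq> \<Union>\<C>" using \<C>(2) by blast
  ultimately obtain \<D> where \<D>: "\<D> \<subseteq> \<C>" "finite \<D>" "(\<Union>j<N. L j) \<subseteq> \<Union>\<D>"
    using \<C>(1) by (meson compactE)
  have "L j \<subseteq> \<Union>(insert B \<D>)" for j
  proof (cases "j < N")
    case True
    then have "L j \<subseteq> (\<Union>j<N. L j)" by blast
    then show ?thesis using \<D>(3) by auto
  next
    case False
    then have "cball y (c j) \<subseteq> ball y e" using N[of j] by auto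
    then show ?thesis using L(2)[of j] e(2) by auto
  qed
  then have "insert y (\<Union>j. L j) \<subseteq> \<Union>(insert B \<D>)" using B(2) by blast
  then show "\<exists>\<D>. \<D> \<subseteq> \<C> \<and> finite \<D> \<and> insert y (\<Union>j. L j) \<subseteq> \<Union>\<D>"
    using \<D>(1,2) B(1) by (intro exI[of _ "insert B \<D>"]) simp
qed

text \<open>The map \<open>\<iota>\<close> stands for an embedding of \<open>M\<close> into a compact space \<open>K\<close>, and \<open>e \<mapsto> T e\<close> parametrizes the
continuous functions on \<open>M\<close>.\<close>

locale dominated_compactification =
  fixes T :: "'e::metric_space \<Rightarrow> 'm::metric_space \<Rightarrow> real" and \<iota> :: "'m \<Rightarrow> 'k::metric_space" and K :: "'k set"
  assumes cont_\<iota>: "continuous_on UNIV \<iota>"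
    and surj_T: "\<And>f. continuous_on UNIV f \<Longrightarrow> \<exists>e. T e = f"
begin

definition remainder :: "'k set" where "remainder = K - range \<iota>"

text \<open>Some vector of \<open>A\<close> is mapped to a function that grows at \<open>L\<close> at least like the reciprocal distance to \<open>L\<close>.
As the function is finite on \<open>M\<close>, this keeps \<open>L\<close> away from each point of \<open>M\<close>.\<close>

definition dominated :: "'e set \<Rightarrow> 'k set \<Rightarrow> bool"
  where "dominated A L \<longleftrightarrow> (\<exists>e\<in>A. \<forall>x. \<forall>y\<in>L. 1 \<le> \<bar>T e x\<bar> * dist (\<iota> x) y)"

text \<open>The points near which every compact subset of the remainder is dominated by \<open>A\<close>. Using all compact
sets, not only the single point, makes this set relatively open and makes it depend on \<open>A\<close> continuously
along increasing unions.\<close>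

definition dominated_points :: "'e set \<Rightarrow> 'k set"
  where "dominated_points A = {y\<in>remainder. \<forall>L. compact L \<longrightarrow> L \<subseteq> remainder \<longrightarrow> (\<exists>U. open U \<and> y \<in> U \<and> dominated A (L \<inter> U))}"

lemma dominated_mono: "dominated A L \<Longrightarrow> A \<subseteq> A' \<Longrightarrow> L' \<subseteq> L \<Longrightarrow> dominated A' L'"
  unfolding dominated_def by blast

lemma dominated_pointsD: "y \<in> dominated_points A \<Longrightarrow> compact L \<Longrightarrow> L \<subseteq> remainder \<Longrightarrow> \<exists>U. open U \<and> y \<in> U \<and> dominated A (L \<inter> U)"
  by (simp add: dominated_points_def)

lemma not_dominated_pointsD:
  "y \<in> remainder \<Longrightarrow> y \<notin> dominated_points A \<Longrightarrow>
    \<exists>L. compact L \<and> L \<subseteq> remainder \<and> (\<forall>U. open U \<longrightarrow> y \<in> U \<longrightarrow> \<not> dominated A (L \<inter> U))"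
  by (auto simp: dominated_points_def)

lemma dominated_UNIV:
  assumes "compact L" "L \<subseteq> remainder"
  shows "dominated UNIV L"
proof (cases "L = {}")
  case False
  have pos: "infdist (\<iota> x) L > 0" for x
    using assms False by (intro infdist_pos_not_in_closed compact_imp_closed) (auto simp: remainder_def)
  then have "infdist (\<iota> x) L \<noteq> 0" for x by (metis less_irrefl)
  then have "continuous_on UNIV (\<lambda>x. 1 / infdist (\<iota> x) L)"
    by (intro continuous_intros cont_\<iota>) simp
  then obtain e where e: "T e = (\<lambda>x. 1 / infdist (\<iota> x) L)" using surj_T by blast
  have "1 \<le> \<bar>T e x\<bar> * dist (\<iota> x) y" if "y \<in> L" for x y
    using pos[of x] infdist_le[OF that, of "\<iota> x"] by (simp add: e field_simps)
  then show ?thesis unfolding dominated_def by blast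
qed (simp add: dominated_def)

lemma dominated_points_UNIV: "dominated_points UNIV = remainder"
  unfolding dominated_points_def using dominated_UNIV by (auto intro!: exI[of _ UNIV])

text \<open>If \<open>y\<close> is a limit of points with bad compact sets \<open>L j\<close>, the parts of \<open>L j\<close> near these points form with
\<open>y\<close> one compact set, which would be bad for \<open>y\<close>.\<close>

lemma dominated_points_rel_open:
  assumes "y \<in> dominated_points A"
  shows "\<exists>U. open U \<and> y \<in> U \<and> U \<inter> remainder \<subseteq> dominated_points A"
proof (rule ccontr)
  assume no: "\<nexists>U. open U \<and> y \<in> U \<and> U \<inter> remainder \<subseteq> dominated_points A"
  have "\<exists>z L. dist y z < 1 / real (Suc j) \<and> compact L \<and> L \<subseteq> remainder \<and>
      (\<forall>U. open U \<longrightarrow> z \<in> U \<longrightarrow> \<not> dominated A (L \<inter> U))" for j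
  proof -
    have "\<not> ball y (1 / real (Suc j)) \<inter> remainder \<subseteq> dominated_points A" using no by (metis centre_in_ball of_nat_0_less_iff open_ball zero_less_Suc zero_less_divide_1_iff)
    then obtain z where "z \<in> ball y (1 / real (Suc j)) \<inter> remainder" "z \<notin> dominated_points A" by (meson subsetI)
    then have z: "dist y z < 1 / real (Suc j)" "z \<in> remainder" "z \<notin> dominated_points A" by simp_all
    show ?thesis using not_dominated_pointsD[OF z(2,3)] z(1) by metis
  qed
  then obtain z L where z: "\<And>j. dist y (z j) < 1 / real (Suc j)" and L: "\<And>j. compact (L j)" "\<And>j. L j \<subseteq> remainder"
    "\<And>j U. open U \<Longrightarrow> z j \<in> U \<Longrightarrow> \<not> dominated A (L j \<inter> U)" by metis
  define B where "B j = cball (z j) (1 / real (Suc j))" for j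
  have B: "B j \<subseteq> cball y (2 * inverse (real (Suc j)))" for j
  proof
    fix x assume "x \<in> B j"
    then show "x \<in> cball y (2 * inverse (real (Suc j)))"
      using z[of j] dist_triangle[of y x "z j"] by (simp add: B_def inverse_eq_divide)
  qed
  have lim: "(\<lambda>j. 2 * inverse (real (Suc j))) \<longlonglongrightarrow> 0"
    using tendsto_mult_right_zero[OF LIMSEQ_inverse_real_of_nat] by simp
  define L' where "L' = insert y (\<Union>j. L j \<inter> B j)"
  have "compact L'"
    unfolding L'_def using B by (intro compact_insert_Union_shrinking[OF _ _ lim]) (auto simp: B_def intro!: compact_Int_closed L(1))
  moreover have "L' \<subseteq> remainder" using L(2) assms by (auto simp: L'_def dominated_points_def)
  ultimately obtain U where U: "open U" "y \<in> U" "dominated A (L' \<inter> U)"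
    using dominated_pointsD[OF assms] by metis
  obtain e where e: "e > 0" "ball y e \<subseteq> U" using U(1,2) by (meson openE)
  have "\<forall>\<^sub>F j in sequentially. 2 * inverse (real (Suc j)) < e" using lim e(1) by (rule order_tendstoD(2))
  then obtain j where j: "2 * inverse (real (Suc j)) < e" by (auto simp: eventually_sequentially)
  have "cball y (2 * inverse (real (Suc j))) \<subseteq> ball y e" using j by auto
  then have "L j \<inter> ball (z j) (1 / real (Suc j)) \<subseteq> L' \<inter> U"
    using B[of j] e(2) ball_subset_cball[of "z j" "1 / real (Suc j)"] unfolding L'_def B_def by blast
  with U(3) have "dominated A (L j \<inter> ball (z j) (1 / real (Suc j)))" by (rule dominated_mono[OF _ order_refl])
  then show False using L(3)[of "ball (z j) (1 / real (Suc j))" j] by simp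
qed

text \<open>If each \<open>A n\<close> has a bad compact set at \<open>y\<close>, then the parts of these sets in balls that shrink to \<open>y\<close> form
one compact set that is bad for all \<open>n\<close> at once.\<close>

lemma dominated_points_Union:
  assumes mono: "\<And>m n. m \<le> n \<Longrightarrow> A m \<subseteq> A n"
  shows "dominated_points (\<Union>n. A n) \<subseteq> (\<Union>n::nat. dominated_points (A n))"
proof (rule subsetI, rule ccontr)
  fix y assume y: "y \<in> dominated_points (\<Union>n. A n)" "y \<notin> (\<Union>n. dominated_points (A n))"
  have "\<exists>L. compact L \<and> L \<subseteq> remainder \<and> (\<forall>U. open U \<longrightarrow> y \<in> U \<longrightarrow> \<not> dominated (A n) (L \<inter> U))" for n
  proof (rule not_dominated_pointsD)
    show "y \<in> remainder" using y(1) by (simp add: dominated_points_def)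
    show "y \<notin> dominated_points (A n)" using y(2) by simp
  qed
  then obtain L where L: "\<And>n. compact (L n)" "\<And>n. L n \<subseteq> remainder"
    "\<And>n U. open U \<Longrightarrow> y \<in> U \<Longrightarrow> \<not> dominated (A n) (L n \<inter> U)" by metis
  define L' where "L' = insert y (\<Union>n. L n \<inter> cball y (inverse (real (Suc n))))"
  have "compact L'"
    unfolding L'_def by (intro compact_insert_Union_shrinking[OF _ _ LIMSEQ_inverse_real_of_nat]) (auto intro!: compact_Int_closed L(1))
  moreover have "L' \<subseteq> remainder" using L(2) y(1) by (auto simp: L'_def dominated_points_def)
  ultimately obtain U where U: "open U" "y \<in> U" "dominated (\<Union>n. A n) (L' \<inter> U)"
    using dominated_pointsD[OF y(1)] by metis
  then obtain e where e: "e \<in> (\<Union>n. A n)" "\<forall>x. \<forall>y\<in>L' \<inter> U. 1 \<le> \<bar>T e x\<bar> * dist (\<iota> x) y"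
    unfolding dominated_def by blast
  then obtain n0 where n0: "e \<in> A n0" by blast
  obtain d where d: "d > 0" "ball y d \<subseteq> U" using U(1,2) by (meson openE)
  obtain n1 where n1: "inverse (real (Suc n1)) < d" using reals_Archimedean[OF d(1)] by blast
  define n where "n = max n0 n1"
  have "inverse (real (Suc n)) \<le> inverse (real (Suc n1))" by (simp add: n_def)
  then have "ball y (inverse (real (Suc n))) \<subseteq> U" using n1 d(2) by (meson less_eq_real_def order_le_less_trans subset_ball order_trans)
  moreover have "L n \<inter> cball y (inverse (real (Suc n))) \<subseteq> L'" unfolding L'_def by blast
  ultimately have "L n \<inter> ball y (inverse (real (Suc n))) \<subseteq> L' \<inter> U"
    using ball_subset_cball[of y "inverse (real (Suc n))"] by blast
  moreover have "e \<in> A n" using n0 mono[of n0 n] by (auto simp: n_def)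
  ultimately have "dominated (A n) (L n \<inter> ball y (inverse (real (Suc n))))"
    using e(2) unfolding dominated_def by blast
  moreover have "y \<in> ball y (inverse (real (Suc n)))" by simp
  ultimately show False using L(3)[OF open_ball] by blast
qed

text \<open>The dominating vectors have a convergent subsequence by the covering condition. So the values of their
functions at \<open>x\<close> stay bounded, while domination forces them to grow like the reciprocal distance of \<open>y k\<close>
from \<open>\<iota> x\<close>.\<close>

lemma limit_of_dominated_points_notin_range:
  fixes d :: "nat \<Rightarrow> 'e"
  assumes cont: "\<And>x. continuous_on UNIV (\<lambda>e. T e x)" and compl: "complete (UNIV :: 'e set)"
    and y: "\<And>k. y k \<in> dominated_points (A k)" "y \<longlonglongrightarrow> \<iota> x"
    and A: "\<And>j. \<exists>n. \<forall>k>j. A k \<subseteq> (\<Union>i\<le>n. cball (d i) (1 / real (Suc j)))"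
  shows False
proof -
  have "\<exists>e\<in>A k. \<forall>x. 1 \<le> \<bar>T e x\<bar> * dist (\<iota> x) (y k)" for k
  proof -
    have "y k \<in> remainder" using y(1)[of k] by (simp add: dominated_points_def)
    then have "\<exists>U. open U \<and> y k \<in> U \<and> dominated (A k) ({y k} \<inter> U)"
      by (intro dominated_pointsD[OF y(1)]) simp_all
    then obtain U where "y k \<in> U" "dominated (A k) ({y k} \<inter> U)" by metis
    then have "dominated (A k) {y k}" by simp
    then show ?thesis by (simp add: dominated_def)
  qed
  then obtain e where e: "\<And>k. e k \<in> A k" "\<And>k x. 1 \<le> \<bar>T (e k) x\<bar> * dist (\<iota> x) (y k)" by metis
  have cov: "\<exists>n. \<forall>k>j. e k \<in> (\<Union>i\<le>n. cball (d i) (1 / real (Suc j)))" for j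
    using A[of j] e(1) by (meson subsetD)
  obtain l r where r: "strict_mono r" "(\<lambda>k. e (r k)) \<longlonglongrightarrow> l"
    by (rule convergent_subsequence_of_finite_covers[OF compl cov])
  have "(\<lambda>k. T (e (r k)) x) \<longlonglongrightarrow> T l x"
    by (rule continuous_on_tendsto_compose[OF cont r(2)]) simp_all
  moreover have "(\<lambda>k. y (r k)) \<longlonglongrightarrow> \<iota> x"
    using LIMSEQ_subseq_LIMSEQ[OF y(2) r(1)] by (simp add: o_def)
  then have "(\<lambda>k. dist (\<iota> x) (y (r k))) \<longlonglongrightarrow> dist (\<iota> x) (\<iota> x)"
    by (rule tendsto_dist[OF tendsto_const])
  ultimately have "(\<lambda>k. \<bar>T (e (r k)) x\<bar> * dist (\<iota> x) (y (r k))) \<longlonglongrightarrow> \<bar>T l x\<bar> * dist (\<iota> x) (\<iota> x)"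
    by (intro tendsto_mult tendsto_rabs)
  then have "1 \<le> \<bar>T l x\<bar> * dist (\<iota> x) (\<iota> x)"
    by (rule LIMSEQ_le_const) (use e(2) in blast)
  then show False by simp
qed

end

text \<open>The relatively open sets \<open>dominated_points (As s)\<close>, indexed by finite lists \<open>s\<close>, form a tree in which each
set is the union of its children. Let \<open>W s\<close> be the largest open set with this trace on the
remainder. If \<open>\<iota> x\<close> is a limit of the remainder, it cannot lie in \<open>W s\<close> along an infinite branch, by the
previous lemma. So it lies in some \<open>W s\<close> but in none of its children. The set \<open>R s\<close> of these points
does not meet the remainder and is a difference of two open sets, hence a countable union of closed sets. Therefore the part of
\<open>M\<close> in it is \<open>\<sigma>\<close>-compact.\<close>

theorem sigma_compact_of_polish_parametrization:
  fixes T :: "'e::metric_space \<Rightarrow> 'm::metric_space \<Rightarrow> real"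
  assumes compl: "complete (UNIV :: 'e set)" and Q: "countable Q" "closure Q = (UNIV :: 'e set)"
    and S: "countable S" "closure S = (UNIV :: 'm set)"
    and cont: "\<And>x. continuous_on UNIV (\<lambda>e. T e x)"
    and surj: "\<And>f. continuous_on UNIV f \<Longrightarrow> \<exists>e. T e = f"
  shows "sigma_compact_space (euclidean :: 'm topology)"
proof -
  obtain \<iota> :: "'m \<Rightarrow> nat \<Rightarrow> real" and K where K: "compact K" "range \<iota> \<subseteq> K" "continuous_on UNIV \<iota>"
    and pre: "\<forall>H. compact H \<longrightarrow> H \<subseteq> range \<iota> \<longrightarrow> compact (\<iota> -` H)"
    by (rule separable_metric_compactification[OF S])
  interpret dominated_compactification T \<iota> K
    by unfold_locales (use K surj in auto)
  obtain d :: "nat \<Rightarrow> 'e" where d: "\<forall>e. \<forall>\<epsilon>>0. \<exists>i. dist (d i) e < \<epsilon>" by (rule dense_sequence[OF Q])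
  define A where "A j n = (\<Union>i\<le>n. cball (d i) (1 / real (Suc j)))" for j n
  have A_mono: "A j m \<subseteq> A j n" if "m \<le> n" for j m n
    unfolding A_def using that by (intro UN_mono) auto
  have A_UN: "(\<Union>n. A j n) = UNIV" for j
  proof (intro set_eqI iffI UNIV_I)
    fix e :: 'e
    have "1 / real (Suc j) > 0" by simp
    then obtain i where "dist (d i) e < 1 / real (Suc j)" using d by blast
    then have "e \<in> A j i" unfolding A_def by (intro UN_I[of i]) auto
    then show "e \<in> (\<Union>n. A j n)" by blast
  qed
  \<comment> \<open>A child \<open>n # s\<close> of \<open>s\<close> adds the \<open>n\<close>-th set of the cover by balls of radius \<open>1/(length s + 1)\<close>.\<close>
  define As where "As = rec_list UNIV (\<lambda>n s B. B \<inter> A (length s) n)"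
  have As: "As [] = UNIV" "As (n # s) = As s \<inter> A (length s) n" for n s by (simp_all add: As_def)
  define W where "W s = - closure (remainder - dominated_points (As s))" for s
  have W_remainder: "W s \<inter> remainder = dominated_points (As s)" for s
  proof (intro set_eqI iffI)
    fix y assume "y \<in> W s \<inter> remainder"
    then show "y \<in> dominated_points (As s)" unfolding W_def using closure_subset[of "remainder - dominated_points (As s)"] by blast
  next
    fix y assume y: "y \<in> dominated_points (As s)"
    then obtain U where U: "open U" "y \<in> U" "U \<inter> remainder \<subseteq> dominated_points (As s)" using dominated_points_rel_open by blast
    then have "U \<inter> closure (remainder - dominated_points (As s)) = {}" by (subst open_Int_closure_eq_empty) auto
    with U(2) y show "y \<in> W s \<inter> remainder" unfolding W_def dominated_points_def by blast
  qed
  define R where "R s = W s - (\<Union>n. W (n # s))" for s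
  have R_remainder: "R s \<inter> remainder = {}" for s
  proof -
    have "As s = (\<Union>n. As (n # s))" using A_UN[of "length s"] by (auto simp: As)
    moreover have "dominated_points (\<Union>n. As (n # s)) \<subseteq> (\<Union>n. dominated_points (As (n # s)))"
      by (rule dominated_points_Union) (use A_mono in \<open>auto simp: As\<close>)
    ultimately have "dominated_points (As s) \<subseteq> (\<Union>n. dominated_points (As (n # s)))" by simp
    then show ?thesis using W_remainder unfolding R_def by blast
  qed
  have cover: "\<iota> x \<in> - closure remainder \<or> (\<exists>s. \<iota> x \<in> R s)" for x
  proof (rule ccontr)
    assume "\<not> (\<iota> x \<in> - closure remainder \<or> (\<exists>s. \<iota> x \<in> R s))"
    then have clY: "\<iota> x \<in> closure remainder" and nR: "\<And>s. \<iota> x \<in> W s \<Longrightarrow> \<exists>n. \<iota> x \<in> W (n # s)"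
      by (auto simp: R_def)
    have "\<iota> x \<in> W []" by (simp add: W_def As dominated_points_UNIV)
    have "\<exists>f. \<forall>k. (\<iota> x \<in> W (f k) \<and> length (f k) = k) \<and> (\<exists>n. f (Suc k) = n # f k)"
    proof (rule dependent_nat_choice)
      show "\<exists>s. \<iota> x \<in> W s \<and> length s = 0" using \<open>\<iota> x \<in> W []\<close> by simp
      show "\<exists>s'. (\<iota> x \<in> W s' \<and> length s' = Suc k) \<and> (\<exists>n. s' = n # s)"
        if s: "\<iota> x \<in> W s \<and> length s = k" for s k
      proof -
        obtain n where "\<iota> x \<in> W (n # s)" using nR[of s] s by blast
        then show ?thesis using s by (intro exI[of _ "n # s"]) simp
      qed
    qed
    then obtain f where f: "\<And>k. \<iota> x \<in> W (f k)" "\<And>k. length (f k) = k" "\<And>k. \<exists>n. f (Suc k) = n # f k" by metis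
    have dec: "As (f (Suc k)) \<subseteq> As (f k)" for k using f(3)[of k] As(2) by auto
    have dec': "As (f k) \<subseteq> As (f j)" if "j \<le> k" for j k
      using that by (induction rule: dec_induct) (use dec in blast)+
    have "\<exists>y. y \<in> dominated_points (As (f k)) \<and> dist y (\<iota> x) < inverse (real (Suc k))" for k
    proof -
      have "open (W (f k) \<inter> ball (\<iota> x) (inverse (real (Suc k))))" by (auto simp: W_def)
      moreover have "\<iota> x \<in> W (f k) \<inter> ball (\<iota> x) (inverse (real (Suc k)))" using f(1) by simp
      ultimately have "W (f k) \<inter> ball (\<iota> x) (inverse (real (Suc k))) \<inter> remainder \<noteq> {}"
        using clY open_Int_closure_eq_empty by (metis disjoint_iff)
      then obtain y where "y \<in> W (f k) \<inter> ball (\<iota> x) (inverse (real (Suc k))) \<inter> remainder" by blast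
      then have "y \<in> W (f k) \<inter> remainder" "dist y (\<iota> x) < inverse (real (Suc k))"
        by (simp_all add: dist_commute)
      then show ?thesis unfolding W_remainder by blast
    qed
    then obtain y where y: "\<And>k. y k \<in> dominated_points (As (f k))" "\<And>k. dist (y k) (\<iota> x) < inverse (real (Suc k))" by metis
    have "y \<longlonglongrightarrow> \<iota> x"
      by (rule metric_tendsto_imp_tendsto[OF LIMSEQ_inverse_real_of_nat]) (use y(2) in \<open>auto intro!: always_eventually less_imp_le\<close>)
    have chain: "\<exists>n. \<forall>k>j. As (f k) \<subseteq> (\<Union>i\<le>n. cball (d i) (1 / real (Suc j)))" for j
    proof -
      obtain n where n: "f (Suc j) = n # f j" using f(3) by blast
      have "As (f k) \<subseteq> A j n" if "k > j" for k
        using dec'[of "Suc j" k] that n f(2)[of j] by (auto simp: As)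
      then show ?thesis unfolding A_def by (intro exI[of _ n] allI impI)
    qed
    show False by (rule limit_of_dominated_points_notin_range[OF cont compl y(1) \<open>y \<longlonglongrightarrow> \<iota> x\<close> chain])
  qed
  have compact_pieces: "\<exists>\<K>. countable \<K> \<and> (\<forall>H\<in>\<K>. compact H) \<and> \<iota> -` (G \<inter> H) \<subseteq> \<Union>\<K>"
    if "open G" "closed H" "G \<inter> H \<inter> remainder = {}" for G H
  proof -
    obtain C :: "nat \<Rightarrow> (nat \<Rightarrow> real) set" where C: "\<And>k. closed (C k)" "G = (\<Union>k. C k)"
      using open_imp_countable_Union_closed[OF \<open>open G\<close>] by metis
    define \<K> where "\<K> = range (\<lambda>k. \<iota> -` (K \<inter> (C k \<inter> H)))"
    have "compact (\<iota> -` (K \<inter> (C k \<inter> H)))" for k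
    proof (rule pre[rule_format])
      show "compact (K \<inter> (C k \<inter> H))" using C(1) that(2) K(1) by (intro compact_Int_closed closed_Int)
      show "K \<inter> (C k \<inter> H) \<subseteq> range \<iota>" using that(3) C(2) unfolding remainder_def by blast
    qed
    then have "countable \<K>" "\<forall>H\<in>\<K>. compact H" by (auto simp: \<K>_def)
    moreover have "\<iota> -` (G \<inter> H) \<subseteq> \<Union>\<K>" using C(2) K(2) by (auto simp: \<K>_def)
    ultimately show ?thesis by blast
  qed
  obtain \<K>0 where \<K>0: "countable \<K>0" "\<forall>H\<in>\<K>0. compact H" "\<iota> -` (- closure remainder) \<subseteq> \<Union>\<K>0"
  proof -
    have "\<exists>\<K>. countable \<K> \<and> (\<forall>H\<in>\<K>. compact H) \<and> \<iota> -` (- closure remainder \<inter> UNIV) \<subseteq> \<Union>\<K>"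
      using closure_subset[of remainder] by (intro compact_pieces) auto
    then show thesis using that by (metis Int_UNIV_right)
  qed
  have "\<exists>\<K>. countable \<K> \<and> (\<forall>H\<in>\<K>. compact H) \<and> \<iota> -` R s \<subseteq> \<Union>\<K>" for s
  proof -
    have "R s = W s \<inter> - (\<Union>n. W (n # s))" by (auto simp: R_def)
    moreover have "open (W s)" for s by (simp add: W_def open_Compl)
    then have "open (W s)" "closed (- (\<Union>n. W (n # s)))" by auto
    ultimately show ?thesis using compact_pieces[of "W s" "- (\<Union>n. W (n # s))"] R_remainder[of s] by simp
  qed
  then obtain \<K>1 where \<K>1: "\<And>s. countable (\<K>1 s)" "\<And>s. \<forall>H\<in>\<K>1 s. compact H" "\<And>s. \<iota> -` R s \<subseteq> \<Union>(\<K>1 s)"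
    by metis
  define \<K> where "\<K> = \<K>0 \<union> (\<Union>s. \<K>1 s)"
  have "countable \<K>" using \<K>0(1) \<K>1(1) by (simp add: \<K>_def)
  moreover have "\<forall>H\<in>\<K>. compact H" using \<K>0(2) \<K>1(2) by (auto simp: \<K>_def)
  moreover have "x \<in> \<Union>\<K>" for x
    using cover[of x]
  proof
    assume "\<iota> x \<in> - closure remainder"
    then have "x \<in> \<Union>\<K>0" by (intro subsetD[OF \<K>0(3)]) simp
    then show ?thesis by (auto simp: \<K>_def)
  next
    assume "\<exists>s. \<iota> x \<in> R s"
    then obtain s where "\<iota> x \<in> R s" ..
    then have "x \<in> \<Union>(\<K>1 s)" by (intro subsetD[OF \<K>1(3)]) simp
    then show ?thesis by (auto simp: \<K>_def)
  qed
  then have "\<Union>\<K> = UNIV" by blast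
  ultimately show ?thesis unfolding sigma_compact_space_def by auto
qed

text \<open>The centres approach \<open>p\<close> so fast that balls with a quarter of their distance to \<open>p\<close> as radius are disjoint.\<close>

section \<open>Families that absorb weakly convergent sequences\<close>

lemma shrinking_bumps:
  fixes p :: "'m::metric_space"
  assumes p: "p islimpt UNIV"
  obtains b :: "nat \<Rightarrow> 'm \<Rightarrow> real" and x where "\<And>i. continuous_on UNIV (b i)" "x \<longlonglongrightarrow> p"
    "\<And>i. b i (x i) = 1" "\<And>i. b i p = 0" "\<And>i j z. i < j \<Longrightarrow> b i z = 0 \<or> b j z = 0"
proof -
  have "\<exists>x. \<forall>i::nat. (x i \<noteq> p \<and> dist (x i) p < inverse (real (Suc i))) \<and> dist (x (Suc i)) p < dist (x i) p / 4"
  proof (rule dependent_nat_choice)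
    show "\<exists>x. x \<noteq> p \<and> dist x p < inverse (real (Suc 0))"
      using p[unfolded islimpt_approachable] by (auto dest: spec[of _ 1])
    fix x and i :: nat assume "x \<noteq> p \<and> dist x p < inverse (real (Suc i))"
    then have "min (inverse (real (Suc (Suc i)))) (dist x p / 4) > 0" by simp
    then have "\<exists>z\<in>UNIV. z \<noteq> p \<and> dist z p < min (inverse (real (Suc (Suc i)))) (dist x p / 4)"
      using p[unfolded islimpt_approachable] by blast
    then show "\<exists>z. (z \<noteq> p \<and> dist z p < inverse (real (Suc (Suc i)))) \<and> dist z p < dist x p / 4" by auto
  qed
  then obtain x where x: "\<And>i. x i \<noteq> p" "\<And>i. dist (x i) p < inverse (real (Suc i))"
    "\<And>i. dist (x (Suc i)) p < dist (x i) p / 4" by metis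
  define r where "r i = dist (x i) p" for i
  have r: "r i > 0" "r (Suc i) < r i / 4" for i using x by (simp_all add: r_def)
  have r_less: "r j < r i / 4" if "i < j" for i j
    using that
  proof (induction j)
    case (Suc j)
    then show ?case using r[of j] r(2)[of i] by (cases "i = j") auto
  qed simp
  define b where "b i z = max 0 (1 - 4 * dist z (x i) / r i)" for i z
  have b_near: "dist z (x i) < r i / 4" if "b i z \<noteq> 0" for i z
    using that r(1)[of i] by (auto simp: b_def max_def field_simps split: if_splits)
  show thesis
  proof
    show "continuous_on UNIV (b i)" for i
      unfolding b_def using r(1)[of i] by (intro continuous_intros) auto
    show "x \<longlonglongrightarrow> p"
      by (rule metric_tendsto_imp_tendsto[OF LIMSEQ_inverse_real_of_nat])
        (use x(2) in \<open>auto intro!: always_eventually less_imp_le\<close>)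
    show "b i (x i) = 1" for i by (simp add: b_def)
    show "b i p = 0" for i
      using b_near[of i p] r(1)[of i] by (cases "b i p = 0") (auto simp: r_def dist_commute)
    show "b i z = 0 \<or> b j z = 0" if "i < j" for i j z
    proof (rule ccontr)
      assume "\<not> (b i z = 0 \<or> b j z = 0)"
      then have "dist z (x i) < r i / 4" "dist z (x j) < r j / 4" using b_near by auto
      moreover have "r i \<le> dist z (x i) + dist z p" unfolding r_def by (metis dist_commute dist_triangle)
      moreover have "dist z p \<le> dist z (x j) + r j" unfolding r_def by (rule dist_triangle)
      ultimately show False using r_less[OF that] r(1)[of i] by linarith
    qed
  qed
qed

text \<open>Let \<open>f I\<close> be the sum of the bumps with index in \<open>I\<close>. For finite \<open>I\<close> and each \<open>j\<close> there are \<open>n\<close> and \<open>m\<close> such that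
\<open>h (f (I \<union> J)) \<in> A j n\<close> for all finite \<open>J \<subseteq> {m..}\<close>: otherwise there are exceptions \<open>J n\<close> moving off to infinity,
\<open>f (I \<union> J n)\<close> converges pointwise to \<open>f I\<close>, and the image of this sequence is absorbed by a single \<open>A j n\<close>.
Hence one can add indices one by one, the \<open>j\<close>-th choice fixing \<open>n j\<close> for all later sums. The images of
these sums then have a weak cluster point, so the sums have a cluster point in \<open>C\<^sub>p(M)\<close>. It would be the
pointwise limit, which is \<open>0\<close> at \<open>p\<close> and \<open>1\<close> at centres arbitrarily close to \<open>p\<close>.\<close>

lemma (in C_p_weak_homeomorphism) not_strongly_dominated:
  fixes A :: "nat \<Rightarrow> nat \<Rightarrow> 'e set" and p :: 'm
  assumes p: "p islimpt UNIV"
    and mono: "\<And>j m n. m \<le> n \<Longrightarrow> A j m \<subseteq> A j n"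
    and absorbs: "\<And>y l j. limitin weak_topology y l sequentially \<Longrightarrow> \<exists>n. \<forall>k. y k \<in> A j n"
    and clusters: "\<And>y. \<forall>j. \<exists>n. \<forall>k. y k \<in> A j n \<Longrightarrow>
      \<exists>l. \<forall>U. openin weak_topology U \<longrightarrow> l \<in> U \<longrightarrow> (\<exists>\<^sub>F k in sequentially. y k \<in> U)"
  shows False
proof -
  obtain b x where b: "\<And>i. continuous_on UNIV (b i)" and x: "x \<longlonglongrightarrow> p" and b1: "\<And>i. b i (x i) = 1"
    and bp: "\<And>i. b i p = (0::real)" and disj: "\<And>i j z. i < j \<Longrightarrow> b i z = 0 \<or> b j z = 0"
    using shrinking_bumps[OF p] by metis
  define f where "f I z = (\<Sum>i\<in>I. b i z)" for I :: "nat set" and z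
  have f_cont: "continuous_on UNIV (f I)" for I
    unfolding f_def by (intro continuous_intros b)
  have disj': "b j z = 0" if "b i z \<noteq> 0" "j \<noteq> i" for i j z
    using disj[of i j z] disj[of j i z] that by (cases i j rule: linorder_cases) auto
  have b_ev: "\<exists>N. \<forall>i\<ge>N. b i z = 0" for z
  proof (cases "\<exists>i. b i z \<noteq> 0")
    case True
    then obtain i where "b i z \<noteq> 0" by blast
    then show ?thesis using disj'[of i z] by (intro exI[of _ "Suc i"]) auto
  qed auto
  have perturb: "\<exists>n m. \<forall>J. finite J \<longrightarrow> J \<subseteq> {m..} \<longrightarrow> h (f (I \<union> J)) \<in> A j n" if "finite I" for I j
  proof (rule ccontr)
    assume "\<not> ?thesis"
    then have "\<exists>J. finite J \<and> J \<subseteq> {n..} \<and> h (f (I \<union> J)) \<notin> A j n" for n by blast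
    then obtain J where J: "\<And>n. finite (J n)" "\<And>n. J n \<subseteq> {n..}" "\<And>n. h (f (I \<union> J n)) \<notin> A j n" by metis
    have "(\<lambda>n. f (I \<union> J n) z) \<longlonglongrightarrow> f I z" for z
    proof (rule tendsto_eventually)
      obtain N where N: "\<And>i. i \<ge> N \<Longrightarrow> b i z = 0" using b_ev[of z] by blast
      have "f (I \<union> J n) z = f I z" if "n \<ge> N" for n
        unfolding f_def using J(1,2)[of n] \<open>finite I\<close> N that
        by (intro sum.mono_neutral_right) (auto simp: subset_iff intro!: N)
      then show "\<forall>\<^sub>F n in sequentially. f (I \<union> J n) z = f I z"
        by (auto simp: eventually_sequentially)
    qed
    then have "limitin weak_topology (\<lambda>n. h (f (I \<union> J n))) (h (f I)) sequentially"
      by (intro limitin_weak_h f_cont)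
    then obtain n where "\<forall>k. h (f (I \<union> J k)) \<in> A j n" using absorbs[of _ _ j] by blast
    then show False using J(3) by blast
  qed
  have "\<exists>I. \<forall>k. finite (I k) \<and> (\<exists>m. I (Suc k) = insert m (I k) \<and> (\<forall>i\<in>I k. i < m) \<and>
      (\<exists>n. \<forall>J. finite J \<longrightarrow> J \<subseteq> {m..} \<longrightarrow> h (f (I k \<union> J)) \<in> A k n))"
  proof (rule dependent_nat_choice)
    show "\<exists>I. finite (I :: nat set)" by blast
    fix I :: "nat set" and k assume "finite I"
    then obtain n m where m: "\<And>J. finite J \<Longrightarrow> J \<subseteq> {m..} \<Longrightarrow> h (f (I \<union> J)) \<in> A k n"
      using perturb by metis
    define m' where "m' = Suc (Max (insert m I))"
    have m': "m \<le> m'" "\<forall>i\<in>I. i < m'"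
      using \<open>finite I\<close> by (auto simp: m'_def less_Suc_eq_le le_Suc_eq)
    have hJ: "h (f (I \<union> J)) \<in> A k n" if "finite J" "J \<subseteq> {m'..}" for J
    proof (rule m)
      show "J \<subseteq> {m..}" using that(2) m'(1) by (meson atLeast_subset_iff order_trans)
    qed (rule that(1))
    have "\<exists>n. \<forall>J. finite J \<longrightarrow> J \<subseteq> {m'..} \<longrightarrow> h (f (I \<union> J)) \<in> A k n"
      by (intro exI[of _ n] allI impI hJ)
    then show "\<exists>I'. finite I' \<and> (\<exists>m. I' = insert m I \<and> (\<forall>i\<in>I. i < m) \<and>
        (\<exists>n. \<forall>J. finite J \<longrightarrow> J \<subseteq> {m..} \<longrightarrow> h (f (I \<union> J)) \<in> A k n))"
      using m'(2) \<open>finite I\<close>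
      by - (rule exI[of _ "insert m' I"], rule conjI, simp, rule exI[of _ m'], simp)
  qed
  then obtain I m n where I: "\<And>k. finite (I k)" "\<And>k. I (Suc k) = insert (m k) (I k)"
      "\<And>k i. i \<in> I k \<Longrightarrow> i < m k"
      "\<And>k J. finite J \<Longrightarrow> J \<subseteq> {m k..} \<Longrightarrow> h (f (I k \<union> J)) \<in> A k (n k)"
    by metis
  have later: "I j \<subseteq> I k \<and> I k - I j \<subseteq> {m j..} \<and> (j < k \<longrightarrow> m j \<in> I k)" if "j \<le> k" for j k
    using that
  proof (induction k rule: dec_induct)
    case (step k)
    have "m j \<le> m k" using step I(3)[of "m j" k] by (cases "j = k") auto
    then show ?case using step I(2)[of k] by (auto simp: less_Suc_eq)
  qed auto
  have m_ge: "k \<le> m k" for k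
  proof (induction k)
    case (Suc k)
    have "m k \<in> I (Suc k)" using I(2) by simp
    then show ?case using I(3) Suc by fastforce
  qed simp
  define y where "y k = h (f (I k))" for k
  have "\<exists>N. \<forall>k. y k \<in> A j N" for j
  proof -
    have "\<exists>N. y k \<in> A j N" for k
    proof -
      have "limitin weak_topology (\<lambda>_::nat. y k) (y k) sequentially" by (simp add: limitin_weak_iff)
      then show ?thesis using absorbs by blast
    qed
    then obtain N0 where N0: "\<And>k. y k \<in> A j (N0 k)" by metis
    define N where "N = Max (insert (n j) (N0 ` {..j}))"
    have "y k \<in> A j N" for k
    proof (cases "k \<le> j")
      case True
      then have "N0 k \<in> insert (n j) (N0 ` {..j})" by simp
      then have "N0 k \<le> N" unfolding N_def by (intro Max_ge) auto
      then show ?thesis using mono N0 by blast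
    next
      case False
      then have "I j \<subseteq> I k" "I k - I j \<subseteq> {m j..}" using later[of j k] by auto
      then have "h (f (I j \<union> (I k - I j))) \<in> A j (n j)" using I(1) by (intro I(4)) auto
      moreover have "I j \<union> (I k - I j) = I k" using \<open>I j \<subseteq> I k\<close> by blast
      moreover have "n j \<le> N" unfolding N_def by simp
      ultimately show ?thesis unfolding y_def using mono by (metis subsetD)
    qed
    then show ?thesis by blast
  qed
  then obtain l where l: "\<And>U. openin weak_topology U \<Longrightarrow> l \<in> U \<Longrightarrow> \<exists>\<^sub>F k in sequentially. y k \<in> U"
    using clusters[of y] by metis
  have T_l: "T l z = c" if c: "\<forall>\<^sub>F k in sequentially. f (I k) z = c" for z c
  proof (rule ccontr)
    assume "T l z \<noteq> c"
    define U where "U = {e \<in> topspace weak_topology. T e z \<in> - {c}}"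
    have "openin weak_topology U"
      unfolding U_def by (rule openin_continuous_map_preimage[OF weak_T_eval]) (simp add: open_Compl)
    then have "\<exists>\<^sub>F k in sequentially. y k \<in> U" using \<open>T l z \<noteq> c\<close> by (intro l) (simp_all add: U_def)
    moreover have "\<forall>\<^sub>F k in sequentially. y k \<notin> U"
      using c by (rule eventually_mono) (simp add: U_def y_def T_h[OF f_cont])
    ultimately show False by (simp add: frequently_def)
  qed
  have "T l p = 0" by (rule T_l) (simp add: f_def bp)
  moreover have "T l (x (m j)) = 1" for j
  proof (rule T_l)
    have "f (I k) (x (m j)) = 1" if "k \<ge> Suc j" for k
    proof -
      have "m j \<in> I k" using later[of j k] that by simp
      have "f (I k) (x (m j)) = (\<Sum>i\<in>{m j}. b i (x (m j)))"
        unfolding f_def using I(1)[of k] \<open>m j \<in> I k\<close> disj'[of "m j" "x (m j)"] b1[of "m j"]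
        by (intro sum.mono_neutral_right) auto
      then show ?thesis using b1 by simp
    qed
    then show "\<forall>\<^sub>F k in sequentially. f (I k) (x (m j)) = 1" by (auto simp: eventually_sequentially)
  qed
  moreover have "(\<lambda>j. T l (x (m j))) \<longlonglongrightarrow> T l p"
  proof (rule continuous_on_tendsto_compose[OF T_cont])
    have "filterlim m at_top sequentially"
      using m_ge by (auto simp: filterlim_at_top eventually_sequentially intro: order_trans)
    then show "(\<lambda>j. x (m j)) \<longlonglongrightarrow> p" by (rule filterlim_compose[OF x])
  qed simp_all
  ultimately show False by (simp add: LIMSEQ_const_iff)
qed

section \<open>Equi-integrability\<close>

text \<open>The \<open>L\<^sub>1\<close> distance of \<open>f\<close> from the order interval between \<open>- n g\<close> and \<open>n g\<close>. A set is equi-integrable if its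
excess tends to \<open>0\<close> uniformly as \<open>n\<close> grows.\<close>

definition excess :: "'w measure \<Rightarrow> ('w \<Rightarrow> real) \<Rightarrow> nat \<Rightarrow> ('w \<Rightarrow> real) \<Rightarrow> real"
  where "excess \<mu> g n f = (\<integral>w. max 0 (\<bar>f w\<bar> - real n * g w) \<partial>\<mu>)"

lemma integrable_excess:
  "integrable \<mu> f \<Longrightarrow> integrable \<mu> g \<Longrightarrow> integrable \<mu> (\<lambda>w. max 0 (\<bar>f w\<bar> - real n * g w))"
  by (intro Bochner_Integration.integrable_max Bochner_Integration.integrable_diff
      integrable_abs integrable_mult_right) simp_all

lemma excess_antimono:
  assumes "integrable \<mu> f" "integrable \<mu> g" "\<And>w. 0 \<le> g w" "m \<le> n"
  shows "excess \<mu> g n f \<le> excess \<mu> g m f"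
  unfolding excess_def
proof (rule integral_mono[OF integrable_excess[OF assms(1,2)] integrable_excess[OF assms(1,2)]])
  fix w
  have "real m * g w \<le> real n * g w" using assms(3,4) by (intro mult_right_mono) auto
  then show "max 0 (\<bar>f w\<bar> - real n * g w) \<le> max 0 (\<bar>f w\<bar> - real m * g w)" by linarith
qed

lemma excess_add:
  assumes "integrable \<mu> f1" "integrable \<mu> f2" "integrable \<mu> f" "integrable \<mu> g"
    and "AE w in \<mu>. f w = f1 w + f2 w"
  shows "excess \<mu> g (m + n) f \<le> excess \<mu> g m f1 + excess \<mu> g n f2"
proof -
  have "excess \<mu> g (m + n) f \<le>
      (\<integral>w. max 0 (\<bar>f1 w\<bar> - real m * g w) + max 0 (\<bar>f2 w\<bar> - real n * g w) \<partial>\<mu>)"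
    unfolding excess_def
  proof (rule integral_mono_AE)
    show "AE w in \<mu>. max 0 (\<bar>f w\<bar> - real (m + n) * g w) \<le>
        max 0 (\<bar>f1 w\<bar> - real m * g w) + max 0 (\<bar>f2 w\<bar> - real n * g w)"
      using assms(5)
    proof eventually_elim
      case (elim w)
      have "real (m + n) * g w = real m * g w + real n * g w" by (simp add: distrib_right)
      then show ?case using elim by linarith
    qed
  qed (intro Bochner_Integration.integrable_add integrable_excess assms)+
  also have "\<dots> = excess \<mu> g m f1 + excess \<mu> g n f2"
    unfolding excess_def by (intro Bochner_Integration.integral_add integrable_excess assms)
  finally show ?thesis .
qed

lemma integral_abs_le_excess:
  assumes "integrable \<mu> f" "integrable \<mu> g"
  shows "(\<integral>w. \<bar>f w\<bar> \<partial>\<mu>) \<le> excess \<mu> g n f + real n * (\<integral>w. g w \<partial>\<mu>)"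
proof -
  have "(\<integral>w. \<bar>f w\<bar> \<partial>\<mu>) \<le> (\<integral>w. max 0 (\<bar>f w\<bar> - real n * g w) + real n * g w \<partial>\<mu>)"
    by (rule integral_mono)
      (use assms in \<open>auto intro!: Bochner_Integration.integrable_add integrable_excess\<close>)
  also have "\<dots> = excess \<mu> g n f + (\<integral>w. real n * g w \<partial>\<mu>)"
    unfolding excess_def by (intro Bochner_Integration.integral_add integrable_excess assms) (use assms in simp)
  finally show ?thesis by simp
qed

lemma AE_summable:
  fixes f :: "nat \<Rightarrow> 'w \<Rightarrow> real"
  assumes f: "\<And>i. integrable \<mu> (f i)" "\<And>i w. 0 \<le> f i w" and s: "summable (\<lambda>i. \<integral>w. f i w \<partial>\<mu>)"
  shows "AE w in \<mu>. summable (\<lambda>i. f i w)"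
proof -
  have "(\<integral>\<^sup>+w. (\<Sum>i. ennreal (f i w)) \<partial>\<mu>) = (\<Sum>i. \<integral>\<^sup>+w. ennreal (f i w) \<partial>\<mu>)"
    using f(1) by (intro nn_integral_suminf) auto
  also have "\<dots> = (\<Sum>i. ennreal (\<integral>w. f i w \<partial>\<mu>))"
    using f by (intro suminf_cong nn_integral_eq_integral) auto
  also have "\<dots> = ennreal (\<Sum>i. \<integral>w. f i w \<partial>\<mu>)"
    using f(2) s by (intro suminf_ennreal2) auto
  finally have "(\<integral>\<^sup>+w. (\<Sum>i. ennreal (f i w)) \<partial>\<mu>) \<noteq> \<infinity>" by simp
  moreover have "(\<lambda>w. \<Sum>i. ennreal (f i w)) \<in> borel_measurable \<mu>"
    using f(1) by measurable
  ultimately have "AE w in \<mu>. (\<Sum>i. ennreal (f i w)) \<noteq> \<infinity>"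
    by (intro nn_integral_noteq_infinite)
  then show ?thesis
    by eventually_elim (rule summable_suminf_not_top, use f(2) in auto)
qed

lemma integrable_bounded_mult:
  fixes u v :: "'w \<Rightarrow> real"
  assumes "integrable \<mu> u" "v \<in> borel_measurable \<mu>" "\<And>w. \<bar>v w\<bar> \<le> K"
  shows "integrable \<mu> (\<lambda>w. v w * u w)"
proof (rule Bochner_Integration.integrable_bound)
  show "integrable \<mu> (\<lambda>w. K * u w)" using assms(1) by simp
  show "AE w in \<mu>. norm (v w * u w) \<le> norm (K * u w)"
    using assms(3) by (intro AE_I2) (auto simp: abs_mult intro!: mult_right_mono order_trans[OF assms(3)])
qed (use assms in auto)

text \<open>The hump lives where \<open>\<bar>f k\<bar>\<close> exceeds \<open>n g\<close> for a large \<open>n\<close>. It is scaled so that its integral against \<open>f k\<close> is exactly \<open>\<epsilon>\<close>;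
then its integral against \<open>g\<close> is at most \<open>\<epsilon> / n\<close>, whatever the norm of \<open>f k\<close>.\<close>

lemma hump_step:
  fixes f :: "nat \<Rightarrow> 'w \<Rightarrow> real"
  assumes g: "integrable \<mu> g" "\<And>w. 0 \<le> g w" and f: "\<And>k. integrable \<mu> (f k)"
    and small: "\<And>k \<epsilon>. \<epsilon> > 0 \<Longrightarrow> \<exists>n. excess \<mu> g n (f k) \<le> \<epsilon>"
    and large: "\<And>n. \<exists>k. \<epsilon> < excess \<mu> g n (f k)"
    and I: "finite I" and \<epsilon>: "\<epsilon> > 0" and \<eta>: "\<eta> > 0"
  shows "\<exists>k b. k \<notin> I \<and> b \<in> borel_measurable \<mu> \<and> (\<forall>w. \<bar>b w\<bar> \<le> 1) \<and>
    (\<integral>w. b w * f k w \<partial>\<mu>) = \<epsilon> \<and> (\<forall>i\<in>I. (\<integral>w. \<bar>b w\<bar> * \<bar>f i w\<bar> \<partial>\<mu>) \<le> \<eta>)"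
proof -
  \<comment> \<open>The bound \<open>\<epsilon>\<close> forces the new index outside \<open>I\<close>, and \<open>\<eta> / 2\<close> makes the hump small against the old functions.\<close>
  define \<theta> where "\<theta> = min (\<eta> / 2) \<epsilon>"
  have \<theta>: "\<theta> > 0" "\<theta> \<le> \<eta> / 2" "\<theta> \<le> \<epsilon>" using \<epsilon> \<eta> by (auto simp: \<theta>_def)
  have "\<forall>i. \<exists>n. excess \<mu> g n (f i) \<le> \<theta>" using small \<theta>(1) by blast
  then obtain m0 where m0: "\<And>i. excess \<mu> g (m0 i) (f i) \<le> \<theta>" by metis
  define m where "m = Max (insert 0 (m0 ` I))"
  have m: "excess \<mu> g n (f i) \<le> \<theta>" if "i \<in> I" "m \<le> n" for i n
  proof -
    have "m0 i \<le> m" unfolding m_def using I that(1) by (intro Max_ge) auto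
    then have "excess \<mu> g n (f i) \<le> excess \<mu> g (m0 i) (f i)"
      using that(2) by (intro excess_antimono f g) auto
    with m0 show ?thesis by (rule order_trans[rotated])
  qed
  obtain n' where n': "2 * real m * \<epsilon> / \<eta> < real n'" using reals_Archimedean2 by blast
  define n where "n = Suc (max m n')"
  have n: "m \<le> n" "n > 0" by (auto simp: n_def)
  have "2 * real m * \<epsilon> / \<eta> < real n" using n' by (auto simp: n_def)
  then have mn: "real m * (\<epsilon> / real n) \<le> \<eta> / 2"
    using \<eta> n(2) by (simp add: field_simps)
  obtain k where k: "\<epsilon> < excess \<mu> g n (f k)" using large by blast
  have "k \<notin> I" using m[OF _ n(1), of k] k \<theta>(3) by fastforce
  define a where "a w = (if real n * g w < \<bar>f k w\<bar> then 1 else 0 :: real)" for w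
  have [measurable]: "f i \<in> borel_measurable \<mu>" "g \<in> borel_measurable \<mu>" for i
    using f g(1) by auto
  have [measurable]: "a \<in> borel_measurable \<mu>" unfolding a_def by measurable
  have a01: "0 \<le> a w" "a w \<le> 1" for w by (auto simp: a_def)
  define t where "t = (\<integral>w. a w * \<bar>f k w\<bar> \<partial>\<mu>)"
  have int_af: "integrable \<mu> (\<lambda>w. a w * \<bar>f k w\<bar>)" using a01 f by (intro integrable_bounded_mult[where K = 1]) auto
  have int_ag: "integrable \<mu> (\<lambda>w. a w * g w)" using a01 g by (intro integrable_bounded_mult[where K = 1]) auto
  have "excess \<mu> g n (f k) \<le> t"
    unfolding excess_def t_def
  proof (rule integral_mono[OF integrable_excess[OF f g(1)] int_af])
    fix w show "max 0 (\<bar>f k w\<bar> - real n * g w) \<le> a w * \<bar>f k w\<bar>" using g(2)[of w] by (auto simp: a_def)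
  qed
  with k have t: "\<epsilon> < t" by simp
  define c where "c = \<epsilon> / t"
  have c: "0 < c" "c < 1" "c * t = \<epsilon>" using t \<epsilon> by (auto simp: c_def)
  define b where "b w = c * a w * sgn (f k w)" for w
  have [measurable]: "b \<in> borel_measurable \<mu>" unfolding b_def by measurable
  have b_le: "\<bar>b w\<bar> \<le> c * a w" for w
  proof -
    have "\<bar>b w\<bar> = c * a w * \<bar>sgn (f k w)\<bar>" using c(1) a01[of w] by (simp add: b_def abs_mult)
    also have "\<dots> \<le> c * a w * 1" using c(1) a01[of w] by (intro mult_left_mono) (auto simp: sgn_if)
    finally show ?thesis by simp
  qed
  have b1: "\<bar>b w\<bar> \<le> 1" for w
  proof -
    have "c * a w \<le> 1 * 1" using c a01[of w] by (intro mult_mono) auto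
    then show ?thesis using b_le[of w] by simp
  qed
  have "(\<integral>w. b w * f k w \<partial>\<mu>) = (\<integral>w. c * (a w * \<bar>f k w\<bar>) \<partial>\<mu>)"
    by (intro Bochner_Integration.integral_cong) (auto simp: b_def sgn_if)
  also have "\<dots> = \<epsilon>" using c(3) by (simp add: t_def)
  finally have bf: "(\<integral>w. b w * f k w \<partial>\<mu>) = \<epsilon>" .
  have ag: "real n * (\<integral>w. a w * g w \<partial>\<mu>) \<le> t"
  proof -
    have "(\<integral>w. real n * (a w * g w) \<partial>\<mu>) \<le> t"
      unfolding t_def by (rule integral_mono[OF _ int_af]) (use int_ag in \<open>auto simp: a_def\<close>)
    then show ?thesis by simp
  qed
  have bg: "(\<integral>w. \<bar>b w\<bar> * g w \<partial>\<mu>) \<le> \<epsilon> / real n"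
  proof -
    have "(\<integral>w. \<bar>b w\<bar> * g w \<partial>\<mu>) \<le> (\<integral>w. c * (a w * g w) \<partial>\<mu>)"
    proof (rule integral_mono)
      show "integrable \<mu> (\<lambda>w. \<bar>b w\<bar> * g w)" using b1 g by (intro integrable_bounded_mult[where K = 1]) auto
      show "integrable \<mu> (\<lambda>w. c * (a w * g w))" using int_ag by simp
      show "\<bar>b w\<bar> * g w \<le> c * (a w * g w)" for w
        using mult_right_mono[OF b_le g(2)] by (simp add: mult.assoc)
    qed
    also have "\<dots> = c * (\<integral>w. a w * g w \<partial>\<mu>)" by simp
    also have "\<dots> \<le> c * (t / real n)"
      using ag n(2) c(1) by (intro mult_left_mono) (auto simp: field_simps)
    also have "\<dots> = \<epsilon> / real n" using c(3) by simp
    finally show ?thesis .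
  qed
  have "(\<integral>w. \<bar>b w\<bar> * \<bar>f i w\<bar> \<partial>\<mu>) \<le> \<eta>" if "i \<in> I" for i
  proof -
    have "(\<integral>w. \<bar>b w\<bar> * \<bar>f i w\<bar> \<partial>\<mu>) \<le>
        (\<integral>w. max 0 (\<bar>f i w\<bar> - real m * g w) + real m * (\<bar>b w\<bar> * g w) \<partial>\<mu>)"
    proof (rule integral_mono)
      show "integrable \<mu> (\<lambda>w. \<bar>b w\<bar> * \<bar>f i w\<bar>)" using b1 f by (intro integrable_bounded_mult[where K = 1]) auto
      show "integrable \<mu> (\<lambda>w. max 0 (\<bar>f i w\<bar> - real m * g w) + real m * (\<bar>b w\<bar> * g w))"
        using b1 g f by (intro Bochner_Integration.integrable_add integrable_excess integrable_mult_right integrable_bounded_mult[where K = 1]) auto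
      fix w
      have "\<bar>f i w\<bar> \<le> max 0 (\<bar>f i w\<bar> - real m * g w) + real m * g w" by linarith
      then have "\<bar>b w\<bar> * \<bar>f i w\<bar> \<le> \<bar>b w\<bar> * (max 0 (\<bar>f i w\<bar> - real m * g w) + real m * g w)"
        by (intro mult_left_mono) auto
      also have "\<dots> \<le> 1 * max 0 (\<bar>f i w\<bar> - real m * g w) + real m * (\<bar>b w\<bar> * g w)"
        unfolding distrib_left using b1[of w]
        by (intro add_mono mult_right_mono) (auto simp: mult.left_commute)
      finally show "\<bar>b w\<bar> * \<bar>f i w\<bar> \<le> max 0 (\<bar>f i w\<bar> - real m * g w) + real m * (\<bar>b w\<bar> * g w)" by simp
    qed
    also have "\<dots> = excess \<mu> g m (f i) + real m * (\<integral>w. \<bar>b w\<bar> * g w \<partial>\<mu>)"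
    proof -
      have "integrable \<mu> (\<lambda>w. real m * (\<bar>b w\<bar> * g w))"
        using b1 g by (intro integrable_mult_right integrable_bounded_mult[where K = 1]) auto
      then show ?thesis
        unfolding excess_def using f g by (subst Bochner_Integration.integral_add) (auto intro: integrable_excess)
    qed
    also have "\<dots> \<le> \<eta> / 2 + real m * (\<epsilon> / real n)"
      using m[OF that order_refl] \<theta>(2) bg by (intro add_mono mult_left_mono) auto
    also have "\<dots> \<le> \<eta>" using mn by linarith
    finally show ?thesis .
  qed
  with \<open>k \<notin> I\<close> b1 bf show ?thesis by (intro exI[of _ k] exI[of _ b]) auto
qed

text \<open>A gliding hump. If equi-integrability fails, humps \<open>b\<close> are added one after the other to a function \<open>B\<close>, as
\<open>(1 - \<bar>b\<bar>) B \<plusminus> b\<close>, which keeps \<open>\<bar>B\<bar> \<le> 1\<close>. Since \<open>\<bar>X + \<epsilon>\<bar>\<close> or \<open>\<bar>X - \<epsilon>\<bar>\<close> is at least \<open>\<epsilon>\<close> for every \<open>X\<close>, a suitable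
sign makes the integral of the new \<open>B\<close> against \<open>f k\<close> at least \<open>\<epsilon>\<close> in absolute value. Later humps are
almost invisible to \<open>f k\<close>, so the limit function \<open>b\<close> has integral at least \<open>\<epsilon>/2\<close> in absolute value against
infinitely many of the \<open>f k\<close>.\<close>

lemma weakly_null_imp_equiintegrable:
  fixes f :: "nat \<Rightarrow> 'w \<Rightarrow> real"
  assumes g: "integrable \<mu> g" "\<And>w. 0 \<le> g w" and f: "\<And>k. integrable \<mu> (f k)"
    and small: "\<And>k \<epsilon>. \<epsilon> > 0 \<Longrightarrow> \<exists>n. excess \<mu> g n (f k) \<le> \<epsilon>"
    and null: "\<And>b. b \<in> borel_measurable \<mu> \<Longrightarrow> (\<And>w. \<bar>b w\<bar> \<le> 1) \<Longrightarrow>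
      (\<lambda>k. \<integral>w. b w * f k w \<partial>\<mu>) \<longlonglongrightarrow> 0"
    and \<epsilon>: "\<epsilon> > 0"
  shows "\<exists>n. \<forall>k. excess \<mu> g n (f k) \<le> \<epsilon>"
proof (rule ccontr)
  assume "\<nexists>n. \<forall>k. excess \<mu> g n (f k) \<le> \<epsilon>"
  then have large: "\<exists>k. \<epsilon> < excess \<mu> g n (f k)" for n by (meson not_le)
  have [measurable]: "f i \<in> borel_measurable \<mu>" for i using f by auto
  define P where "P = (\<lambda>s :: ('w \<Rightarrow> real) \<times> nat set. fst s \<in> borel_measurable \<mu> \<and>
    (\<forall>w. \<bar>fst s w\<bar> \<le> 1) \<and> finite (snd s))"
  define Q where "Q = (\<lambda>(l::nat) (s :: ('w \<Rightarrow> real) \<times> nat set) s'. \<exists>k. k \<notin> snd s \<and> snd s' = insert k (snd s) \<and>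
    \<epsilon> \<le> \<bar>\<integral>w. fst s' w * f k w \<partial>\<mu>\<bar> \<and>
    (\<forall>i\<in>snd s. (\<integral>w. \<bar>fst s' w - fst s w\<bar> * \<bar>f i w\<bar> \<partial>\<mu>) \<le> \<epsilon> / 4 * (1/2) ^ l))"
  have "\<exists>s. \<forall>l. P (s l) \<and> Q l (s l) (s (Suc l))"
  proof (rule dependent_nat_choice)
    show "\<exists>s. P s" by (intro exI[of _ "(\<lambda>_. 0, {})"]) (simp add: P_def)
  next
    fix s l assume s: "P s"
    define B where "B = fst s"
    define I where "I = snd s"
    have [measurable]: "B \<in> borel_measurable \<mu>" and B1: "\<And>w. \<bar>B w\<bar> \<le> 1" and I: "finite I"
      using s by (auto simp: P_def B_def I_def)
    define \<eta> where "\<eta> = \<epsilon> / 8 * (1/2) ^ l"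
    have "\<eta> > 0" using \<epsilon> by (simp add: \<eta>_def)
    from hump_step[OF g f small large I \<epsilon> this] obtain k b where kb: "k \<notin> I"
      "b \<in> borel_measurable \<mu>" "\<forall>w. \<bar>b w\<bar> \<le> 1" "(\<integral>w. b w * f k w \<partial>\<mu>) = \<epsilon>"
      "\<forall>i\<in>I. (\<integral>w. \<bar>b w\<bar> * \<bar>f i w\<bar> \<partial>\<mu>) \<le> \<eta>" by blast
    note kb(2)[measurable]
    have b1: "\<bar>b w\<bar> \<le> 1" for w using kb(3) by blast
    define X where "X = (\<integral>w. (1 - \<bar>b w\<bar>) * B w * f k w \<partial>\<mu>)"
    define \<sigma> :: real where "\<sigma> = (if X \<ge> 0 then 1 else - 1)"
    define B' where "B' w = (1 - \<bar>b w\<bar>) * B w + \<sigma> * b w" for w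
    have [measurable]: "B' \<in> borel_measurable \<mu>" unfolding B'_def by measurable
    have damp: "\<bar>(1 - \<bar>b w\<bar>) * B w\<bar> \<le> 1 - \<bar>b w\<bar>" for w
      using mult_left_mono[OF B1[of w], of "1 - \<bar>b w\<bar>"] b1[of w] by (simp add: abs_mult)
    have damp1: "\<bar>(1 - \<bar>b w\<bar>) * B w\<bar> \<le> 1" for w using damp[of w] by linarith
    have "\<bar>\<sigma> * b w\<bar> = \<bar>b w\<bar>" for w by (simp add: \<sigma>_def abs_mult)
    with damp have B'1: "\<bar>B' w\<bar> \<le> 1" for w
      unfolding B'_def by (smt (verit))
    have B'B: "\<bar>B' w - B w\<bar> \<le> 2 * \<bar>b w\<bar>" for w
    proof -
      have "B' w - B w = \<sigma> * b w - \<bar>b w\<bar> * B w" by (simp add: B'_def algebra_simps)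
      moreover have "\<bar>\<bar>b w\<bar> * B w\<bar> \<le> \<bar>b w\<bar>" using mult_left_mono[OF B1[of w], of "\<bar>b w\<bar>"] by (simp add: abs_mult)
      moreover have "\<bar>\<sigma> * b w\<bar> = \<bar>b w\<bar>" by (simp add: \<sigma>_def abs_mult)
      ultimately show ?thesis by linarith
    qed
    have "(\<integral>w. B' w * f k w \<partial>\<mu>) = (\<integral>w. (1 - \<bar>b w\<bar>) * B w * f k w + \<sigma> * (b w * f k w) \<partial>\<mu>)"
      by (intro Bochner_Integration.integral_cong) (auto simp: B'_def algebra_simps)
    also have "\<dots> = X + \<sigma> * \<epsilon>"
    proof -
      have "integrable \<mu> (\<lambda>w. (1 - \<bar>b w\<bar>) * B w * f k w)"
        using damp1 by (intro integrable_bounded_mult[OF f, where K = 1]) auto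
      moreover have "integrable \<mu> (\<lambda>w. \<sigma> * (b w * f k w))"
        using b1 by (intro integrable_mult_right integrable_bounded_mult[OF f, where K = 1]) auto
      ultimately show ?thesis using kb(4) by (simp add: X_def)
    qed
    finally have "\<epsilon> \<le> \<bar>\<integral>w. B' w * f k w \<partial>\<mu>\<bar>" using \<epsilon> by (auto simp: \<sigma>_def)
    moreover have "(\<integral>w. \<bar>B' w - B w\<bar> * \<bar>f i w\<bar> \<partial>\<mu>) \<le> \<epsilon> / 4 * (1/2) ^ l" if "i \<in> I" for i
    proof -
      have "(\<integral>w. \<bar>B' w - B w\<bar> * \<bar>f i w\<bar> \<partial>\<mu>) \<le> (\<integral>w. 2 * (\<bar>b w\<bar> * \<bar>f i w\<bar>) \<partial>\<mu>)"
      proof (rule integral_mono)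
        have "\<bar>B' w - B w\<bar> \<le> 2" for w using B'B[of w] b1[of w] by linarith
        then show "integrable \<mu> (\<lambda>w. \<bar>B' w - B w\<bar> * \<bar>f i w\<bar>)"
          using f by (intro integrable_bounded_mult[where K = 2]) auto
        show "integrable \<mu> (\<lambda>w. 2 * (\<bar>b w\<bar> * \<bar>f i w\<bar>))"
          using f b1 by (intro integrable_mult_right integrable_bounded_mult[where K = 1]) auto
        show "\<bar>B' w - B w\<bar> * \<bar>f i w\<bar> \<le> 2 * (\<bar>b w\<bar> * \<bar>f i w\<bar>)" for w
          using mult_right_mono[OF B'B[of w], of "\<bar>f i w\<bar>"] by (simp add: mult.assoc)
      qed
      also have "\<dots> \<le> 2 * \<eta>" using kb(5) that by simp
      finally show ?thesis by (simp add: \<eta>_def)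
    qed
    ultimately have "Q l s (B', insert k I)"
      unfolding Q_def using kb(1) by (intro exI[of _ k]) (simp add: B_def I_def)
    moreover have "P (B', insert k I)" using B'1 I by (simp add: P_def)
    ultimately show "\<exists>s'. P s' \<and> Q l s s'" by blast
  qed
  then obtain s where s: "\<And>l. P (s l)" "\<And>l. Q l (s l) (s (Suc l))" by blast
  define B where "B l = fst (s l)" for l
  define I where "I l = snd (s l)" for l
  have [measurable]: "B l \<in> borel_measurable \<mu>" and B1: "\<bar>B l w\<bar> \<le> 1" and I: "finite (I l)" for l w
    using s(1)[of l] by (auto simp: P_def B_def I_def)
  define R where "R l k \<longleftrightarrow> k \<notin> I l \<and> I (Suc l) = insert k (I l) \<and> \<epsilon> \<le> \<bar>\<integral>w. B (Suc l) w * f k w \<partial>\<mu>\<bar> \<and>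
    (\<forall>i\<in>I l. (\<integral>w. \<bar>B (Suc l) w - B l w\<bar> * \<bar>f i w\<bar> \<partial>\<mu>) \<le> \<epsilon> / 4 * (1/2) ^ l)" for l k
  have "\<exists>k. R l k" for l
    using s(2)[of l] unfolding Q_def B_def I_def R_def .
  then obtain k where R: "\<And>l. R l (k l)" by metis
  have k: "k l \<notin> I l" "I (Suc l) = insert (k l) (I l)" "\<epsilon> \<le> \<bar>\<integral>w. B (Suc l) w * f (k l) w \<partial>\<mu>\<bar>" for l
    using R[of l] by (simp_all add: R_def)
  have step: "(\<integral>w. \<bar>B (Suc l) w - B l w\<bar> * \<bar>f i w\<bar> \<partial>\<mu>) \<le> \<epsilon> / 4 * (1/2) ^ l" if "i \<in> I l" for l i
    using R[of l] that by (simp add: R_def)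
  have I_mono: "I l \<subseteq> I l'" if "l \<le> l'" for l l'
    using that by (induction rule: dec_induct) (use k(2) in auto)
  have k_in: "k l \<in> I l'" if "l < l'" for l l'
    using I_mono[of "Suc l" l'] that k(2)[of l] by auto
  have inj_k: "inj k"
  proof (rule linorder_injI)
    fix l l' :: nat assume "l < l'"
    then show "k l \<noteq> k l'" using k_in[of l l'] k(1)[of l'] by auto
  qed
  have int_Bf: "integrable \<mu> (\<lambda>w. B l w * f i w)" for l i
    using B1 by (intro integrable_bounded_mult[OF f, where K = 1]) auto
  have diff2: "\<bar>B (Suc l) w - B l w\<bar> \<le> 2" for l w using B1[of l w] B1[of "Suc l" w] by linarith
  have int_diff: "integrable \<mu> (\<lambda>w. \<bar>B (Suc l) w - B l w\<bar> * \<bar>f i w\<bar>)" for l i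
    using diff2 f by (intro integrable_bounded_mult[where K = 2]) auto
  have step': "\<bar>(\<integral>w. B (Suc l) w * f i w \<partial>\<mu>) - (\<integral>w. B l w * f i w \<partial>\<mu>)\<bar> \<le> \<epsilon> / 4 * (1/2) ^ l"
    if "i \<in> I l" for l i
  proof -
    have "(\<integral>w. B (Suc l) w * f i w \<partial>\<mu>) - (\<integral>w. B l w * f i w \<partial>\<mu>) =
        (\<integral>w. (B (Suc l) w - B l w) * f i w \<partial>\<mu>)"
      using int_Bf by (simp add: left_diff_distrib)
    then have "\<bar>(\<integral>w. B (Suc l) w * f i w \<partial>\<mu>) - (\<integral>w. B l w * f i w \<partial>\<mu>)\<bar> \<le>
        (\<integral>w. \<bar>B (Suc l) w - B l w\<bar> * \<bar>f i w\<bar> \<partial>\<mu>)"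
      using integral_abs_bound[of \<mu> "\<lambda>w. (B (Suc l) w - B l w) * f i w"] by (simp add: abs_mult)
    with step[OF that] show ?thesis by linarith
  qed
  have far: "\<epsilon> / 2 * (1 + (1/2) ^ (l' - Suc l)) \<le> \<bar>\<integral>w. B l' w * f (k l) w \<partial>\<mu>\<bar>" if "Suc l \<le> l'" for l l'
    using that
  proof (induction l' rule: dec_induct)
    case base
    show ?case using k(3)[of l] by simp
  next
    case (step n)
    define z where "z = \<epsilon> / 4 * (1/2) ^ (n - Suc l)"
    have "\<epsilon> / 4 * (1/2) ^ n \<le> z"
      unfolding z_def using \<epsilon> by (intro mult_left_mono power_decreasing) auto
    moreover have "k l \<in> I n" using step.hyps by (intro k_in) simp
    ultimately have "\<bar>(\<integral>w. B (Suc n) w * f (k l) w \<partial>\<mu>) - (\<integral>w. B n w * f (k l) w \<partial>\<mu>)\<bar> \<le> z"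
      using step'[of "k l" n] by linarith
    moreover have "\<epsilon> / 2 + 2 * z \<le> \<bar>\<integral>w. B n w * f (k l) w \<partial>\<mu>\<bar>"
      using step.IH by (simp add: z_def algebra_simps)
    ultimately have "\<epsilon> / 2 + z \<le> \<bar>\<integral>w. B (Suc n) w * f (k l) w \<partial>\<mu>\<bar>" by linarith
    moreover have "Suc n - Suc l = Suc (n - Suc l)" using step.hyps by simp
    then have "\<epsilon> / 2 * (1 + (1/2) ^ (Suc n - Suc l)) = \<epsilon> / 2 + z" by (simp add: z_def algebra_simps)
    ultimately show ?case by simp
  qed
  \<comment> \<open>The sequence \<open>B l w\<close> converges almost everywhere where some \<open>f (k l)\<close> does not vanish; elsewhere \<open>lim\<close> is arbitrary, and truncation keeps the bound.\<close>
  define b where "b w = max (- 1) (min 1 (lim (\<lambda>l. B l w)))" for w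
  have [measurable]: "b \<in> borel_measurable \<mu>" unfolding b_def by measurable
  have lim_b: "\<bar>\<integral>w. b w * f (k l) w \<partial>\<mu>\<bar> \<ge> \<epsilon> / 2" for l
  proof -
    have "AE w in \<mu>. summable (\<lambda>j. \<bar>B (Suc (j + Suc l)) w - B (j + Suc l) w\<bar> * \<bar>f (k l) w\<bar>)"
    proof (rule AE_summable)
      show "summable (\<lambda>j. \<integral>w. \<bar>B (Suc (j + Suc l)) w - B (j + Suc l) w\<bar> * \<bar>f (k l) w\<bar> \<partial>\<mu>)"
      proof (rule summable_comparison_test')
        show "summable (\<lambda>j. \<epsilon> / 4 * (1/2) ^ (j + Suc l))"
          by (intro summable_mult summable_ignore_initial_segment summable_geometric) simp
        show "norm (\<integral>w. \<bar>B (Suc (j + Suc l)) w - B (j + Suc l) w\<bar> * \<bar>f (k l) w\<bar> \<partial>\<mu>) \<le> \<epsilon> / 4 * (1/2) ^ (j + Suc l)"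
          if "j \<ge> 0" for j
          using step[of "k l" "j + Suc l"] k_in[of l "j + Suc l"] by (simp add: integral_nonneg_AE)
      qed
    qed (use int_diff in auto)
    then have AE: "AE w in \<mu>. (\<lambda>j. B j w * f (k l) w) \<longlonglongrightarrow> b w * f (k l) w"
    proof eventually_elim
      case (elim w)
      show ?case
      proof (cases "f (k l) w = 0")
        case False
        have "summable (\<lambda>j. (\<bar>B (Suc (j + Suc l)) w - B (j + Suc l) w\<bar> * \<bar>f (k l) w\<bar>) * (1 / \<bar>f (k l) w\<bar>))"
          using elim by (rule summable_mult2)
        then have "summable (\<lambda>j. \<bar>B (Suc (j + Suc l)) w - B (j + Suc l) w\<bar>)" using False by simp
        then have "summable (\<lambda>j. B (Suc (j + Suc l)) w - B (j + Suc l) w)" by (rule summable_rabs_cancel)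
        then have "convergent (\<lambda>n. \<Sum>j<n. B (Suc (j + Suc l)) w - B (j + Suc l) w)"
          by (simp add: summable_iff_convergent)
        moreover have "(\<Sum>j<n. B (Suc (j + Suc l)) w - B (j + Suc l) w) = B (n + Suc l) w - B (Suc l) w" for n
          using sum_lessThan_telescope[of "\<lambda>j. B (j + Suc l) w" n] by simp
        ultimately have "convergent (\<lambda>n. B (n + Suc l) w - B (Suc l) w)" by simp
        then obtain L where "(\<lambda>n. B (n + Suc l) w - B (Suc l) w) \<longlonglongrightarrow> L" by (auto simp: convergent_def)
        then have "(\<lambda>n. (B (n + Suc l) w - B (Suc l) w) + B (Suc l) w) \<longlonglongrightarrow> L + B (Suc l) w"
          by (intro tendsto_intros)
        then have "(\<lambda>n. B (n + Suc l) w) \<longlonglongrightarrow> L + B (Suc l) w" by simp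
        then have L: "(\<lambda>n. B n w) \<longlonglongrightarrow> L + B (Suc l) w" by (rule LIMSEQ_offset)
        moreover have "L + B (Suc l) w \<le> 1"
          by (rule LIMSEQ_le_const2[OF L]) (use B1 in \<open>auto simp: abs_le_iff\<close>)
        moreover have "- 1 \<le> L + B (Suc l) w"
          by (rule LIMSEQ_le_const[OF L]) (use B1 in \<open>auto simp: abs_le_iff minus_le_iff\<close>)
        ultimately have "b w = L + B (Suc l) w" by (simp add: b_def limI)
        then show ?thesis using L by (auto intro: tendsto_mult_right)
      qed simp
    qed
    have "(\<lambda>j. \<integral>w. B j w * f (k l) w \<partial>\<mu>) \<longlonglongrightarrow> (\<integral>w. b w * f (k l) w \<partial>\<mu>)"
    proof (rule integral_dominated_convergence[OF _ _ _ AE])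
      show "integrable \<mu> (\<lambda>w. \<bar>f (k l) w\<bar>)" using f by simp
      show "AE w in \<mu>. norm (B j w * f (k l) w) \<le> \<bar>f (k l) w\<bar>" for j
        using B1 by (intro AE_I2) (simp add: abs_mult mult_left_le_one_le)
    qed measurable
    then have "(\<lambda>j. \<bar>\<integral>w. B j w * f (k l) w \<partial>\<mu>\<bar>) \<longlonglongrightarrow> \<bar>\<integral>w. b w * f (k l) w \<partial>\<mu>\<bar>"
      by (rule tendsto_rabs)
    moreover have "\<epsilon> / 2 \<le> \<bar>\<integral>w. B j w * f (k l) w \<partial>\<mu>\<bar>" if "j \<ge> Suc l" for j
    proof -
      have "\<epsilon> / 2 * 1 \<le> \<epsilon> / 2 * (1 + (1/2) ^ (j - Suc l))" using \<epsilon> by (intro mult_left_mono) auto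
      with far[OF that] show ?thesis by simp
    qed
    ultimately show ?thesis by (intro LIMSEQ_le_const) auto
  qed
  have "\<bar>b w\<bar> \<le> 1" for w by (auto simp: b_def)
  then have "(\<lambda>k. \<integral>w. b w * f k w \<partial>\<mu>) \<longlonglongrightarrow> 0" by (intro null) measurable
  from tendstoD[OF this, of "\<epsilon> / 2"]
  have "\<forall>\<^sub>F i in sequentially. \<bar>\<integral>w. b w * f i w \<partial>\<mu>\<bar> < \<epsilon> / 2"
    using \<epsilon> by (simp add: dist_real_def)
  then obtain N where N: "\<And>i. i \<ge> N \<Longrightarrow> \<bar>\<integral>w. b w * f i w \<partial>\<mu>\<bar> < \<epsilon> / 2"
    by (auto simp: eventually_sequentially)
  have "range k \<subseteq> {..<N}" using lim_b N by (fastforce simp: not_le[symmetric])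
  then have "finite (range k)" by (rule finite_subset) simp
  then show False using inj_k by (simp add: finite_image_iff)
qed

text \<open>The weight is a convergent series of multiples of the functions of a dense sequence, so every one of these
functions is bounded almost everywhere by a multiple of \<open>g\<close>.\<close>

lemma separable_L1_weight:
  assumes "separable_L1 \<mu>"
  obtains g :: "'w \<Rightarrow> real" where "integrable \<mu> g" "\<And>w. 0 \<le> g w"
    "\<And>f \<epsilon>. integrable \<mu> f \<Longrightarrow> \<epsilon> > 0 \<Longrightarrow> \<exists>n. excess \<mu> g n f \<le> \<epsilon>"
proof -
  obtain D :: "('w \<Rightarrow> real) set" where D: "countable D" "\<And>f. f \<in> D \<Longrightarrow> integrable \<mu> f"
    and dense: "\<And>f \<epsilon>. integrable \<mu> f \<Longrightarrow> \<epsilon> > 0 \<Longrightarrow> \<exists>d\<in>D. (\<integral>w. \<bar>f w - d w\<bar> \<partial>\<mu>) < \<epsilon>"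
    using assms unfolding separable_L1_def by metis
  have "D \<noteq> {}" using dense[of "\<lambda>_. 0" 1] by auto
  define d where "d = from_nat_into D"
  have rd: "range d = D" unfolding d_def using \<open>D \<noteq> {}\<close> D(1) by (simp add: range_from_nat_into)
  have d: "integrable \<mu> (d i)" for i using D(2) rd by blast
  define a where "a i = (1/2) ^ i / (1 + (\<integral>w. \<bar>d i w\<bar> \<partial>\<mu>))" for i
  have nn: "0 \<le> (\<integral>w. \<bar>d i w\<bar> \<partial>\<mu>)" for i by (simp add: integral_nonneg_AE)
  have nn1: "0 < 1 + (\<integral>w. \<bar>d i w\<bar> \<partial>\<mu>)" for i using nn[of i] by linarith
  have a: "a i > 0" for i unfolding a_def by (intro divide_pos_pos nn1) simp
  have a_int: "(\<integral>w. a i * \<bar>d i w\<bar> \<partial>\<mu>) \<le> (1/2) ^ i" for i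
  proof -
    have "(\<integral>w. \<bar>d i w\<bar> \<partial>\<mu>) / (1 + (\<integral>w. \<bar>d i w\<bar> \<partial>\<mu>)) \<le> 1" using nn1[of i] by (simp add: pos_divide_le_eq)
    then have "(1/2) ^ i * ((\<integral>w. \<bar>d i w\<bar> \<partial>\<mu>) / (1 + (\<integral>w. \<bar>d i w\<bar> \<partial>\<mu>))) \<le> (1/2) ^ i * 1"
      by (intro mult_left_mono) auto
    then show ?thesis by (simp add: a_def)
  qed
  have int: "integrable \<mu> (\<lambda>w. a i * \<bar>d i w\<bar>)" for i using d by simp
  have pos: "0 \<le> a i * \<bar>d i w\<bar>" for i w using a[of i] by simp
  have sm: "summable (\<lambda>i. \<integral>w. a i * \<bar>d i w\<bar> \<partial>\<mu>)"
  proof (rule summable_comparison_test')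
    show "summable (\<lambda>i. (1/2 :: real) ^ i)" by (intro summable_geometric) simp
    show "norm (\<integral>w. a i * \<bar>d i w\<bar> \<partial>\<mu>) \<le> (1/2) ^ i" if "i \<ge> 0" for i
      using a_int[of i] integral_nonneg_AE[of "\<lambda>w. a i * \<bar>d i w\<bar>" \<mu>] pos by simp
  qed
  have AE: "AE w in \<mu>. summable (\<lambda>i. a i * \<bar>d i w\<bar>)" by (rule AE_summable[OF int pos sm])
  \<comment> \<open>The outer absolute value makes \<open>g\<close> non-negative also on the null set where the series diverges.\<close>
  define g where "g w = \<bar>\<Sum>i. a i * \<bar>d i w\<bar>\<bar>" for w
  show thesis
  proof
    show "integrable \<mu> g"
      unfolding g_def by (intro integrable_abs integrable_suminf int) (use AE sm pos in auto)
    show "0 \<le> g w" for w by (simp add: g_def)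
    show "\<exists>n. excess \<mu> g n f \<le> \<epsilon>" if f: "integrable \<mu> f" "\<epsilon> > 0" for f \<epsilon>
    proof -
      obtain i where i: "(\<integral>w. \<bar>f w - d i w\<bar> \<partial>\<mu>) < \<epsilon>" using dense[OF f] rd by blast
      obtain n where n: "1 / a i < real n" using reals_Archimedean2 by blast
      have "excess \<mu> g n f \<le> (\<integral>w. \<bar>f w - d i w\<bar> \<partial>\<mu>)"
        unfolding excess_def
      proof (rule integral_mono_AE)
        show "integrable \<mu> (\<lambda>w. max 0 (\<bar>f w\<bar> - real n * g w))" by (intro integrable_excess f) fact
        show "integrable \<mu> (\<lambda>w. \<bar>f w - d i w\<bar>)" using f d by simp
        show "AE w in \<mu>. max 0 (\<bar>f w\<bar> - real n * g w) \<le> \<bar>f w - d i w\<bar>"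
          using AE
        proof eventually_elim
          case (elim w)
          have "a i * \<bar>d i w\<bar> \<le> (\<Sum>i. a i * \<bar>d i w\<bar>)"
            using sum_le_suminf[OF elim, of "{i}"] pos by simp
          then have "a i * \<bar>d i w\<bar> \<le> g w" unfolding g_def by linarith
          then have "real n * (a i * \<bar>d i w\<bar>) \<le> real n * g w" by (intro mult_left_mono) auto
          moreover have "1 * \<bar>d i w\<bar> \<le> (real n * a i) * \<bar>d i w\<bar>"
            using n a[of i] by (intro mult_right_mono) (auto simp: field_simps)
          ultimately have "\<bar>d i w\<bar> \<le> real n * g w" by (simp add: mult.assoc)
          then show ?case by linarith
        qed
      qed
      then show ?thesis using i by (intro exI[of _ n]) simp
    qed
  qed
qed

text \<open>The triangle inequality for the plane vectors \<open>(g, a)\<close> and \<open>(g, b)\<close>.\<close>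

lemma hyperbola_midpoint_defect_nonneg:
  fixes g a b :: real
  shows "2 * sqrt (g\<^sup>2 + ((a + b) / 2)\<^sup>2) \<le> sqrt (g\<^sup>2 + a\<^sup>2) + sqrt (g\<^sup>2 + b\<^sup>2)"
proof -
  have "2 * sqrt (g\<^sup>2 + ((a + b) / 2)\<^sup>2) = sqrt ((g + g)\<^sup>2 + (a + b)\<^sup>2)"
  proof -
    have "2 * sqrt (g\<^sup>2 + ((a + b) / 2)\<^sup>2) = sqrt (2\<^sup>2 * (g\<^sup>2 + ((a + b) / 2)\<^sup>2))"
      by (simp only: real_sqrt_mult real_sqrt_abs)
    also have "2\<^sup>2 * (g\<^sup>2 + ((a + b) / 2)\<^sup>2) = (g + g)\<^sup>2 + (a + b)\<^sup>2"
      by (simp add: power2_eq_square field_simps)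
    finally show ?thesis .
  qed
  then show ?thesis using real_sqrt_sum_squares_triangle_ineq[of g g a b] by (simp add: ac_simps)
qed

text \<open>Strict convexity of \<open>t \<mapsto> sqrt (g\<^sup>2 + t\<^sup>2)\<close> on bounded intervals, with a constant that is homogeneous in \<open>g\<close>. With \<open>P\<close>, \<open>Q\<close>, \<open>R\<close>
the lengths of the plane vectors \<open>(g, a)\<close>, \<open>(g, b)\<close> and of their sum, it follows from the identity
\<open>(P + Q - R) (P + Q + R) (P Q + g\<^sup>2 + a b) = 2 g\<^sup>2 (a - b)\<^sup>2\<close>.\<close>

lemma hyperbola_midpoint_defect:
  fixes g a b :: real and n :: nat
  assumes "g > 0" "\<bar>a\<bar> \<le> 2 * real n * g" "\<bar>b\<bar> \<le> 2 * real n * g"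
  shows "(a - b)\<^sup>2 \<le> 4 * (2 * real n + 1) ^ 3 * g *
    (sqrt (g\<^sup>2 + a\<^sup>2) + sqrt (g\<^sup>2 + b\<^sup>2) - 2 * sqrt (g\<^sup>2 + ((a + b) / 2)\<^sup>2))"
proof -
  define P where "P = sqrt (g\<^sup>2 + a\<^sup>2)"
  define Q where "Q = sqrt (g\<^sup>2 + b\<^sup>2)"
  define R where "R = 2 * sqrt (g\<^sup>2 + ((a + b) / 2)\<^sup>2)"
  define N where "N = 2 * real n + 1"
  have PQ: "P\<^sup>2 = g\<^sup>2 + a\<^sup>2" "Q\<^sup>2 = g\<^sup>2 + b\<^sup>2" by (simp_all add: P_def Q_def)
  have "R\<^sup>2 = 2\<^sup>2 * (g\<^sup>2 + ((a + b) / 2)\<^sup>2)" by (simp add: R_def power_mult_distrib)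
  then have R2: "R\<^sup>2 = 4 * g\<^sup>2 + (a + b)\<^sup>2" by (simp add: power2_eq_square field_simps)
  have nn: "0 \<le> P" "0 \<le> Q" "0 \<le> R" by (simp_all add: P_def Q_def R_def)
  have D: "R \<le> P + Q" unfolding P_def Q_def R_def by (rule hyperbola_midpoint_defect_nonneg)
  have le: "sqrt (g\<^sup>2 + t\<^sup>2) \<le> N * g" if "\<bar>t\<bar> \<le> 2 * real n * g" for t
  proof -
    have "sqrt (g\<^sup>2 + t\<^sup>2) \<le> \<bar>g\<bar> + \<bar>t\<bar>" by (rule sqrt_sum_squares_le_sum_abs)
    then show ?thesis using that assms(1) by (simp add: N_def distrib_right)
  qed
  have PN: "P \<le> N * g" and QN: "Q \<le> N * g" using le assms(2,3) by (simp_all add: P_def Q_def)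
  have Ng: "0 \<le> N * g" using assms(1) by (simp add: N_def)
  have e1: "(P + Q - R) * (P + Q + R) = 2 * (P * Q - (g\<^sup>2 + a * b))"
  proof -
    have "(P + Q - R) * (P + Q + R) = P\<^sup>2 + Q\<^sup>2 + 2 * P * Q - R\<^sup>2" by (simp add: power2_eq_square algebra_simps)
    then show ?thesis unfolding PQ R2 by (simp add: power2_eq_square algebra_simps)
  qed
  have e2: "(P * Q - (g\<^sup>2 + a * b)) * (P * Q + (g\<^sup>2 + a * b)) = g\<^sup>2 * (a - b)\<^sup>2"
  proof -
    have "(P * Q - (g\<^sup>2 + a * b)) * (P * Q + (g\<^sup>2 + a * b)) = P\<^sup>2 * Q\<^sup>2 - (g\<^sup>2 + a * b)\<^sup>2"
      by (simp add: power2_eq_square algebra_simps)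
    then show ?thesis unfolding PQ by (simp add: power2_eq_square algebra_simps)
  qed
  have key: "(P + Q - R) * (P + Q + R) * (P * Q + (g\<^sup>2 + a * b)) = 2 * (g\<^sup>2 * (a - b)\<^sup>2)"
    by (simp only: e1 e2 mult.assoc)
  have "g\<^sup>2 + a * b \<le> P * Q"
  proof -
    have "(g\<^sup>2 + a * b)\<^sup>2 \<le> (P * Q)\<^sup>2"
    proof -
      have "(P * Q)\<^sup>2 = (g\<^sup>2 + a * b)\<^sup>2 + g\<^sup>2 * (a - b)\<^sup>2"
        unfolding power_mult_distrib PQ by (simp add: power2_eq_square algebra_simps)
      then show ?thesis by simp
    qed
    then show ?thesis by (rule power2_le_imp_le) (use nn in simp)
  qed
  then have "P * Q + (g\<^sup>2 + a * b) \<le> 2 * (P * Q)" by simp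
  also have "\<dots> \<le> 2 * ((N * g) * (N * g))" using PN QN nn Ng by (intro mult_left_mono mult_mono) auto
  finally have 1: "P * Q + (g\<^sup>2 + a * b) \<le> 2 * ((N * g) * (N * g))" .
  have 2: "P + Q + R \<le> 4 * (N * g)" using PN QN D by linarith
  have "2 * (g\<^sup>2 * (a - b)\<^sup>2) \<le> (P + Q - R) * (4 * (N * g)) * (2 * ((N * g) * (N * g)))"
  proof -
    have "(P + Q - R) * (P + Q + R) * (P * Q + (g\<^sup>2 + a * b)) \<le>
        (P + Q - R) * (P + Q + R) * (2 * ((N * g) * (N * g)))"
      using 1 D nn by (intro mult_left_mono) auto
    also have "\<dots> \<le> (P + Q - R) * (4 * (N * g)) * (2 * ((N * g) * (N * g)))"
      using 2 D nn Ng by (intro mult_right_mono mult_left_mono) auto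
    finally show ?thesis using key by simp
  qed
  also have "\<dots> = (2 * g\<^sup>2) * (4 * N ^ 3 * g * (P + Q - R))"
    by (simp add: power2_eq_square power3_eq_cube algebra_simps)
  finally have "(2 * g\<^sup>2) * (a - b)\<^sup>2 \<le> (2 * g\<^sup>2) * (4 * N ^ 3 * g * (P + Q - R))" by (simp add: mult.assoc)
  then have "(a - b)\<^sup>2 \<le> 4 * N ^ 3 * g * (P + Q - R)"
    by (rule mult_left_le_imp_le) (use assms(1) in simp)
  then show ?thesis by (simp add: P_def Q_def R_def N_def)
qed

text \<open>Where \<open>a\<close> and \<open>b\<close> are at most \<open>2 n g\<close> in absolute value, the defect controls the square of their distance;
elsewhere the larger one is at most twice its excess over \<open>n g\<close>.\<close>

lemma distance_le_excess_plus_defect: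
  fixes g a b \<delta> :: real and n :: nat
  assumes "g \<ge> 0" "\<delta> > 0"
  shows "\<bar>a - b\<bar> \<le> 4 * max 0 (\<bar>a\<bar> - real n * g) + 4 * max 0 (\<bar>b\<bar> - real n * g) + \<delta> * g +
    (2 * real n + 1) ^ 3 / \<delta> * (sqrt (g\<^sup>2 + a\<^sup>2) + sqrt (g\<^sup>2 + b\<^sup>2) - 2 * sqrt (g\<^sup>2 + ((a + b) / 2)\<^sup>2))"
    (is "_ \<le> _ + _ + _ + ?K / \<delta> * ?D")
proof -
  have D: "?D \<ge> 0" using hyperbola_midpoint_defect_nonneg[of g a b] by simp
  have K: "?K \<ge> 0" by simp
  define E where "E = ?K / \<delta> * ?D"
  have E: "E \<ge> 0" unfolding E_def using D K assms(2) by simp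
  have \<delta>g: "\<delta> * g \<ge> 0" using assms by simp
  have ng: "real n * g \<ge> 0" using assms by simp
  define p where "p = max 0 (\<bar>a\<bar> - real n * g)"
  define q where "q = max 0 (\<bar>b\<bar> - real n * g)"
  have pq: "0 \<le> p" "0 \<le> q" "\<bar>a\<bar> - real n * g \<le> p" "\<bar>b\<bar> - real n * g \<le> q" by (auto simp: p_def q_def)
  have "\<bar>a - b\<bar> \<le> 4 * p + 4 * q + \<delta> * g + E"
  proof (cases "\<bar>a\<bar> \<le> 2 * (real n * g) \<and> \<bar>b\<bar> \<le> 2 * (real n * g)")
    case True
    show ?thesis
    proof (cases "g = 0")
      case True
      with \<open>_ \<and> _\<close> have "a = 0" "b = 0" by simp_all
      then show ?thesis using E pq True by simp
    next
      case False
      then have g: "g > 0" using assms(1) by simp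
      have "(a - b)\<^sup>2 \<le> 4 * ?K * g * ?D"
        using True by (intro hyperbola_midpoint_defect g) (simp_all add: mult.assoc)
      moreover have "\<bar>a - b\<bar> * (4 * \<delta> * g) \<le> (2 * \<delta> * g)\<^sup>2 + (a - b)\<^sup>2"
      proof -
        have "0 \<le> (2 * \<delta> * g - \<bar>a - b\<bar>)\<^sup>2" by simp
        then show ?thesis by (simp add: power2_diff algebra_simps)
      qed
      moreover have "(\<delta> * g + E) * (4 * \<delta> * g) = (2 * \<delta> * g)\<^sup>2 + 4 * ?K * g * ?D"
        using assms(2) unfolding E_def by (simp add: power2_eq_square field_simps)
      ultimately have "\<bar>a - b\<bar> * (4 * \<delta> * g) \<le> (\<delta> * g + E) * (4 * \<delta> * g)" by linarith
      then have "\<bar>a - b\<bar> \<le> \<delta> * g + E"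
        by (rule mult_right_le_imp_le) (use g assms(2) in simp)
      then show ?thesis using pq by linarith
    qed
  next
    case False
    show ?thesis
    proof (cases "\<bar>a\<bar> \<le> \<bar>b\<bar>")
      case True
      then have "\<bar>b\<bar> > 2 * (real n * g)" using False by linarith
      then show ?thesis using True pq E \<delta>g by linarith
    next
      case False': False
      then have "\<bar>a\<bar> > 2 * (real n * g)" using False by linarith
      then show ?thesis using False' pq E \<delta>g by linarith
    qed
  qed
  then show ?thesis unfolding E_def p_def q_def .
qed

section \<open>Banach spaces that embed into a separable \<open>L\<^sub>1\<close>\<close>

lemma compact_imp_cluster_point:
  fixes F :: "nat \<Rightarrow> 'a::topological_space"
  assumes "compact K" "\<And>k. F k \<in> K"
  obtains \<Phi> where "\<Phi> \<in> K" "\<forall>U. open U \<longrightarrow> \<Phi> \<in> U \<longrightarrow> (\<exists>\<^sub>F k in sequentially. F k \<in> U)"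
proof -
  have "filtermap F sequentially \<noteq> bot" by (simp add: filtermap_bot_iff)
  moreover have "eventually (\<lambda>x. x \<in> K) (filtermap F sequentially)"
    by (simp add: eventually_filtermap assms(2))
  ultimately obtain \<Phi> where \<Phi>: "\<Phi> \<in> K" "inf (nhds \<Phi>) (filtermap F sequentially) \<noteq> bot"
    using assms(1) unfolding compact_filter by blast
  have freq: "\<exists>\<^sub>F k in sequentially. F k \<in> U" if U: "open U" "\<Phi> \<in> U" for U
  proof (rule ccontr)
    assume "\<not> (\<exists>\<^sub>F k in sequentially. F k \<in> U)"
    then have "eventually (\<lambda>x. x \<notin> U) (filtermap F sequentially)"
      by (simp add: frequently_def eventually_filtermap)
    moreover have "eventually (\<lambda>x. x \<in> U) (nhds \<Phi>)" using U by (rule eventually_nhds_in_open)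
    ultimately have "eventually (\<lambda>_. False) (inf (nhds \<Phi>) (filtermap F sequentially))"
      unfolding eventually_inf by (intro exI[of _ "\<lambda>x. x \<in> U"] exI[of _ "\<lambda>x. x \<notin> U"]) simp
    then show False using \<Phi>(2) by (simp add: trivial_limit_def)
  qed
  show thesis by (rule that[OF \<Phi>(1)]) (intro allI impI freq)
qed

text \<open>An isomorphic embedding \<open>\<Theta>\<close> into \<open>L\<^sub>1\<close>, given by representatives, together with a weight \<open>g\<close> as in
\<open>separable_L1_weight\<close>.\<close>

locale weighted_L1_embedding =
  fixes \<Theta> :: "'e::real_normed_vector \<Rightarrow> 'w \<Rightarrow> real" and \<mu> :: "'w measure" and c C :: real and g :: "'w \<Rightarrow> real"
  assumes int_\<Theta>: "integrable \<mu> (\<Theta> x)"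
    and \<Theta>_add: "AE w in \<mu>. \<Theta> (x + y) w = \<Theta> x w + \<Theta> y w"
    and \<Theta>_scale: "AE w in \<mu>. \<Theta> (a *\<^sub>R x) w = a * \<Theta> x w"
    and c_pos: "c > 0" and lower: "c * norm x \<le> (\<integral>w. \<bar>\<Theta> x w\<bar> \<partial>\<mu>)" and upper: "(\<integral>w. \<bar>\<Theta> x w\<bar> \<partial>\<mu>) \<le> C * norm x"
    and int_g: "integrable \<mu> g" and g_nonneg: "0 \<le> g w"
    and weight: "integrable \<mu> f \<Longrightarrow> \<epsilon> > 0 \<Longrightarrow> \<exists>n. excess \<mu> g n f \<le> \<epsilon>"
begin

lemma meas [measurable]: "\<Theta> x \<in> borel_measurable \<mu>" "g \<in> borel_measurable \<mu>"
  using int_\<Theta> int_g by auto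

lemma \<Theta>_comb: "AE w in \<mu>. \<Theta> (u *\<^sub>R x + v *\<^sub>R y) w = u * \<Theta> x w + v * \<Theta> y w"
  using \<Theta>_add[of "u *\<^sub>R x" "v *\<^sub>R y"] \<Theta>_scale[of u x] \<Theta>_scale[of v y] by eventually_elim simp

lemma \<Theta>_diff: "AE w in \<mu>. \<Theta> (x - y) w = \<Theta> x w - \<Theta> y w"
  using \<Theta>_comb[of 1 x "- 1" y] by simp

text \<open>A convex functional on \<open>E\<close> that is strictly convex on equi-integrable sets in a quantitative way. Minimising it plays the part
of the minimal norm in a Hilbert space.\<close>

definition energy :: "'e \<Rightarrow> real" where "energy x = (\<integral>w. sqrt ((g w)\<^sup>2 + (\<Theta> x w)\<^sup>2) \<partial>\<mu>)"

lemma integrable_sqrt: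
  assumes "integrable \<mu> f"
  shows "integrable \<mu> (\<lambda>w. sqrt ((g w)\<^sup>2 + (f w)\<^sup>2))"
proof (rule Bochner_Integration.integrable_bound)
  show "integrable \<mu> (\<lambda>w. \<bar>g w\<bar> + \<bar>f w\<bar>)" using int_g assms by simp
  show "AE w in \<mu>. norm (sqrt ((g w)\<^sup>2 + (f w)\<^sup>2)) \<le> norm (\<bar>g w\<bar> + \<bar>f w\<bar>)"
    using sqrt_sum_squares_le_sum_abs by (intro AE_I2) simp
  have [measurable]: "f \<in> borel_measurable \<mu>" using assms by auto
  show "(\<lambda>w. sqrt ((g w)\<^sup>2 + (f w)\<^sup>2)) \<in> borel_measurable \<mu>" by measurable
qed

lemma energy_nonneg: "0 \<le> energy x"
  unfolding energy_def by (intro integral_nonneg_AE AE_I2) simp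

lemma energy_le: "energy x \<le> (\<integral>w. g w \<partial>\<mu>) + (\<integral>w. \<bar>\<Theta> x w\<bar> \<partial>\<mu>)"
proof -
  have "energy x \<le> (\<integral>w. g w + \<bar>\<Theta> x w\<bar> \<partial>\<mu>)"
    unfolding energy_def
  proof (rule integral_mono[OF integrable_sqrt[OF int_\<Theta>]])
    show "sqrt ((g w)\<^sup>2 + (\<Theta> x w)\<^sup>2) \<le> g w + \<bar>\<Theta> x w\<bar>" for w
      using sqrt_sum_squares_le_sum_abs[of "g w" "\<Theta> x w"] g_nonneg[of w] by simp
  qed (use int_g int_\<Theta> in simp)
  then show ?thesis using int_g int_\<Theta> by simp
qed

text \<open>On a set with uniformly small excess, two almost minimal points whose midpoint is almost minimal too are
close in norm.\<close>

lemma energy_uniformly_convex: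
  assumes "excess \<mu> g n (\<Theta> x) \<le> \<epsilon>" "excess \<mu> g n (\<Theta> y) \<le> \<epsilon>" "\<delta> > 0"
  shows "c * dist x y \<le> 8 * \<epsilon> + \<delta> * (\<integral>w. g w \<partial>\<mu>) +
    (2 * real n + 1) ^ 3 / \<delta> * (energy x + energy y - 2 * energy ((1/2) *\<^sub>R x + (1/2) *\<^sub>R y))"
proof -
  define K where "K = (2 * real n + 1) ^ 3 / \<delta>"
  define z where "z = (1/2) *\<^sub>R x + (1/2) *\<^sub>R y"
  define e where "e x w = max 0 (\<bar>\<Theta> x w\<bar> - real n * g w)" for x w
  define s where "s x w = sqrt ((g w)\<^sup>2 + (\<Theta> x w)\<^sup>2)" for x w
  have int_e: "integrable \<mu> (e x)" for x unfolding e_def by (rule integrable_excess[OF int_\<Theta> int_g])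
  have int_s: "integrable \<mu> (s x)" for x unfolding s_def by (rule integrable_sqrt[OF int_\<Theta>])
  have "c * dist x y \<le> (\<integral>w. \<bar>\<Theta> (x - y) w\<bar> \<partial>\<mu>)" using lower[of "x - y"] by (simp add: dist_norm)
  also have "\<dots> \<le> (\<integral>w. 4 * e x w + 4 * e y w + \<delta> * g w + K * (s x w + s y w - 2 * s z w) \<partial>\<mu>)"
  proof (rule integral_mono_AE)
    show "integrable \<mu> (\<lambda>w. \<bar>\<Theta> (x - y) w\<bar>)" using int_\<Theta> by simp
    show "integrable \<mu> (\<lambda>w. 4 * e x w + 4 * e y w + \<delta> * g w + K * (s x w + s y w - 2 * s z w))"
      using int_e int_s int_g
      by (intro Bochner_Integration.integrable_add Bochner_Integration.integrable_diff integrable_mult_right)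
    show "AE w in \<mu>. \<bar>\<Theta> (x - y) w\<bar> \<le> 4 * e x w + 4 * e y w + \<delta> * g w + K * (s x w + s y w - 2 * s z w)"
      using \<Theta>_diff[of x y] \<Theta>_comb[of "1/2" x "1/2" y]
    proof eventually_elim
      case (elim w)
      have "\<Theta> z w = (\<Theta> x w + \<Theta> y w) / 2" using elim(2) by (simp add: z_def)
      then show ?case
        unfolding e_def s_def K_def elim(1)
        by (simp only:) (rule distance_le_excess_plus_defect[OF g_nonneg assms(3)])
    qed
  qed
  also have "\<dots> = 4 * (\<integral>w. e x w \<partial>\<mu>) + 4 * (\<integral>w. e y w \<partial>\<mu>) + \<delta> * (\<integral>w. g w \<partial>\<mu>) +
      K * ((\<integral>w. s x w \<partial>\<mu>) + (\<integral>w. s y w \<partial>\<mu>) - 2 * (\<integral>w. s z w \<partial>\<mu>))"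
    using int_e int_s int_g by simp
  also have "\<dots> \<le> 8 * \<epsilon> + \<delta> * (\<integral>w. g w \<partial>\<mu>) + K * (energy x + energy y - 2 * energy z)"
    using assms(1,2) unfolding e_def s_def energy_def excess_def by simp
  finally show ?thesis by (simp add: K_def z_def)
qed

lemma convex_small_excess: "convex {x. excess \<mu> g n (\<Theta> x) \<le> t}"
  unfolding convex_def
proof (intro ballI allI impI CollectI)
  fix x y and u v :: real
  assume x: "x \<in> {x. excess \<mu> g n (\<Theta> x) \<le> t}" and y: "y \<in> {x. excess \<mu> g n (\<Theta> x) \<le> t}"
    and uv: "0 \<le> u" "0 \<le> v" "u + v = 1"
  define e where "e x w = max 0 (\<bar>\<Theta> x w\<bar> - real n * g w)" for x w
  have int_e: "integrable \<mu> (e x)" for x unfolding e_def by (rule integrable_excess[OF int_\<Theta> int_g])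
  have "(\<integral>w. e (u *\<^sub>R x + v *\<^sub>R y) w \<partial>\<mu>) \<le> (\<integral>w. u * e x w + v * e y w \<partial>\<mu>)"
  proof (rule integral_mono_AE[OF int_e])
    show "integrable \<mu> (\<lambda>w. u * e x w + v * e y w)" using int_e by simp
    show "AE w in \<mu>. e (u *\<^sub>R x + v *\<^sub>R y) w \<le> u * e x w + v * e y w"
      using \<Theta>_comb[of u x v y]
    proof eventually_elim
      case (elim w)
      have "u * (\<bar>\<Theta> x w\<bar> - real n * g w) \<le> u * e x w" "v * (\<bar>\<Theta> y w\<bar> - real n * g w) \<le> v * e y w"
        using uv by (auto simp: e_def intro!: mult_left_mono)
      moreover have "\<bar>u * \<Theta> x w + v * \<Theta> y w\<bar> \<le> u * \<bar>\<Theta> x w\<bar> + v * \<bar>\<Theta> y w\<bar>"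
        using uv abs_triangle_ineq[of "u * \<Theta> x w" "v * \<Theta> y w"] by (simp add: abs_mult)
      moreover have "real n * g w = u * (real n * g w) + v * (real n * g w)"
        using uv(3) by (simp add: distrib_right[symmetric])
      moreover have "0 \<le> u * e x w" "0 \<le> v * e y w" using uv by (auto simp: e_def)
      ultimately show ?case
        unfolding elim e_def[of "u *\<^sub>R x + v *\<^sub>R y"] by (simp add: right_diff_distrib)
    qed
  qed
  also have "\<dots> = u * (\<integral>w. e x w \<partial>\<mu>) + v * (\<integral>w. e y w \<partial>\<mu>)" using int_e by simp
  also have "\<dots> \<le> u * t + v * t"
    using x y uv by (intro add_mono mult_left_mono) (auto simp: e_def excess_def)
  also have "\<dots> = t" using uv(3) by (simp add: distrib_right[symmetric])
  finally show "excess \<mu> g n (\<Theta> (u *\<^sub>R x + v *\<^sub>R y)) \<le> t" by (simp add: e_def excess_def)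
qed

text \<open>Let \<open>dd\<close> be the supremum of the infima of the energy over the sets of \<open>\<C>\<close>. Almost minimal points of a set
whose infimum is close to \<open>dd\<close> are close to each other, since midpoints stay in the set. Thus the sets \<open>N A \<eta>\<close> of points of
\<open>A\<close> with energy below \<open>dd + \<eta>\<close> have arbitrarily small diameter and converge to a point, which is in the
closure of every set of \<open>\<C>\<close> by directedness.\<close>

lemma directed_convex_sets_cluster:
  fixes \<C> :: "'e set set"
  assumes compl: "complete (UNIV :: 'e set)" and ne: "\<C> \<noteq> {}"
    and C: "\<And>A. A \<in> \<C> \<Longrightarrow> A \<noteq> {}" "\<And>A. A \<in> \<C> \<Longrightarrow> convex A"
    and dir: "\<And>A B. A \<in> \<C> \<Longrightarrow> B \<in> \<C> \<Longrightarrow> \<exists>D\<in>\<C>. D \<subseteq> A \<inter> B"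
    and equi: "\<And>j. \<exists>n. \<forall>A\<in>\<C>. \<forall>x\<in>A. excess \<mu> g n (\<Theta> x) \<le> 1 / real (Suc j)"
  obtains z where "\<forall>A\<in>\<C>. z \<in> closure A"
proof -
  define G where "G = (\<integral>w. g w \<partial>\<mu>)"
  have G: "0 \<le> G" unfolding G_def using g_nonneg by (intro integral_nonneg_AE AE_I2)
  obtain n0 where n0: "\<And>A x. A \<in> \<C> \<Longrightarrow> x \<in> A \<Longrightarrow> excess \<mu> g n0 (\<Theta> x) \<le> 1" using equi[of 0] by auto
  define M where "M = G + (1 + real n0 * G)"
  have energy_le_M: "energy x \<le> M" if "A \<in> \<C>" "x \<in> A" for A x
    using energy_le[of x] integral_abs_le_excess[OF int_\<Theta>[of x] int_g, of n0] n0[OF that]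
    by (simp add: M_def G_def)
  define d where "d A = Inf (energy ` A)" for A
  have bdd: "bdd_below (energy ` A)" for A by (rule bdd_belowI[of _ 0]) (auto simp: energy_nonneg)
  have d_le: "d A \<le> energy x" if "x \<in> A" for A x unfolding d_def using bdd that by (intro cInf_lower) auto
  have d_mono: "d A \<le> d B" if "B \<subseteq> A" "B \<noteq> {}" for A B
    unfolding d_def using bdd that by (intro cInf_superset_mono) auto
  define dd where "dd = Sup (d ` \<C>)"
  have bdd_d: "bdd_above (d ` \<C>)"
  proof (rule bdd_aboveI)
    fix t assume "t \<in> d ` \<C>"
    then obtain A x where "A \<in> \<C>" "t = d A" "x \<in> A" using C(1) by blast
    then show "t \<le> M" using d_le[of x A] energy_le_M[of A x] by linarith
  qed
  have d_le_dd: "d A \<le> dd" if "A \<in> \<C>" for A unfolding dd_def using bdd_d that by (intro cSup_upper) auto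
  define N where "N A \<eta> = {x\<in>A. energy x < dd + \<eta>}" for A and \<eta> :: real
  have N_ne: "N A \<eta> \<noteq> {}" if A: "A \<in> \<C>" "\<eta> > 0" for A \<eta>
  proof -
    have "Inf (energy ` A) < dd + \<eta>" using d_le_dd[OF A(1)] A(2) by (simp add: d_def)
    then obtain t where "t \<in> energy ` A" "t < dd + \<eta>"
      using C(1)[OF A(1)] by (meson cInf_lessD image_is_empty)
    then show ?thesis by (auto simp: N_def)
  qed
  have small: "\<exists>A \<eta>. A \<in> \<C> \<and> \<eta> > 0 \<and> (\<forall>x\<in>N A \<eta>. \<forall>y\<in>N A \<eta>. dist x y < \<rho>)" if "\<rho> > 0" for \<rho>
  proof -
    \<comment> \<open>The four error terms, from the excess, \<open>\<delta>\<close>, the defect and strictness, get a quarter of \<open>c * \<rho>\<close> each.\<close>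
    define r where "r = c * \<rho> / 4"
    have r: "r > 0" using c_pos that by (simp add: r_def)
    obtain j where "8 / r < real j" using reals_Archimedean2 by blast
    then have "8 / r < real (Suc j)" by simp
    then have j: "8 * (1 / real (Suc j)) < r" using r by (simp add: field_simps)
    obtain n where n: "\<And>A x. A \<in> \<C> \<Longrightarrow> x \<in> A \<Longrightarrow> excess \<mu> g n (\<Theta> x) \<le> 1 / real (Suc j)" using equi[of j] by blast
    define \<delta> where "\<delta> = r / (G + 1)"
    have \<delta>: "\<delta> > 0" using r G by (simp add: \<delta>_def)
    have "\<delta> * G \<le> \<delta> * (G + 1)" using \<delta> by simp
    also have "\<delta> * (G + 1) = r" using G by (simp add: \<delta>_def)
    finally have \<delta>G: "\<delta> * G \<le> r" .
    define K where "K = (2 * real n + 1) ^ 3 / \<delta>"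
    have K: "K > 0" unfolding K_def using \<delta> by (intro divide_pos_pos zero_less_power) auto
    define \<eta> where "\<eta> = r / (4 * K)"
    have \<eta>: "\<eta> > 0" "K * (4 * \<eta>) = r" using r K by (auto simp: \<eta>_def)
    have "dd - \<eta> < Sup (d ` \<C>)" using \<eta>(1) by (simp add: dd_def)
    then obtain A where A: "A \<in> \<C>" "dd - \<eta> < d A" using ne by (auto elim!: less_cSupE)
    have "dist x y < \<rho>" if x: "x \<in> N A \<eta>" and y: "y \<in> N A \<eta>" for x y
    proof -
      have "(1/2) *\<^sub>R x + (1/2) *\<^sub>R y \<in> A"
        using x y by (intro convexD[OF C(2)[OF A(1)]]) (auto simp: N_def)
      then have "dd - \<eta> < energy ((1/2) *\<^sub>R x + (1/2) *\<^sub>R y)" using d_le A(2) by fastforce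
      then have "energy x + energy y - 2 * energy ((1/2) *\<^sub>R x + (1/2) *\<^sub>R y) \<le> 4 * \<eta>"
        using x y by (simp add: N_def)
      then have "K * (energy x + energy y - 2 * energy ((1/2) *\<^sub>R x + (1/2) *\<^sub>R y)) \<le> r"
        using K \<eta>(2) by (metis less_imp_le mult_left_mono)
      moreover have "c * dist x y \<le> 8 * (1 / real (Suc j)) + \<delta> * G +
          K * (energy x + energy y - 2 * energy ((1/2) *\<^sub>R x + (1/2) *\<^sub>R y))"
        unfolding G_def K_def using x y A(1) by (intro energy_uniformly_convex n \<delta>) (auto simp: N_def)
      ultimately have "c * dist x y < 4 * r" using j \<delta>G r by linarith
      then show ?thesis using c_pos by (simp add: r_def)
    qed
    then show ?thesis using A(1) \<eta>(1) by blast
  qed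
  have "\<exists>A \<eta>. A \<in> \<C> \<and> \<eta> > 0 \<and> (\<forall>x\<in>N A \<eta>. \<forall>y\<in>N A \<eta>. dist x y < 1 / real (Suc k))" for k
    by (rule small) simp
  then obtain A \<eta> where A: "\<And>k. A k \<in> \<C>" "\<And>k. \<eta> k > 0"
    "\<And>k x y. x \<in> N (A k) (\<eta> k) \<Longrightarrow> y \<in> N (A k) (\<eta> k) \<Longrightarrow> dist x y < 1 / real (Suc k)" by metis
  have "\<exists>D. \<forall>k. (fst (D k) \<in> \<C> \<and> snd (D k) > 0 \<and> fst (D k) \<subseteq> A k \<and> snd (D k) \<le> \<eta> k) \<and>
      (fst (D (Suc k)) \<subseteq> fst (D k) \<and> snd (D (Suc k)) \<le> snd (D k))"
  proof (rule dependent_nat_choice)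
    show "\<exists>D. fst D \<in> \<C> \<and> snd D > 0 \<and> fst D \<subseteq> A 0 \<and> snd D \<le> \<eta> 0"
      using A(1,2) by (intro exI[of _ "(A 0, \<eta> 0)"]) simp
    fix D k assume D: "fst D \<in> \<C> \<and> snd D > (0::real) \<and> fst D \<subseteq> A k \<and> snd D \<le> \<eta> k"
    obtain B where "B \<in> \<C>" "B \<subseteq> fst D \<inter> A (Suc k)" using dir D A(1) by meson
    then show "\<exists>D'. (fst D' \<in> \<C> \<and> snd D' > 0 \<and> fst D' \<subseteq> A (Suc k) \<and> snd D' \<le> \<eta> (Suc k)) \<and>
        (fst D' \<subseteq> fst D \<and> snd D' \<le> snd D)"
      using D A(2) by (intro exI[of _ "(B, min (snd D) (\<eta> (Suc k)))"]) simp
  qed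
  then obtain D where D: "\<And>k. fst (D k) \<in> \<C>" "\<And>k. snd (D k) > 0" "\<And>k. fst (D k) \<subseteq> A k" "\<And>k. snd (D k) \<le> \<eta> k"
    and Ddec: "\<And>k. fst (D (Suc k)) \<subseteq> fst (D k)" "\<And>k. snd (D (Suc k)) \<le> snd (D k)" by metis
  have "\<exists>z. z \<in> N (fst (D k)) (snd (D k))" for k using N_ne[OF D(1,2)] by blast
  then obtain z where z: "\<And>k. z k \<in> N (fst (D k)) (snd (D k))" by metis
  have zN: "z m \<in> N (A k) (\<eta> k)" if "k \<le> m" for k m
  proof -
    have "fst (D m) \<subseteq> fst (D k)"
      using that by (induction rule: dec_induct) (use Ddec(1) in blast)+
    moreover have "snd (D m) \<le> snd (D k)"
      using that
    proof (induction rule: dec_induct)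
      case (step i)
      then show ?case using Ddec(2)[of i] by linarith
    qed simp
    ultimately have "fst (D m) \<subseteq> A k" "snd (D m) \<le> \<eta> k" using D(3,4)[of k] by auto
    then show ?thesis using z[of m] by (auto simp: N_def)
  qed
  have close: "dist (z m) (z k) < 1 / real (Suc k)" if "k \<le> m" for k m
    by (intro A(3) zN that order_refl)
  have "Cauchy z"
  proof (rule metric_CauchyI)
    fix e :: real assume "e > 0"
    then obtain k where k: "inverse (real (Suc k)) < e / 2" using reals_Archimedean[of "e / 2"] by auto
    have "dist (z m) (z m') < e" if "m \<ge> k" "m' \<ge> k" for m m'
      using close[OF that(1)] close[OF that(2)] k dist_triangle2[of "z m" "z m'" "z k"]
      by (simp add: inverse_eq_divide)
    then show "\<exists>M. \<forall>m\<ge>M. \<forall>n\<ge>M. dist (z m) (z n) < e" by blast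
  qed
  then obtain l where l: "z \<longlonglongrightarrow> l" using compl unfolding complete_def by (metis UNIV_I)
  have "l \<in> closure B" if B: "B \<in> \<C>" for B
    unfolding closure_approachable
  proof (intro allI impI)
    fix e :: real assume "e > 0"
    then obtain k where k: "inverse (real (Suc k)) < e / 2" using reals_Archimedean[of "e / 2"] by auto
    have "(\<lambda>m. dist (z m) (z k)) \<longlonglongrightarrow> dist l (z k)" by (intro tendsto_intros l)
    then have lz: "dist l (z k) \<le> 1 / real (Suc k)"
      by (rule LIMSEQ_le_const2) (use close in \<open>auto intro!: exI[of _ k] less_imp_le\<close>)
    obtain B' where B': "B' \<in> \<C>" "B' \<subseteq> B \<inter> A k" using dir[OF B A(1)] by blast
    obtain x where x: "x \<in> N B' (\<eta> k)" using N_ne[OF B'(1) A(2)] by blast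
    then have "x \<in> N (A k) (\<eta> k)" "x \<in> B" using B'(2) by (auto simp: N_def)
    then have "dist x (z k) < 1 / real (Suc k)" using A(3) zN[OF order_refl] by blast
    then have "dist x l < e"
      using lz k dist_triangle2[of x l "z k"] by (simp add: inverse_eq_divide)
    with \<open>x \<in> B\<close> show "\<exists>y\<in>B. dist y l < e" by blast
  qed
  with that show thesis by blast
qed

text \<open>By compactness of a product of intervals, the values of all functionals on \<open>y k\<close> cluster at a function \<open>\<Phi>\<close> on
the dual. The convex hulls of the parts of the sequence that are close to \<open>\<Phi>\<close> on finitely many functionals
form a directed family, and a common point of their closures represents \<open>\<Phi>\<close>.\<close>

lemma equiintegrable_has_weak_cluster_point:
  fixes y :: "nat \<Rightarrow> 'e"
  assumes compl: "complete (UNIV :: 'e set)"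
    and equi: "\<forall>j. \<exists>n. \<forall>k. excess \<mu> g n (\<Theta> (y k)) \<le> 1 / real (Suc j)"
  shows "\<exists>l. \<forall>U. openin weak_topology U \<longrightarrow> l \<in> U \<longrightarrow> (\<exists>\<^sub>F k in sequentially. y k \<in> U)"
proof -
  obtain n0 where n0: "\<And>k. excess \<mu> g n0 (\<Theta> (y k)) \<le> 1" using spec[OF equi, of 0] by auto
  define R where "R = (1 + real n0 * (\<integral>w. g w \<partial>\<mu>)) / c"
  have R: "norm (y k) \<le> R" for k
  proof -
    have "c * norm (y k) \<le> 1 + real n0 * (\<integral>w. g w \<partial>\<mu>)"
      using lower[of "y k"] integral_abs_le_excess[OF int_\<Theta>[of "y k"] int_g, of n0] n0[of k] by linarith
    then show ?thesis using c_pos by (simp add: R_def pos_le_divide_eq mult.commute)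
  qed
  define F where "F k = (\<lambda>\<psi> :: 'e \<Rightarrow>\<^sub>L real. blinfun_apply \<psi> (y k))" for k
  have box: "F k \<in> Pi\<^sub>E UNIV (\<lambda>\<psi>. {- (norm \<psi> * R)..norm \<psi> * R})" for k
  proof -
    have "\<bar>blinfun_apply \<psi> (y k)\<bar> \<le> norm \<psi> * R" for \<psi>
      using norm_blinfun[of \<psi> "y k"] mult_left_mono[OF R[of k], of "norm \<psi>"] by simp
    then show ?thesis by (auto simp: F_def PiE_iff abs_le_iff minus_le_iff)
  qed
  obtain \<Phi> where \<Phi>: "\<forall>U. open U \<longrightarrow> \<Phi> \<in> U \<longrightarrow> (\<exists>\<^sub>F k in sequentially. F k \<in> U)"
    by (rule compact_imp_cluster_point[OF compact_PiE_UNIV[OF compact_Icc] box])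
  define S where "S \<Psi> \<epsilon> = {k. \<forall>\<psi>\<in>\<Psi>. \<bar>blinfun_apply \<psi> (y k) - \<Phi> \<psi>\<bar> < \<epsilon>}" for \<Psi> and \<epsilon> :: real
  have freq: "\<exists>\<^sub>F k in sequentially. k \<in> S \<Psi> \<epsilon>" if "finite \<Psi>" "\<epsilon> > 0" for \<Psi> \<epsilon>
  proof -
    define U where "U = (\<Inter>\<psi>\<in>\<Psi>. {F :: ('e \<Rightarrow>\<^sub>L real) \<Rightarrow> real. \<bar>F \<psi> - \<Phi> \<psi>\<bar> < \<epsilon>})"
    have "open U"
      unfolding U_def using that(1)
      by (intro open_INT ballI open_Collect_less continuous_intros continuous_on_product_coordinates) simp
    moreover have "\<Phi> \<in> U" using that(2) by (simp add: U_def)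
    ultimately have "\<exists>\<^sub>F k in sequentially. F k \<in> U" by (rule \<Phi>[rule_format])
    moreover have "F k \<in> U \<longleftrightarrow> k \<in> S \<Psi> \<epsilon>" for k by (simp add: U_def S_def F_def)
    ultimately show ?thesis by simp
  qed
  define \<C> where "\<C> = {convex hull (y ` S \<Psi> \<epsilon>) | \<Psi> \<epsilon>. finite \<Psi> \<and> \<epsilon> > 0}"
  have \<C>I: "convex hull (y ` S \<Psi> \<epsilon>) \<in> \<C>" if "finite \<Psi>" "\<epsilon> > 0" for \<Psi> \<epsilon> using that by (auto simp: \<C>_def)
  have \<C>E: "\<exists>\<Psi> \<epsilon>. A = convex hull (y ` S \<Psi> \<epsilon>) \<and> finite \<Psi> \<and> \<epsilon> > 0" if "A \<in> \<C>" for A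
    using that by (auto simp: \<C>_def)
  obtain l where l: "\<forall>A\<in>\<C>. l \<in> closure A"
  proof (rule directed_convex_sets_cluster[OF compl, of \<C>])
    show "\<C> \<noteq> {}" using \<C>I[of "{}" 1] by auto
    show "A \<noteq> {}" if "A \<in> \<C>" for A
    proof -
      obtain \<Psi> \<epsilon> where A: "A = convex hull (y ` S \<Psi> \<epsilon>)" "finite \<Psi>" "\<epsilon> > 0" using \<C>E \<open>A \<in> \<C>\<close> by blast
      then obtain k where "k \<in> S \<Psi> \<epsilon>" using frequently_ex[OF freq] by blast
      then show ?thesis using A(1) by auto
    qed
    show "convex A" if "A \<in> \<C>" for A using \<C>E[OF that] by (auto simp: convex_convex_hull)
    show "\<exists>D\<in>\<C>. D \<subseteq> A \<inter> B" if "A \<in> \<C>" "B \<in> \<C>" for A B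
    proof -
      obtain \<Psi> \<epsilon> where A: "A = convex hull (y ` S \<Psi> \<epsilon>)" "finite \<Psi>" "\<epsilon> > 0" using \<C>E \<open>A \<in> \<C>\<close> by blast
      obtain \<Psi>' \<epsilon>' where B: "B = convex hull (y ` S \<Psi>' \<epsilon>')" "finite \<Psi>'" "\<epsilon>' > 0" using \<C>E \<open>B \<in> \<C>\<close> by blast
      have "S (\<Psi> \<union> \<Psi>') (min \<epsilon> \<epsilon>') \<subseteq> S \<Psi> \<epsilon>" "S (\<Psi> \<union> \<Psi>') (min \<epsilon> \<epsilon>') \<subseteq> S \<Psi>' \<epsilon>'" by (auto simp: S_def)
      then have "convex hull (y ` S (\<Psi> \<union> \<Psi>') (min \<epsilon> \<epsilon>')) \<subseteq> A \<inter> B"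
        unfolding A(1) B(1) by (intro Int_greatest hull_mono image_mono)
      moreover have "convex hull (y ` S (\<Psi> \<union> \<Psi>') (min \<epsilon> \<epsilon>')) \<in> \<C>" using A B by (intro \<C>I) auto
      ultimately show ?thesis by blast
    qed
    show "\<exists>n. \<forall>A\<in>\<C>. \<forall>x\<in>A. excess \<mu> g n (\<Theta> x) \<le> 1 / real (Suc j)" for j
    proof -
      obtain n where n: "\<And>k. excess \<mu> g n (\<Theta> (y k)) \<le> 1 / real (Suc j)" using equi by blast
      have "A \<subseteq> {x. excess \<mu> g n (\<Theta> x) \<le> 1 / real (Suc j)}" if "A \<in> \<C>" for A
      proof -
        obtain \<Psi> \<epsilon> where "A = convex hull (y ` S \<Psi> \<epsilon>)" using \<C>E \<open>A \<in> \<C>\<close> by blast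
        then show ?thesis by (simp only:) (rule hull_minimal, use n in blast, rule convex_small_excess)
      qed
      then show ?thesis by blast
    qed
  qed
  have l\<Phi>: "blinfun_apply \<psi> l = \<Phi> \<psi>" for \<psi>
  proof -
    have le_\<epsilon>: "\<bar>blinfun_apply \<psi> l - \<Phi> \<psi>\<bar> \<le> \<epsilon>" if "\<epsilon> > 0" for \<epsilon>
    proof -
      define H where "H = {x. \<bar>blinfun_apply \<psi> x - \<Phi> \<psi>\<bar> \<le> \<epsilon>}"
      have "closed H" unfolding H_def by (intro closed_Collect_le continuous_intros)
      have "H = blinfun_apply \<psi> -` cball (\<Phi> \<psi>) \<epsilon>" by (auto simp: H_def dist_real_def abs_minus_commute)
      then have "convex H"
        by (simp add: convex_linear_vimage[OF bounded_linear.linear[OF blinfun.bounded_linear_right]])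
      then have "convex hull (y ` S {\<psi>} \<epsilon>) \<subseteq> H"
        by (intro hull_minimal) (auto simp: S_def H_def)
      then have "closure (convex hull (y ` S {\<psi>} \<epsilon>)) \<subseteq> H" using \<open>closed H\<close> by (rule closure_minimal)
      then show ?thesis using bspec[OF l \<C>I[of "{\<psi>}" \<epsilon>]] that by (auto simp: H_def)
    qed
    have "\<bar>blinfun_apply \<psi> l - \<Phi> \<psi>\<bar> \<le> 0" by (rule field_le_epsilon) (use le_\<epsilon> in simp)
    then show ?thesis by simp
  qed
  have "\<exists>\<^sub>F k in sequentially. y k \<in> U" if U: "openin weak_topology U" "l \<in> U" for U
  proof -
    obtain \<Psi> \<epsilon> where \<Psi>: "finite \<Psi>" "\<forall>\<psi>\<in>\<Psi>. bounded_linear \<psi>" "\<epsilon> > 0" "weak_nbhd \<Psi> \<epsilon> l \<subseteq> U"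
      using U by (rule weak_topology_nhd)
    have inS: "y k \<in> weak_nbhd \<Psi> \<epsilon> l" if k: "k \<in> S (Blinfun ` \<Psi>) \<epsilon>" for k
      unfolding weak_nbhd_def
    proof (intro CollectI ballI)
      fix \<psi> assume \<psi>: "\<psi> \<in> \<Psi>"
      then have "blinfun_apply (Blinfun \<psi>) = \<psi>" using \<Psi>(2) by (simp add: bounded_linear_Blinfun_apply)
      then show "\<bar>\<psi> (y k) - \<psi> l\<bar> < \<epsilon>" using k \<psi> l\<Phi>[of "Blinfun \<psi>"] by (auto simp: S_def)
    qed
    have "y k \<in> U" if "k \<in> S (Blinfun ` \<Psi>) \<epsilon>" for k by (rule subsetD[OF \<Psi>(4) inS[OF that]])
    moreover have "\<exists>\<^sub>F k in sequentially. k \<in> S (Blinfun ` \<Psi>) \<epsilon>" using \<Psi>(1,3) by (intro freq) auto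
    ultimately show ?thesis by (rule frequently_elim1[rotated])
  qed
  then show ?thesis by blast
qed

lemma weakly_convergent_imp_equiintegrable:
  fixes y :: "nat \<Rightarrow> 'e"
  assumes lim: "limitin weak_topology y l sequentially" and "\<epsilon> > 0"
  shows "\<exists>n. \<forall>k. excess \<mu> g n (\<Theta> (y k)) \<le> \<epsilon>"
proof -
  define f where "f k = \<Theta> (y k - l)" for k
  have "\<exists>n. \<forall>k. excess \<mu> g n (f k) \<le> \<epsilon> / 2"
  proof (rule weakly_null_imp_equiintegrable[OF int_g g_nonneg])
    show "integrable \<mu> (f k)" for k by (simp add: f_def int_\<Theta>)
    show "\<exists>n. excess \<mu> g n (f k) \<le> \<eta>" if "\<eta> > 0" for k \<eta>
      using that by (intro weight) (simp_all add: f_def int_\<Theta>)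
    show "0 < \<epsilon> / 2" using \<open>\<epsilon> > 0\<close> by simp
    fix b :: "'w \<Rightarrow> real" assume b: "b \<in> borel_measurable \<mu>" "\<And>w. \<bar>b w\<bar> \<le> 1"
    note b(1)[measurable]
    have le: "\<bar>b w * \<Theta> x w\<bar> \<le> \<bar>\<Theta> x w\<bar>" for x w using b(2)[of w] by (simp add: abs_mult mult_left_le_one_le)
    have int_b: "integrable \<mu> (\<lambda>w. b w * \<Theta> x w)" for x by (rule integrable_bounded_mult[OF int_\<Theta> b])
    define \<psi> where "\<psi> x = (\<integral>w. b w * \<Theta> x w \<partial>\<mu>)" for x
    have \<psi>: "bounded_linear \<psi>"
    proof (rule bounded_linear_intro)
      show "\<psi> (x + x') = \<psi> x + \<psi> x'" for x x'
      proof -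
        have "\<psi> (x + x') = (\<integral>w. b w * \<Theta> x w + b w * \<Theta> x' w \<partial>\<mu>)"
          unfolding \<psi>_def
        proof (rule integral_cong_AE)
          show "AE w in \<mu>. b w * \<Theta> (x + x') w = b w * \<Theta> x w + b w * \<Theta> x' w"
            using \<Theta>_add[of x x'] by eventually_elim (simp add: distrib_left)
        qed measurable
        then show ?thesis using int_b by (simp add: \<psi>_def)
      qed
      show "\<psi> (a *\<^sub>R x) = a *\<^sub>R \<psi> x" for a x
      proof -
        have "\<psi> (a *\<^sub>R x) = (\<integral>w. a * (b w * \<Theta> x w) \<partial>\<mu>)"
          unfolding \<psi>_def
        proof (rule integral_cong_AE)
          show "AE w in \<mu>. b w * \<Theta> (a *\<^sub>R x) w = a * (b w * \<Theta> x w)"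
            using \<Theta>_scale[of a x] by eventually_elim simp
        qed measurable
        then show ?thesis by (simp add: \<psi>_def)
      qed
      show "norm (\<psi> x) \<le> norm x * C" for x
      proof -
        have "norm (\<psi> x) \<le> (\<integral>w. \<bar>b w * \<Theta> x w\<bar> \<partial>\<mu>)" unfolding \<psi>_def real_norm_def by (rule integral_abs_bound)
        also have "\<dots> \<le> (\<integral>w. \<bar>\<Theta> x w\<bar> \<partial>\<mu>)" using int_b int_\<Theta> le by (intro integral_mono) auto
        also have "\<dots> \<le> norm x * C" using upper[of x] by (simp add: mult.commute)
        finally show ?thesis .
      qed
    qed
    then have "(\<lambda>k. \<psi> (y k)) \<longlonglongrightarrow> \<psi> l" using lim unfolding limitin_weak_iff by blast
    then have "(\<lambda>k. \<psi> (y k) - \<psi> l) \<longlonglongrightarrow> 0" by (rule LIM_zero)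
    moreover have "\<psi> (y k) - \<psi> l = (\<integral>w. b w * f k w \<partial>\<mu>)" for k
      using linear_diff[OF bounded_linear.linear[OF \<psi>], of "y k" l] by (simp add: \<psi>_def f_def)
    ultimately show "(\<lambda>k. \<integral>w. b w * f k w \<partial>\<mu>) \<longlonglongrightarrow> 0" by simp
  qed
  then obtain n where n: "\<And>k. excess \<mu> g n (f k) \<le> \<epsilon> / 2" by blast
  obtain m where m: "excess \<mu> g m (\<Theta> l) \<le> \<epsilon> / 2" using weight[OF int_\<Theta>, of "\<epsilon> / 2"] \<open>\<epsilon> > 0\<close> by auto
  have "excess \<mu> g (n + m) (\<Theta> (y k)) \<le> \<epsilon>" for k
  proof -
    have "AE w in \<mu>. \<Theta> (y k) w = f k w + \<Theta> l w"
      using \<Theta>_diff[of "y k" l] by eventually_elim (simp add: f_def)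
    then have "excess \<mu> g (n + m) (\<Theta> (y k)) \<le> excess \<mu> g n (f k) + excess \<mu> g m (\<Theta> l)"
      by (intro excess_add) (simp_all add: f_def int_\<Theta> int_g)
    then show ?thesis using n[of k] m by linarith
  qed
  then show ?thesis by blast
qed

end

section \<open>Excluding the six conditions\<close>

lemma (in C_p_weak_homeomorphism) not_homeomorphic_if_embeds_into_L1:
  fixes \<mu> :: "'w measure"
  assumes p: "p islimpt (UNIV :: 'm set)" and compl: "complete (UNIV :: 'e set)"
    and "separable_L1 \<mu>" "embeds_into_L1 TYPE('e) \<mu>"
  shows False
proof -
  obtain g where g: "integrable \<mu> g" "\<And>w. 0 \<le> g w"
    "\<And>f \<epsilon>. integrable \<mu> f \<Longrightarrow> \<epsilon> > 0 \<Longrightarrow> \<exists>n. excess \<mu> g n f \<le> \<epsilon>"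
    using separable_L1_weight[OF \<open>separable_L1 \<mu>\<close>] by metis
  obtain \<Theta> :: "'e \<Rightarrow> 'w \<Rightarrow> real" and c C where \<Theta>: "\<forall>x. integrable \<mu> (\<Theta> x)"
    "\<forall>x y. AE w in \<mu>. \<Theta> (x + y) w = \<Theta> x w + \<Theta> y w" "\<forall>a x. AE w in \<mu>. \<Theta> (a *\<^sub>R x) w = a * \<Theta> x w"
    "c > 0" "\<forall>x. c * norm x \<le> (\<integral>w. \<bar>\<Theta> x w\<bar> \<partial>\<mu>) \<and> (\<integral>w. \<bar>\<Theta> x w\<bar> \<partial>\<mu>) \<le> C * norm x"
    using \<open>embeds_into_L1 TYPE('e) \<mu>\<close> unfolding embeds_into_L1_def by auto
  interpret weighted_L1_embedding \<Theta> \<mu> c C g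
    by unfold_locales (use \<Theta> g in auto)
  define A where "A j n = {x. excess \<mu> g n (\<Theta> x) \<le> 1 / real (Suc j)}" for j n
  show False
  proof (rule not_strongly_dominated[OF p, of A])
    show "A j m \<subseteq> A j n" if "m \<le> n" for j m n
    proof
      fix x assume "x \<in> A j m"
      then show "x \<in> A j n"
        using excess_antimono[OF int_\<Theta>[of x] int_g g_nonneg that] by (simp add: A_def)
    qed
    show "\<exists>n. \<forall>k. y k \<in> A j n" if "limitin weak_topology y l sequentially" for y l j
      using weakly_convergent_imp_equiintegrable[OF that, of "1 / real (Suc j)"] by (simp add: A_def)
    show "\<exists>l. \<forall>U. openin weak_topology U \<longrightarrow> l \<in> U \<longrightarrow> (\<exists>\<^sub>F k in sequentially. y k \<in> U)"
      if "\<forall>j. \<exists>n. \<forall>k. y k \<in> A j n" for y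
      using that by (intro equiintegrable_has_weak_cluster_point[OF compl]) (simp add: A_def)
  qed
qed

lemma (in C_p_weak_homeomorphism) not_homeomorphic_if_schur:
  assumes p: "p islimpt (UNIV :: 'm set)" and compl: "complete (UNIV :: 'e set)"
    and Q: "countable Q" "closure Q = (UNIV :: 'e set)" and schur: "schur_property TYPE('e)"
  shows False
proof -
  obtain d :: "nat \<Rightarrow> 'e" where near: "\<forall>e. \<forall>\<rho>>0. \<exists>i. dist (d i) e < \<rho>" by (rule dense_sequence[OF Q])
  define A where "A j n = (\<Union>i\<le>n. cball (d i) (1 / real (Suc j)))" for j n
  have A_mono: "A j m \<subseteq> A j n" if "m \<le> n" for j m n
    unfolding A_def using that by (intro UN_mono) auto
  show False
  proof (rule not_strongly_dominated[OF p A_mono])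
    show "\<exists>n. \<forall>k. y k \<in> A j n" if "limitin weak_topology y l sequentially" for y l j
    proof -
      define \<rho> where "\<rho> = 1 / real (Suc j)"
      have \<rho>: "\<rho> > 0" by (simp add: \<rho>_def)
      have "y \<longlonglongrightarrow> l" using schur that unfolding schur_property_def by blast
      then obtain K where K: "\<And>k. k \<ge> K \<Longrightarrow> dist (y k) l < \<rho> / 2"
        using \<rho> by (metis half_gt_zero lim_sequentially)
      obtain i0 where i0: "dist (d i0) l < \<rho> / 2" using near[rule_format, OF half_gt_zero[OF \<rho>]] by blast
      have "\<forall>k. \<exists>i. dist (d i) (y k) < \<rho>" using near \<rho> by blast
      then obtain i where i: "\<And>k. dist (d (i k)) (y k) < \<rho>" by metis
      define n where "n = Max (insert i0 (i ` {..<K}))"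
      have "y k \<in> A j n" for k
      proof (cases "k < K")
        case True
        then have "i k \<in> insert i0 (i ` {..<K})" by simp
        then have "i k \<le> n" unfolding n_def by (intro Max_ge) auto
        then show ?thesis using i[of k] by (auto simp: A_def \<rho>_def intro!: bexI[of _ "i k"] less_imp_le)
      next
        case False
        then have "dist (d i0) (y k) < \<rho>"
          using K[of k] i0 dist_triangle2[of "d i0" "y k" l] by simp
        moreover have "i0 \<le> n" by (simp add: n_def)
        ultimately show ?thesis by (auto simp: A_def \<rho>_def intro!: bexI[of _ i0] less_imp_le)
      qed
      then show ?thesis by blast
    qed
    show "\<exists>l. \<forall>U. openin weak_topology U \<longrightarrow> l \<in> U \<longrightarrow> (\<exists>\<^sub>F k in sequentially. y k \<in> U)"
      if y: "\<forall>j. \<exists>n. \<forall>k. y k \<in> A j n" for y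
    proof -
      have cov: "\<exists>n. \<forall>k>j. y k \<in> (\<Union>i\<le>n. cball (d i) (1 / real (Suc j)))" for j
        using y unfolding A_def by metis
      obtain l r where r: "strict_mono r" "(\<lambda>k. y (r k)) \<longlonglongrightarrow> l"
        by (rule convergent_subsequence_of_finite_covers[OF compl cov])
      have "\<exists>\<^sub>F k in sequentially. y k \<in> U" if U: "openin weak_topology U" "l \<in> U" for U
      proof -
        have "\<forall>\<^sub>F k in sequentially. y (r k) \<in> U"
          by (rule topological_tendstoD[OF r(2) openin_weak_imp_open[OF U(1)] U(2)])
        then obtain K where K: "\<And>k. k \<ge> K \<Longrightarrow> y (r k) \<in> U" by (auto simp: eventually_sequentially)
        show ?thesis
          unfolding frequently_sequentially
        proof
          fix N
          have "N \<le> r (max N K)" using seq_suble[OF r(1), of "max N K"] by simp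
          then show "\<exists>k\<ge>N. y k \<in> U" using K[of "max N K"] by auto
        qed
      qed
      then show ?thesis by blast
    qed
  qed
qed

lemma not_scattered_imp_limit_point:
  assumes "\<not> scattered (UNIV :: 'a::topological_space set)"
  shows "\<exists>p :: 'a. p islimpt UNIV"
proof (rule ccontr)
  assume no: "\<nexists>p :: 'a. p islimpt UNIV"
  have "scattered (UNIV :: 'a set)"
    unfolding scattered_def
  proof (intro allI impI)
    fix A :: "'a set" assume "A \<noteq> {}"
    then obtain x where x: "x \<in> A" by blast
    obtain V where V: "x \<in> V" "open V" "\<And>y. y \<in> V \<Longrightarrow> y = x"
      using no unfolding islimpt_def by (metis UNIV_I)
    then have "V \<inter> A = {x}" using x by blast
    then show "\<exists>x. x isolated_in A" using V(2) x unfolding isolated_in_def by metis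
  qed
  with assms show False by contradiction
qed

theorem theorem4p8:
  assumes "infinite (UNIV :: 'm::metric_space set)"
    and "infinite (UNIV :: 'n::pointed_metric_space set)"
    and "(\<not> separable_space (euclidean :: 'm topology) \<or>
          \<not> separable_space (euclidean :: 'n topology)) \<or>
         countable (UNIV :: 'm set) \<or>
         scattered (UNIV :: 'm set) \<or>
         \<not> sigma_compact_space (euclidean :: 'm topology) \<or>
         schur_property TYPE('n lipschitz_free) \<or>
         (\<exists>\<mu> :: 'w measure. separable_L1 \<mu> \<and> embeds_into_L1 TYPE('n lipschitz_free) \<mu>)"
  shows "\<not> (C_p :: ('m \<Rightarrow> real) topology) homeomorphic_space
           (weak_topology :: 'n lipschitz_free topology)"
proof
  assume "(C_p :: ('m \<Rightarrow> real) topology) homeomorphic_space (weak_topology :: 'n lipschitz_free topology)"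
  then obtain h T where hT: "homeomorphic_maps (C_p :: ('m \<Rightarrow> real) topology) (weak_topology :: 'n lipschitz_free topology) h T"
    unfolding homeomorphic_space_def by blast
  interpret C_p_weak_homeomorphism h T by unfold_locales (rule hT)
  obtain S :: "'m set" where S: "countable S" "closure S = UNIV" by (rule separable_domain)
  obtain Q0 :: "'n lipschitz_free set" where Q0: "countable Q0" "weak_topology closure_of Q0 = UNIV"
    by (rule weakly_separable_codomain)
  obtain S' :: "'n set" where S': "countable S'" "closure S' = UNIV" by (rule weakly_separable_lipschitz_free[OF Q0])
  obtain Q :: "'n lipschitz_free set" where Q: "countable Q" "closure Q = UNIV" by (rule lipschitz_free_separable[OF S'])
  have "separable_space (euclidean :: 'm topology)" "separable_space (euclidean :: 'n topology)"
    unfolding separable_space_def using S S' by auto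
  moreover have unc: "uncountable (UNIV :: 'm set)"
  proof (rule uncountable_domain[OF infinite_independent_dirac[OF assms(2)] independent_dirac])
    fix m :: "'n lipschitz_free"
    assume ann: "\<And>\<psi> :: 'n lipschitz_free \<Rightarrow> real. bounded_linear \<psi> \<Longrightarrow> \<psi> m = 0"
    show "m = 0" by (rule pairing_separates) (rule ann[OF bounded_linear_pairing])
  qed
  moreover have "\<not> scattered (UNIV :: 'm set)"
    using separable_scattered_imp_countable[OF S] unc by blast
  moreover have "sigma_compact_space (euclidean :: 'm topology)"
  proof (rule sigma_compact_of_polish_parametrization[OF complete_lipschitz_free Q S continuous_T_eval])
    show "\<exists>e. T e = f" if "continuous_on UNIV f" for f using T_h[OF that] by blast
  qed
  moreover obtain p :: 'm where p: "p islimpt UNIV"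
    using not_scattered_imp_limit_point \<open>\<not> scattered (UNIV :: 'm set)\<close> by blast
  moreover have "\<not> schur_property TYPE('n lipschitz_free)"
    using not_homeomorphic_if_schur[OF p complete_lipschitz_free Q] by blast
  moreover have "\<not> (separable_L1 \<mu> \<and> embeds_into_L1 TYPE('n lipschitz_free) \<mu>)" for \<mu> :: "'w measure"
    using not_homeomorphic_if_embeds_into_L1[OF p complete_lipschitz_free] by blast
  ultimately show False using assms(3) by blast
qed

end
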